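(* Let $U$ be an open set in $\mathbb{R}^n$, $n\ge 3$, and let $\varphi:[0,\infty)\to[0,\infty)$ be an increasing function such that $\varphi(0)=0$ and $$\int_1^\infty\left[\frac{t}{\varphi(t)}\right]^{\frac{1}{n-2}}dt<\infty .$$ Let $f:U\to\mathbb{R}^m$, $m\ge 1$, be a continuous mapping in the class $W^{1,\varphi}_{\rm loc}(U)$ and let $\mathcal{P}_0$ be a fixed hyperplane in $\mathbb{R}^n$. Then for a.e. hyperplane $\mathcal{P}$ parallel to $\mathcal{P}_0$ the restriction of $f$ to $\mathcal{P}\cap U$ has the $(N)$-property (furthermore, it is locally absolutely continuous) with respect to the $(n-1)$-dimensional Hausdorff measure $H^{n-1}$. Moreover, for a.e. such $\mathcal{P}$, $H^{n-1}(f(E))=0$ whenever $|\nabla f|=0$ on $E\subset\mathcal{P}\cap U$.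
   Context: For an open set $U\subset\mathbb{R}^n$ and an increasing function $\varphi:[0,\infty)\to[0,\infty)$ (not assumed convex), $W^{1,\varphi}_{\rm loc}(U)$ is the class of locally integrable mappings $f=(f_1,\dots,f_m):U\to\mathbb{R}^m$ with $f_i\in W^{1,1}_{\rm loc}(U)$ and such that $\varphi(|\nabla f|)$ is locally integrable in $U$, where $|\nabla f(x)|=\sqrt{\sum_{i,j}(\partial f_i/\partial x_j)^2}$. "A.e. hyperplane parallel to $\mathcal{P}_0$" is with respect to one-dimensional Lebesgue measure on a line orthogonal to $\mathcal{P}_0$ (each hyperplane being identified with its intersection point with the line). The $(N)$-property (of Lusin) with respect to $H^{n-1}$ on $\mathcal{P}\cap U$ means: $E\subset\mathcal{P}\cap U$ and $H^{n-1}(E)=0$ imply $H^{n-1}(f(E))=0$. Local absolute continuity with respect to $H^{n-1}$ means: for every compact $K\subset\mathcal{P}\cap U$ and $\varepsilon>0$ there is $\delta>0$ such that $H^{n-1}(f(E))<\varepsilon$ for every measurable $E\subset K$ with $H^{n-1}(E)<\delta$. *)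

theory Defs
  imports "HOL-Analysis.Analysis"
begin

section \<open>Hausdorff measure\<close>

text \<open>
  The \<open>k\<close>-dimensional Hausdorff outer measure, defined for every subset of a metric space and
  normalised by the volume of the unit ball of dimension \<open>k\<close>.  Boundedness of the covering sets is
  required because \<^const>\<open>diameter\<close> is unspecified on unbounded sets; empty covering sets cost
  nothing even if \<open>k = 0\<close>.
\<close>

definition hausdorff_cost :: "nat \<Rightarrow> 'a::metric_space set \<Rightarrow> ennreal" where
  "hausdorff_cost k C =
     (if C = {} then 0 else ennreal (unit_ball_vol (real k) * (diameter C / 2) ^ k))"

definition hausdorff_premeasure :: "nat \<Rightarrow> real \<Rightarrow> 'a::metric_space set \<Rightarrow> ennreal" where
  "hausdorff_premeasure k \<delta> A =
     (INF C \<in> {C :: nat \<Rightarrow> 'a set. A \<subseteq> (\<Union>i. C i) \<and> (\<forall>i. bounded (C i) \<and> diameter (C i) \<le> \<delta>)}.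
        \<Sum>i. hausdorff_cost k (C i))"

definition hausdorff_measure :: "nat \<Rightarrow> 'a::metric_space set \<Rightarrow> ennreal" where
  "hausdorff_measure k A = (SUP \<delta> \<in> {0<..}. hausdorff_premeasure k \<delta> A)"

text \<open>The sets that are measurable in the sense of Caratheodory for this outer measure.\<close>

definition hausdorff_measurable :: "nat \<Rightarrow> 'a::metric_space set set" where
  "hausdorff_measurable k = lambda_system UNIV (Pow UNIV) (hausdorff_measure k)"

definition lusin_N_on ::
  "nat \<Rightarrow> 'a::metric_space set \<Rightarrow> ('a \<Rightarrow> 'b::metric_space) \<Rightarrow> bool" where
  "lusin_N_on k S f \<longleftrightarrow>
     (\<forall>E. E \<subseteq> S \<longrightarrow> hausdorff_measure k E = 0 \<longrightarrow> hausdorff_measure k (f ` E) = 0)"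

definition locally_abs_continuous_on ::
  "nat \<Rightarrow> 'a::metric_space set \<Rightarrow> ('a \<Rightarrow> 'b::metric_space) \<Rightarrow> bool" where
  "locally_abs_continuous_on k S f \<longleftrightarrow>
     (\<forall>K. compact K \<longrightarrow> K \<subseteq> S \<longrightarrow>
       (\<forall>\<epsilon>::real. \<epsilon> > 0 \<longrightarrow> (\<exists>\<delta>::real. \<delta> > 0 \<and>
         (\<forall>E. E \<subseteq> K \<longrightarrow> E \<in> hausdorff_measurable k \<longrightarrow> hausdorff_measure k E < ennreal \<delta> \<longrightarrow>
            hausdorff_measure k (f ` E) < ennreal \<epsilon>))))"


section \<open>Sobolev classes\<close>

definition locally_integrable_on ::
  "(real ^ 'n \<Rightarrow> real) \<Rightarrow> (real ^ 'n) set \<Rightarrow> bool" (infixl "locally'_integrable'_on" 50) where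
  "u locally_integrable_on U \<longleftrightarrow> (\<forall>K. compact K \<longrightarrow> K \<subseteq> U \<longrightarrow> set_integrable lebesgue K u)"

definition partial_deriv :: "'n \<Rightarrow> (real ^ 'n \<Rightarrow> real) \<Rightarrow> real ^ 'n \<Rightarrow> real" where
  "partial_deriv j g x = frechet_derivative g (at x) (axis j 1)"

primrec continuously_differentiable :: "nat \<Rightarrow> (real ^ 'n \<Rightarrow> real) \<Rightarrow> bool" where
  "continuously_differentiable 0 g \<longleftrightarrow> continuous_on UNIV g"
| "continuously_differentiable (Suc k) g \<longleftrightarrow>
     g differentiable_on UNIV \<and> (\<forall>j. continuously_differentiable k (partial_deriv j g))"

text \<open>The class \<open>C\<^sub>c\<^sup>\<infinity>(U)\<close>, each function being extended by zero to the whole space.\<close>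

definition test_function :: "(real ^ 'n) set \<Rightarrow> (real ^ 'n \<Rightarrow> real) \<Rightarrow> bool" where
  "test_function U g \<longleftrightarrow>
     (\<forall>k. continuously_differentiable k g) \<and>
     compact (closure {x. g x \<noteq> 0}) \<and> closure {x. g x \<noteq> 0} \<subseteq> U"

text \<open>\<open>v\<close> is a representative of the weak partial derivative of \<open>u\<close> in direction \<open>j\<close>.\<close>

definition weak_partial ::
  "(real ^ 'n) set \<Rightarrow> 'n \<Rightarrow> (real ^ 'n \<Rightarrow> real) \<Rightarrow> (real ^ 'n \<Rightarrow> real) \<Rightarrow> bool" where
  "weak_partial U j u v \<longleftrightarrow>
     u locally_integrable_on U \<and> v locally_integrable_on U \<and>
     (\<forall>g. test_function U g \<longrightarrow>
        (LINT x:U|lebesgue. u x * partial_deriv j g x) = - (LINT x:U|lebesgue. v x * g x))"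

definition sobolev_11_loc :: "(real ^ 'n) set \<Rightarrow> (real ^ 'n \<Rightarrow> real) \<Rightarrow> bool" where
  "sobolev_11_loc U u \<longleftrightarrow> u locally_integrable_on U \<and> (\<forall>j. \<exists>v. weak_partial U j u v)"

text \<open>
  \<open>D\<close> is a representative of the weak Jacobian matrix of \<open>f\<close>; it is determined by \<open>f\<close> only up to
  Lebesgue null subsets of \<open>U\<close>.
\<close>

definition weak_gradient ::
  "(real ^ 'n) set \<Rightarrow> (real ^ 'n \<Rightarrow> real ^ 'm) \<Rightarrow> (real ^ 'n \<Rightarrow> real ^ 'n ^ 'm) \<Rightarrow> bool" where
  "weak_gradient U f D \<longleftrightarrow> (\<forall>i j. weak_partial U j (\<lambda>x. f x $ i) (\<lambda>x. D x $ i $ j))"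

definition gradient_norm :: "real ^ 'n ^ 'm \<Rightarrow> real" where
  "gradient_norm A = sqrt (\<Sum>i\<in>UNIV. \<Sum>j\<in>UNIV. (A $ i $ j)\<^sup>2)"

lemma gradient_norm_eq_norm: "gradient_norm A = norm A"
  by (simp add: gradient_norm_def norm_vec_def L2_set_def sum_nonneg)

definition orlicz_sobolev_loc ::
  "(real \<Rightarrow> real) \<Rightarrow> (real ^ 'n) set \<Rightarrow> (real ^ 'n \<Rightarrow> real ^ 'm) \<Rightarrow> bool" where
  "orlicz_sobolev_loc \<phi> U f \<longleftrightarrow>
     (\<forall>i. sobolev_11_loc U (\<lambda>x. f x $ i)) \<and>
     (\<exists>D. weak_gradient U f D \<and> (\<lambda>x. \<phi> (gradient_norm (D x))) locally_integrable_on U)"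

text \<open>
  The power \<open>[t / \<phi>(t)]\<^sup>\<alpha>\<close> for \<open>t > 0\<close>, with the convention \<open>t / 0 = \<infinity>\<close>.  The convention only matters
  when \<open>\<phi>\<close> is nondecreasing but not strictly increasing.
\<close>

definition quotient_power :: "(real \<Rightarrow> real) \<Rightarrow> real \<Rightarrow> real \<Rightarrow> ennreal" where
  "quotient_power \<phi> \<alpha> t = (if \<phi> t = 0 then \<infinity> else ennreal ((t / \<phi> t) powr \<alpha>))"


section \<open>Almost every parallel hyperplane\<close>

definition is_hyperplane :: "'a::euclidean_space set \<Rightarrow> bool" where
  "is_hyperplane P \<longleftrightarrow> affine P \<and> aff_dim P = int DIM('a) - 1"

text \<open>
  The line \<open>{p + t *\<^sub>R e | t. True}\<close> with a unit vector \<open>e\<close> orthogonal to \<open>P\<^sub>0\<close> is parametrised by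
  arc length, so one-dimensional Lebesgue measure on it is Lebesgue measure in \<open>t\<close>; every hyperplane
  parallel to \<open>P\<^sub>0\<close> is identified with the parameter of the point where it meets the line.  The
  notion does not depend on the line, so all lines orthogonal to \<open>P\<^sub>0\<close> are admitted.
\<close>

definition ae_parallel_hyperplane ::
  "'a::euclidean_space set \<Rightarrow> ('a set \<Rightarrow> bool) \<Rightarrow> bool" where
  "ae_parallel_hyperplane P\<^sub>0 Q \<longleftrightarrow>
     (\<forall>p e. norm e = 1 \<longrightarrow> (\<forall>x\<in>P\<^sub>0. \<forall>y\<in>P\<^sub>0. orthogonal e (x - y)) \<longrightarrow>
        (AE t in lebesgue. \<forall>P. affine_parallel P\<^sub>0 P \<longrightarrow> p + t *\<^sub>R e \<in> P \<longrightarrow> Q P))"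

lemma is_hyperplane_level_set:
  fixes a :: "'a::euclidean_space"
  assumes "norm a = 1"
  shows "is_hyperplane {x. a \<bullet> x = b}"
proof -
  have "a \<noteq> 0" using assms by auto
  then show ?thesis by (simp add: is_hyperplane_def affine_hyperplane aff_dim_hyperplane)
qed

lemma ae_parallel_hyperplane_level_sets:
  fixes a :: "'a::euclidean_space"
  assumes a: "norm a = 1" and ae: "ae_parallel_hyperplane {x. a \<bullet> x = b} Q"
  shows "AE c in lebesgue. Q {x. a \<bullet> x = c}"
proof -
  have aa: "a \<bullet> a = 1" using a by (simp add: norm_eq_1)
  have par: "affine_parallel {x. a \<bullet> x = b} {x. a \<bullet> x = c}" for c
  proof -
    have "\<exists>y. a \<bullet> y = b \<and> x = (a \<bullet> x - b) *\<^sub>R a + y" for x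
      by (rule exI[of _ "x - (a \<bullet> x - b) *\<^sub>R a"]) (simp add: inner_diff_right aa)
    then have "{x. a \<bullet> x = c} = (\<lambda>x. ((c - b) *\<^sub>R a) + x) ` {x. a \<bullet> x = b}"
      by (auto simp: inner_add_right aa image_iff)
    then show ?thesis unfolding affine_parallel_def by blast
  qed
  have "\<forall>x\<in>{x. a \<bullet> x = b}. \<forall>y\<in>{x. a \<bullet> x = b}. orthogonal a (x - y)"
    by (simp add: orthogonal_def inner_diff_right)
  then have "AE t in lebesgue. \<forall>P. affine_parallel {x. a \<bullet> x = b} P \<longrightarrow> 0 + t *\<^sub>R a \<in> P \<longrightarrow> Q P"
    using a ae unfolding ae_parallel_hyperplane_def by blast
  then show ?thesis
    by eventually_elim (use par aa in auto)
qed

end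

theory Submission
  imports Defs
begin

text \<open>
  Let \<open>k = n - 1\<close>.  Testing the weak derivatives with tensor products in coordinates adapted to
  \<open>P\<^sub>0\<close>, Fubini's theorem and the fundamental lemma of the calculus of variations give, on almost every
  parallel hyperplane, integration by parts against the countably many products of bumps attached to
  dyadic cubes.  On such a hyperplane the difference between the smooth means of a component of \<open>f\<close> over a
  dyadic cube of side \<open>l\<close> and over one of its children is at most \<open>C l\<^sup>1\<^sup>-\<^sup>k\<close> times the integral of
  \<open>\<bar>\<nabla>f\<bar>\<close> over the cube.  Summing over the cubes shrinking to a point bounds the oscillation of \<open>f\<close>
  by a discrete Riesz potential of \<open>\<bar>\<nabla>f\<bar>\<close>.  Splitting \<open>\<bar>\<nabla>f\<bar>\<close> into its dyadic levels and applying
  Hoelder's inequality to the sum over the levels turns this, by the integral condition on \<open>\<phi>\<close>, into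
  Calderon's estimate: \<open>(diam f(Q))\<^sup>k\<close> is at most a constant times the integral over \<open>Q\<close> of
  \<open>\<phi>\<^sub>*(\<bar>\<nabla>f\<bar>)\<close>, where \<open>\<phi>\<^sub>*\<close> vanishes at \<open>0\<close> and is constant just above it.  Covering a set by disjoint
  maximal dyadic cubes with small image gives \<open>H\<^sup>k(f(E)) \<le> D \<mu>(A)\<close> for every Borel set \<open>A\<close> between
  \<open>E\<close> and \<open>U\<close>, where \<open>\<mu>\<close> has density \<open>\<phi>\<^sub>*(\<bar>\<nabla>f\<bar>)\<close> on the hyperplane.  As \<open>\<mu>\<close> is absolutely continuous,
  finite on compact sets, and zero where the gradient vanishes, all the assertions follow.
\<close>

section \<open>Test functions of tensor product form\<close>

text \<open>Weak derivatives are tested on open sets of the full space, so each identity on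
  hyperplanes holds off a null set of heights that depends on the test function. Hence only
  countably many tests are allowed, which excludes cubes or balls around arbitrary points and leads
  to dyadic cubes with one fixed smooth profile; continuity of \<open>f\<close> then recovers every
  point of the hyperplane. The profile is the derivative of a smooth step. In one coordinate, child
  and parent profile both have mass 1, so their difference has a compactly supported primitive
  bounded by 1. Exchanging the coordinates one at a time therefore bounds the difference of two
  means by the gradient alone. The exponent 1/(n - 2) is 1/(k - 1). The kernel l^(1-k), integrated
  over a set E, gives a multiple of |E|^(1/k); for the levels E_i of the gradient this leaves the
  sum of 2^i |E_i|^(1/k). Hoelder's exponents k and k/(k - 1) separate \<phi>(2^i) |E_i| from 2^i
  (2^i / \<phi>(2^i))^(1/(k-1)), and the latter terms are essentially a Riemann sum of the integral
  in the hypothesis.\<close>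

primrec smooth_upto :: "nat \<Rightarrow> (real \<Rightarrow> real) \<Rightarrow> bool" where
  "smooth_upto 0 g \<longleftrightarrow> continuous_on UNIV g"
| "smooth_upto (Suc k) g \<longleftrightarrow>
     (\<exists>g'. (\<forall>x. (g has_real_derivative g' x) (at x)) \<and> smooth_upto k g')"

lemma smooth_upto_continuous: "smooth_upto k g \<Longrightarrow> continuous_on UNIV g"
  by (cases k) (auto intro!: continuous_at_imp_continuous_on intro: DERIV_isCont)

lemma smooth_upto_Suc: "smooth_upto (Suc k) g \<Longrightarrow> smooth_upto k g"
proof (induction k arbitrary: g)
  case 0
  then show ?case using smooth_upto_continuous by (simp only: smooth_upto.simps(1))
next
  case (Suc k)
  then obtain g' where "\<forall>x. (g has_real_derivative g' x) (at x)" "smooth_upto (Suc k) g'"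
    by (subst (asm) smooth_upto.simps(2)) blast
  then show ?case using Suc.IH by (auto simp: smooth_upto.simps(2))
qed

lemma smooth_upto_add:
  "smooth_upto k f \<Longrightarrow> smooth_upto k g \<Longrightarrow> smooth_upto k (\<lambda>x. f x + g x)"
proof (induction k arbitrary: f g)
  case 0
  then show ?case by (auto intro!: continuous_intros)
next
  case (Suc k)
  then obtain f' g' where "\<forall>x. (f has_real_derivative f' x) (at x)" "smooth_upto k f'"
    "\<forall>x. (g has_real_derivative g' x) (at x)" "smooth_upto k g'" by auto
  then show ?case using Suc.IH
    by (auto intro!: exI[of _ "\<lambda>x. f' x + g' x"] derivative_eq_intros)
qed

lemma smooth_upto_mult:
  "smooth_upto k f \<Longrightarrow> smooth_upto k g \<Longrightarrow> smooth_upto k (\<lambda>x. f x * g x)"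
proof (induction k arbitrary: f g)
  case 0
  then show ?case by (auto intro!: continuous_intros)
next
  case (Suc k)
  then obtain f' g' where fg: "\<forall>x. (f has_real_derivative f' x) (at x)" "smooth_upto k f'"
    "\<forall>x. (g has_real_derivative g' x) (at x)" "smooth_upto k g'" by auto
  have "smooth_upto k (\<lambda>x. f' x * g x + g' x * f x)"
    using fg Suc smooth_upto_Suc by (intro smooth_upto_add Suc.IH) blast+
  then show ?case using fg
    by (auto intro!: exI[of _ "\<lambda>x. f' x * g x + g' x * f x"] derivative_eq_intros)
qed

lemma smooth_upto_const: "smooth_upto k (\<lambda>x. c)"
  by (induction k arbitrary: c) (auto intro!: exI[of _ "\<lambda>x. 0"])

lemma smooth_upto_diff:
  assumes "smooth_upto k f" "smooth_upto k g" shows "smooth_upto k (\<lambda>x. f x - g x)"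
proof -
  have "smooth_upto k (\<lambda>x. f x + (-1) * g x)"
    by (intro smooth_upto_add smooth_upto_mult smooth_upto_const assms)
  then show ?thesis by simp
qed

lemma smooth_upto_affine:
  "smooth_upto k f \<Longrightarrow> smooth_upto k (\<lambda>x. f (a * x + b))"
proof (induction k arbitrary: f)
  case 0
  then show ?case
    by (auto intro!: continuous_on_compose2[of UNIV f] continuous_intros)
next
  case (Suc k)
  then obtain f' where f: "\<forall>x. (f has_real_derivative f' x) (at x)" "smooth_upto k f'" by auto
  have "smooth_upto k (\<lambda>x. f' (a * x + b) * a)"
    using f Suc by (intro smooth_upto_mult smooth_upto_const) auto
  moreover have "((\<lambda>x. f (a * x + b)) has_real_derivative f' (a * x + b) * a) (at x)" for x
    by (rule DERIV_chain2[of f "f' (a * x + b)"]) (use f in \<open>auto intro!: derivative_eq_intros\<close>)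
  ultimately show ?case by (auto intro!: exI[of _ "\<lambda>x. f' (a * x + b) * a"])
qed

lemma smooth_upto_inverse:
  assumes "\<And>x. g x \<noteq> 0" shows "smooth_upto k g \<Longrightarrow> smooth_upto k (\<lambda>x. inverse (g x))"
proof (induction k)
  case 0
  then show ?case using assms by (auto intro!: continuous_intros)
next
  case (Suc k)
  then obtain g' where g: "\<forall>x. (g has_real_derivative g' x) (at x)" "smooth_upto k g'" by auto
  have "smooth_upto k (\<lambda>x. (-1) * (g' x * (inverse (g x) * inverse (g x))))"
    using g Suc smooth_upto_Suc
    by (intro smooth_upto_mult smooth_upto_const) blast+
  moreover have "((\<lambda>x. inverse (g x)) has_real_derivative
      (-1) * (g' x * (inverse (g x) * inverse (g x)))) (at x)" for x
    by (rule derivative_eq_intros g(1)[rule_format] assms refl)+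
       (simp add: mult_ac)
  ultimately show ?case by (auto intro!: exI[of _ "\<lambda>x. (-1) * (g' x * (inverse (g x) * inverse (g x)))"])
qed

section \<open>Flat functions, a smooth step and the bump that is its derivative\<close>

definition flat :: "nat \<Rightarrow> real \<Rightarrow> real" where
  "flat n t = (if t > 0 then exp (- 1 / t) / t ^ n else 0)"

lemma flat_nonneg: "flat n t \<ge> 0"
  by (simp add: flat_def)

lemma flat_le_0: "t \<le> 0 \<Longrightarrow> flat n t = 0"
  by (simp add: flat_def)

lemma flat_pos: "t > 0 \<Longrightarrow> flat n t > 0"
  by (simp add: flat_def)

lemma flat_0_le_1: "flat 0 t \<le> 1"
  by (simp add: flat_def)

text \<open>From the right, the substitution of \<open>inverse x\<close> turns the claim into the
  decay of powers against the exponential. The limit at 0 is needed for all \<open>n\<close> at once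
  because it yields the derivative at 0 of the preceding member of the family.\<close>

lemma flat_tendsto_0: "(flat n \<longlongrightarrow> 0) (at 0)"
proof -
  have "((\<lambda>x::real. inverse x ^ n / exp (inverse x)) \<longlongrightarrow> 0) (at_right 0)"
    by (rule filterlim_compose[OF tendsto_power_div_exp_0 filterlim_inverse_at_top_right])
  moreover have "eventually (\<lambda>x. inverse x ^ n / exp (inverse x) = flat n x) (at_right 0)"
    by (rule eventually_at_right_less[THEN eventually_mono])
       (simp add: flat_def exp_minus field_simps)
  ultimately have "(flat n \<longlongrightarrow> 0) (at_right 0)"
    by (rule Lim_transform_eventually)
  moreover have "(flat n \<longlongrightarrow> 0) (at_left 0)"
    by (rule tendsto_eventually) (auto simp: eventually_at_left_field flat_def intro: exI[of _ "-1"])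
  ultimately show ?thesis by (simp add: filterlim_at_split)
qed

lemma flat_deriv:
  "(flat n has_real_derivative flat (n + 2) t - real n * flat (n + 1) t) (at t)"
proof -
  consider "t > 0" | "t < 0" | "t = 0" by linarith
  then show ?thesis
  proof cases
    case 1
    have "((\<lambda>t. exp (- 1 / t) / t ^ n) has_real_derivative
        flat (n + 2) t - real n * flat (n + 1) t) (at t)"
      using 1
      apply (auto intro!: derivative_eq_intros simp: flat_def)
      apply (cases n)
       apply (auto simp: field_simps power2_eq_square)
      done
    then show ?thesis
      by (rule has_field_derivative_transform_within_open[where S="{0<..}"])
         (use 1 in \<open>auto simp: flat_def\<close>)
  next
    case 2
    have "((\<lambda>t. 0) has_real_derivative flat (n + 2) t - real n * flat (n + 1) t) (at t)"
      using 2 by (simp add: flat_le_0)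
    then show ?thesis
      by (rule has_field_derivative_transform_within_open[where S="{..<0}"])
         (use 2 in \<open>auto simp: flat_def\<close>)
  next
    case 3
    \<comment> \<open>The difference quotient at 0 is the next member of the family.\<close>
    have "eventually (\<lambda>y. flat (n + 1) y = (flat n y - flat n 0) / (y - 0)) (at 0)"
      by (auto simp: eventually_at_filter flat_def)
    then have "((\<lambda>y. (flat n y - flat n 0) / (y - 0)) \<longlongrightarrow> 0) (at 0)"
      by (rule Lim_transform_eventually[OF flat_tendsto_0])
    then show ?thesis using 3 by (simp add: has_field_derivative_iff flat_le_0)
  qed
qed

text \<open>The derivative of one member is a combination of two later ones, so a single induction
  on the order, generalised over the index, treats the whole family.\<close>

lemma smooth_upto_flat: "smooth_upto k (flat n)"
proof (induction k arbitrary: n)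
  case 0
  then show ?case by (auto intro!: continuous_at_imp_continuous_on DERIV_isCont flat_deriv)
next
  case (Suc k)
  have "smooth_upto k (\<lambda>t. flat (n + 2) t - real n * flat (n + 1) t)"
    by (intro smooth_upto_diff smooth_upto_mult smooth_upto_const Suc)
  then show ?case unfolding smooth_upto.simps
    by (intro exI[of _ "\<lambda>t. flat (n + 2) t - real n * flat (n + 1) t"] conjI allI flat_deriv)
qed

definition smooth_step :: "real \<Rightarrow> real" where
  "smooth_step t = flat 0 t / (flat 0 t + flat 0 (1 - t))"

text \<open>This is the quotient rule for \<open>smooth_step\<close> written out. Obtaining the bump
  as a derivative makes its mass exactly 1 and supplies an explicit primitive.\<close>

definition bump :: "real \<Rightarrow> real" where
  "bump t = (flat 2 t * flat 0 (1 - t) + flat 0 t * flat 2 (1 - t)) / (flat 0 t + flat 0 (1 - t))\<^sup>2"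

lemma step_denominator_pos: "flat 0 t + flat 0 (1 - t) > 0"
  using flat_pos[of t 0] flat_pos[of "1 - t" 0] flat_nonneg[of 0 t] flat_nonneg[of 0 "1 - t"]
  by (cases "t > 0") auto

lemma flat_affine_deriv:
  "((\<lambda>t. flat n (1 - t)) has_real_derivative
     - (flat (n + 2) (1 - t) - real n * flat (n + 1) (1 - t))) (at t)"
  by (rule DERIV_cong[OF DERIV_chain2[OF flat_deriv, where g = "\<lambda>t. 1 - t"]])
     (auto intro!: derivative_eq_intros)

lemma smooth_step_deriv: "(smooth_step has_real_derivative bump t) (at t)"
  unfolding smooth_step_def
  apply (rule DERIV_cong)
   apply (rule derivative_intros flat_deriv flat_affine_deriv)+
  using step_denominator_pos[of t] apply simp
  apply (simp add: bump_def power2_eq_square algebra_simps numeral_2_eq_2)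
  done

lemma smooth_upto_smooth_step: "smooth_upto k smooth_step"
proof -
  have 1: "smooth_upto k (\<lambda>t. flat 0 (1 - t))"
    using smooth_upto_affine[OF smooth_upto_flat, of k 0 "-1" 1] by simp
  have "smooth_upto k (\<lambda>t. flat 0 t * inverse (flat 0 t + flat 0 (1 - t)))"
    by (intro smooth_upto_mult smooth_upto_inverse smooth_upto_add 1 smooth_upto_flat)
       (metis step_denominator_pos less_irrefl)
  then show ?thesis by (simp add: smooth_step_def[abs_def] field_simps)
qed

lemma smooth_upto_bump: "smooth_upto k bump"
proof -
  have 1: "smooth_upto k (\<lambda>t. flat n (1 - t))" for n
    using smooth_upto_affine[OF smooth_upto_flat, of k n "-1" 1] by simp
  have "smooth_upto k (\<lambda>t. (flat 2 t * flat 0 (1 - t) + flat 0 t * flat 2 (1 - t)) *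
      (inverse (flat 0 t + flat 0 (1 - t)) * inverse (flat 0 t + flat 0 (1 - t))))"
    by (intro smooth_upto_mult smooth_upto_inverse smooth_upto_add 1 smooth_upto_flat)
       (metis step_denominator_pos less_irrefl)+
  then show ?thesis by (simp add: bump_def[abs_def] field_simps power2_eq_square)
qed

lemma smooth_step_le_0: "t \<le> 0 \<Longrightarrow> smooth_step t = 0"
  by (simp add: smooth_step_def flat_le_0)

lemma smooth_step_ge_1: "t \<ge> 1 \<Longrightarrow> smooth_step t = 1"
  using step_denominator_pos[of t] by (simp add: smooth_step_def flat_le_0)

lemma smooth_step_bounds: "0 \<le> smooth_step t" "smooth_step t \<le> 1"
  using step_denominator_pos[of t] flat_nonneg[of 0 t] flat_nonneg[of 0 "1 - t"]
  by (simp_all add: smooth_step_def)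

lemma bump_eq_0: "t \<le> 0 \<or> t \<ge> 1 \<Longrightarrow> bump t = 0"
  by (auto simp: bump_def flat_le_0)

lemma bump_nonneg: "bump t \<ge> 0"
  by (simp add: bump_def flat_nonneg)

lemma bump_continuous: "continuous_on S bump"
  using smooth_upto_continuous[OF smooth_upto_bump] continuous_on_subset by blast

lemma bump_bounded: "\<exists>B\<ge>1. \<forall>t. bump t \<le> B"
proof -
  have "compact (bump ` {0..1})"
    by (intro compact_continuous_image bump_continuous compact_Icc)
  then obtain B where B: "\<forall>y\<in>bump ` {0..1}. norm y \<le> B"
    using compact_imp_bounded bounded_iff by blast
  have "bump t \<le> max B 1" for t
  proof (cases "0 \<le> t \<and> t \<le> 1")
    case True
    then have "norm (bump t) \<le> B" using B by auto
    then show ?thesis by auto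
  qed (use bump_eq_0[of t] in auto)
  then show ?thesis by (intro exI[of _ "max B 1"]) auto
qed

section \<open>Smooth functions of several variables\<close>

lemma continuously_differentiable_continuous:
  "continuously_differentiable k g \<Longrightarrow> continuous_on UNIV g"
  by (cases k) (auto intro: differentiable_imp_continuous_on)

lemma continuously_differentiable_Suc:
  "continuously_differentiable (Suc k) g \<Longrightarrow> continuously_differentiable k g"
proof (induction k arbitrary: g)
  case 0
  then show ?case
    using continuously_differentiable_continuous by (simp only: continuously_differentiable.simps(1))
next
  case (Suc k)
  then have "g differentiable_on UNIV" "continuously_differentiable (Suc k) (partial_deriv j g)" for j
    by (simp_all only: continuously_differentiable.simps(2)[of "Suc k"])
  with Suc.IH show ?case by (simp only: continuously_differentiable.simps(2)[of k] simp_thms)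
qed

lemma partial_deriv_eq:
  "(g has_derivative g') (at x) \<Longrightarrow> partial_deriv j g x = g' (axis j 1)"
  by (simp add: partial_deriv_def frechet_derivative_at[symmetric])

lemma continuously_differentiable_add:
  "continuously_differentiable k f \<Longrightarrow> continuously_differentiable k g \<Longrightarrow>
    continuously_differentiable k (\<lambda>x. f x + g x)"
proof (induction k arbitrary: f g)
  case 0
  then show ?case by (auto intro!: continuous_intros)
next
  case (Suc k)
  then have fg: "\<And>x. f differentiable at x" "\<And>x. g differentiable at x"
    by (auto simp: differentiable_on_def)
  have "partial_deriv j (\<lambda>x. f x + g x) = (\<lambda>x. partial_deriv j f x + partial_deriv j g x)" for j
  proof
    fix x
    show "partial_deriv j (\<lambda>x. f x + g x) x = partial_deriv j f x + partial_deriv j g x"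
      using fg[of x] unfolding frechet_derivative_works
      by (subst partial_deriv_eq[OF has_derivative_add]) (auto simp: partial_deriv_def)
  qed
  then show ?case using Suc
    by (auto intro!: differentiable_on_add Suc.IH)
qed

lemma continuously_differentiable_mult:
  "continuously_differentiable k f \<Longrightarrow> continuously_differentiable k g \<Longrightarrow>
    continuously_differentiable k (\<lambda>x. f x * g x)"
proof (induction k arbitrary: f g)
  case 0
  then show ?case by (auto intro!: continuous_intros)
next
  case (Suc k)
  then have fg: "\<And>x. f differentiable at x" "\<And>x. g differentiable at x"
    by (auto simp: differentiable_on_def)
  have p: "partial_deriv j (\<lambda>x. f x * g x) =
      (\<lambda>x. f x * partial_deriv j g x + partial_deriv j f x * g x)" for j
  proof
    fix x
    show "partial_deriv j (\<lambda>x. f x * g x) x = f x * partial_deriv j g x + partial_deriv j f x * g x"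
      using fg[of x] unfolding frechet_derivative_works
      by (subst partial_deriv_eq[OF has_derivative_mult]) (auto simp: partial_deriv_def)
  qed
  have "(\<lambda>x. f x * g x) differentiable_on UNIV"
    using fg by (auto simp: differentiable_on_def intro: differentiable_mult)
  moreover have "continuously_differentiable k
      (\<lambda>x. f x * partial_deriv j g x + partial_deriv j f x * g x)" for j
    using Suc continuously_differentiable_Suc
    by (intro continuously_differentiable_add Suc.IH) auto
  ultimately show ?case by (simp add: p)
qed

lemma continuously_differentiable_const:
  "continuously_differentiable k (\<lambda>x :: real ^ 'n. c)"
proof (induction k arbitrary: c)
  case (Suc k)
  have "partial_deriv j (\<lambda>x :: real ^ 'n. c) = (\<lambda>x. 0)" for j
    by (rule ext, subst partial_deriv_eq[OF has_derivative_const]) simp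
  then show ?case using Suc by simp
qed simp

lemma continuously_differentiable_prod:
  assumes "finite I" "\<And>i. i \<in> I \<Longrightarrow> continuously_differentiable k (f i)"
  shows "continuously_differentiable k (\<lambda>x. \<Prod>i\<in>I. f i x)"
  using assms
  by (induction I) (auto intro!: continuously_differentiable_const continuously_differentiable_mult)

lemma ridge_has_derivative:
  assumes "(h has_real_derivative h') (at (c \<bullet> x))"
  shows "((\<lambda>x. h (c \<bullet> x)) has_derivative (\<lambda>v. h' * (c \<bullet> v))) (at x)"
proof -
  have "((\<lambda>x. c \<bullet> x) has_derivative (\<lambda>v. c \<bullet> v)) (at x)"
    by (intro derivative_eq_intros) auto
  from has_derivative_compose[OF this] assms show ?thesis
    by (auto simp: has_field_derivative_def)
qed

text \<open>A partial derivative of a ridge function is a constant times the ridge function of the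
  derivative, so smoothness in one variable transfers order by order.\<close>

lemma continuously_differentiable_ridge:
  "smooth_upto k h \<Longrightarrow> continuously_differentiable k (\<lambda>x. h (c \<bullet> x))"
proof (induction k arbitrary: h)
  case 0
  then show ?case
    by (auto intro!: continuous_on_compose2[of UNIV h] continuous_intros)
next
  case (Suc k)
  then obtain h' where h: "\<And>x. (h has_real_derivative h' x) (at x)" "smooth_upto k h'" by auto
  have "partial_deriv j (\<lambda>x. h (c \<bullet> x)) = (\<lambda>x. h' (c \<bullet> x) * (c \<bullet> axis j 1))" for j
    by (rule ext, subst partial_deriv_eq[OF ridge_has_derivative[OF h(1)]]) simp
  moreover have "(\<lambda>x. h (c \<bullet> x)) differentiable_on UNIV"
    using ridge_has_derivative[OF h(1)] by (auto simp: differentiable_on_def differentiable_def)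
  ultimately show ?case
    using Suc.IH[OF h(2)]
    by (auto intro!: continuously_differentiable_mult continuously_differentiable_const)
qed

text \<open>Weak derivatives are defined along the coordinate axes; this is the passage to
  derivatives along rotated axes.\<close>

lemma sum_partial_deriv:
  fixes v :: "real ^ 'n"
  assumes "(g has_derivative g') (at x)"
  shows "(\<Sum>j\<in>UNIV. v $ j * partial_deriv j g x) = g' v"
proof -
  interpret bounded_linear g' using assms by (rule has_derivative_bounded_linear)
  have "g' v = g' (\<Sum>j\<in>UNIV. v $ j *\<^sub>R axis j 1)"
    using basis_expansion[of v] by (simp add: scalar_mult_eq_scaleR)
  also have "\<dots> = (\<Sum>j\<in>UNIV. v $ j * g' (axis j 1))" by (simp add: sum scaleR)
  finally show ?thesis by (simp add: partial_deriv_eq[OF assms])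
qed

section \<open>Products of one-variable functions in orthogonal coordinates\<close>

lemma orthogonal_inner_Basis:
  assumes "orthogonal_transformation T" "b \<in> Basis" "c \<in> Basis"
  shows "T b \<bullet> T c = (if b = c then 1 else 0)"
  using assms by (simp add: orthogonal_transformation_def inner_Basis)

lemma orthogonal_expansion:
  fixes T :: "real ^ 'n \<Rightarrow> real ^ 'n"
  assumes T: "orthogonal_transformation T"
  shows "(\<Sum>b\<in>Basis. (T b \<bullet> x) *\<^sub>R T b) = x"
proof -
  interpret linear T using T by (rule orthogonal_transformation_linear)
  obtain y where y: "x = T y" using orthogonal_transformation_surj[OF T] by (metis surjD)
  have "(\<Sum>b\<in>Basis. (T b \<bullet> x) *\<^sub>R T b) = T (\<Sum>b\<in>Basis. (b \<bullet> y) *\<^sub>R b)"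
    using T by (simp add: y sum scale orthogonal_transformation_def)
  then show ?thesis by (simp add: y euclidean_representation inner_commute[of _ y])
qed

lemma norm_le_orthogonal_coordinates:
  fixes T :: "real ^ 'n \<Rightarrow> real ^ 'n"
  assumes T: "orthogonal_transformation T"
  shows "norm x \<le> (\<Sum>b\<in>Basis. \<bar>T b \<bullet> x\<bar>)"
proof -
  have "norm x = norm (\<Sum>b\<in>Basis. (T b \<bullet> x) *\<^sub>R T b)" by (simp add: orthogonal_expansion[OF T])
  also have "\<dots> \<le> (\<Sum>b\<in>Basis. norm ((T b \<bullet> x) *\<^sub>R T b))" by (rule norm_sum)
  finally show ?thesis using T by (simp add: orthogonal_transformation_norm)
qed

lemma compact_orthogonal_box:
  fixes T :: "real ^ 'n \<Rightarrow> real ^ 'n"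
  assumes T: "orthogonal_transformation T"
  shows "compact {x. \<forall>b\<in>Basis. l b \<le> T b \<bullet> x \<and> T b \<bullet> x \<le> r b}" (is "compact ?W")
proof -
  have "closed ?W"
    by (simp only: Collect_ball_eq)
       (auto intro!: closed_INT closed_Collect_conj closed_Collect_le continuous_intros)
  moreover have "norm x \<le> (\<Sum>b\<in>Basis. \<bar>l b\<bar> + \<bar>r b\<bar>)" if "x \<in> ?W" for x
    by (rule order_trans[OF norm_le_orthogonal_coordinates[OF T]]) (use that in \<open>force intro!: sum_mono\<close>)
  then have "bounded ?W" unfolding bounded_iff by blast
  ultimately show ?thesis by (simp add: compact_eq_bounded_closed)
qed

text \<open>The index set is a parameter: over \<open>Basis\<close> the product is a test function
  on the whole space, and without the normal basis vector it is what remains of that test function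
  on one hyperplane.\<close>

definition tensor :: "(real ^ 'n \<Rightarrow> real ^ 'n) \<Rightarrow> (real ^ 'n) set \<Rightarrow> (real ^ 'n \<Rightarrow> real \<Rightarrow> real)
    \<Rightarrow> real ^ 'n \<Rightarrow> real" where
  "tensor T J \<gamma> x = (\<Prod>b\<in>J. \<gamma> b (T b \<bullet> x))"

lemma test_function_tensor:
  assumes T: "orthogonal_transformation T"
    and smooth: "\<And>b k. b \<in> Basis \<Longrightarrow> smooth_upto k (\<gamma> b)"
    and supp: "\<And>b s. b \<in> Basis \<Longrightarrow> \<not> (l b \<le> s \<and> s \<le> r b) \<Longrightarrow> \<gamma> b s = 0"
    and W: "{x. \<forall>b\<in>Basis. l b \<le> T b \<bullet> x \<and> T b \<bullet> x \<le> r b} \<subseteq> U" (is "?W \<subseteq> U")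
  shows "test_function U (tensor T Basis \<gamma>)"
proof -
  have S0: "{x. tensor T Basis \<gamma> x \<noteq> 0} \<subseteq> ?W"
    using supp by (auto simp: tensor_def)
  have cW: "compact ?W" using compact_orthogonal_box[OF T] .
  have sub: "closure {x. tensor T Basis \<gamma> x \<noteq> 0} \<subseteq> ?W"
    by (rule closure_minimal[OF S0 compact_imp_closed[OF cW]])
  have "compact (closure {x. tensor T Basis \<gamma> x \<noteq> 0})"
    unfolding compact_closure by (rule bounded_subset[OF compact_imp_bounded[OF cW] S0])
  moreover have "continuously_differentiable k (tensor T Basis \<gamma>)" for k
    unfolding tensor_def[abs_def] using smooth
    by (intro continuously_differentiable_prod continuously_differentiable_ridge) auto
  ultimately show ?thesis using sub W unfolding test_function_def by blast
qed

text \<open>In the product rule only the factor with \<open>c = b\<close> survives, since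
  \<open>T b\<close> is orthogonal to every other \<open>T c\<close>.\<close>

lemma tensor_dir_deriv:
  assumes T: "orthogonal_transformation T" and b: "b \<in> Basis"
    and deriv: "\<And>c s. c \<in> Basis \<Longrightarrow> (\<gamma> c has_real_derivative \<gamma>' c s) (at s)"
  shows "(\<Sum>j\<in>UNIV. T b $ j * partial_deriv j (tensor T Basis \<gamma>) x) =
    tensor T Basis (\<gamma>(b := \<gamma>' b)) x"
proof -
  have 1: "((\<lambda>x. \<gamma> c (T c \<bullet> x)) has_derivative (\<lambda>v. \<gamma>' c (T c \<bullet> x) * (T c \<bullet> v))) (at x)"
    if "c \<in> Basis" for c
    using that by (intro ridge_has_derivative deriv)
  have "(tensor T Basis \<gamma> has_derivative (\<lambda>v. \<Sum>c\<in>Basis. \<gamma>' c (T c \<bullet> x) * (T c \<bullet> v) *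
      (\<Prod>d\<in>Basis - {c}. \<gamma> d (T d \<bullet> x)))) (at x)"
    unfolding tensor_def[abs_def] using 1 by (rule has_derivative_prod)
  note * = sum_partial_deriv[OF this]
  have "(\<Sum>j\<in>UNIV. T b $ j * partial_deriv j (tensor T Basis \<gamma>) x) =
    (\<Sum>c\<in>Basis. if c = b then \<gamma>' c (T c \<bullet> x) * (\<Prod>d\<in>Basis - {c}. \<gamma> d (T d \<bullet> x)) else 0)"
    unfolding * using b by (intro sum.cong) (auto simp: orthogonal_inner_Basis[OF T])
  also have "\<dots> = \<gamma>' b (T b \<bullet> x) * (\<Prod>d\<in>Basis - {b}. \<gamma> d (T d \<bullet> x))"
    using b by (simp add: sum.delta)
  also have "\<dots> = tensor T Basis (\<gamma>(b := \<gamma>' b)) x"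
    unfolding tensor_def prod.remove[OF finite_Basis b] by (auto intro!: prod.cong)
  finally show ?thesis .
qed

section \<open>The fundamental lemma of the calculus of variations\<close>

text \<open>Open boxes are stable under intersection and generate the Borel sets, so the vanishing
  of the integral spreads from boxes to all Borel sets by a Dynkin class argument.\<close>

lemma AE_zero_of_box_integrals_lborel:
  fixes h :: "'a::euclidean_space \<Rightarrow> real"
  assumes h: "integrable lborel h"
    and box: "\<And>a b. (LINT x:box a b|lborel. h x) = 0"
  shows "AE x in lborel. h x = 0"
proof -
  have int: "set_integrable lborel A h" if "A \<in> sets borel" for A
    using integrable_mult_indicator[OF _ h, of A] that by (simp add: set_integrable_def)
  have inc: "incseq (\<lambda>i. box (- (real i *\<^sub>R One)) (real i *\<^sub>R One) :: 'a set)"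
    by (auto simp: incseq_def box_def)
  \<comment> \<open>Complements require the integral over the whole space, obtained as a limit over
    growing boxes.\<close>
  have "(\<lambda>i. LINT x:box (- (real i *\<^sub>R One)) (real i *\<^sub>R One)|lborel. h x) \<longlonglongrightarrow>
      (LINT x:(\<Union>i. box (- (real i *\<^sub>R One)) (real i *\<^sub>R One))|lborel. h x)"
    using inc by (intro set_integral_cont_up int) auto
  then have UNIV: "(LINT x:UNIV|lborel. h x) = 0"
    by (simp add: box UN_box_eq_UNIV LIMSEQ_const_iff)
  have "(LINT x:A|lborel. h x) = 0" if "A \<in> sets borel" for A
  proof -
    have "Int_stable (range (\<lambda>(a, b). box a b :: 'a set))"
      by (auto simp: Int_stable_def box_Int_box)
    moreover have "range (\<lambda>(a, b). box a b :: 'a set) \<subseteq> Pow UNIV" by simp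
    moreover have "A \<in> sigma_sets UNIV (range (\<lambda>(a, b). box a b :: 'a set))"
      using that unfolding borel_eq_box by simp
    ultimately show ?thesis
    proof (induction rule: sigma_sets_induct_disjoint)
      case (basic A)
      then show ?case using box by auto
    next
      case empty
      then show ?case by (simp add: set_lebesgue_integral_def)
    next
      case (compl A)
      then have [measurable]: "A \<in> sets borel" unfolding borel_eq_box by simp
      have "(LINT x:A \<union> (UNIV - A)|lborel. h x) =
          (LINT x:A|lborel. h x) + (LINT x:(UNIV - A)|lborel. h x)"
        by (intro set_integral_Un int) auto
      then show ?case using compl UNIV by simp
    next
      case (union A)
      then have [measurable]: "\<And>i. A i \<in> sets borel" unfolding borel_eq_box by auto
      have "(LINT x:(\<Union>i. A i)|lborel. h x) = (\<Sum>i. (LINT x:(A i)|lborel. h x))"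
        using union(1) by (intro lebesgue_integral_countable_add int)
          (auto simp: disjoint_family_on_def)
      then show ?case using union by simp
    qed
  qed
  then show ?thesis
    by (intro density_unique_real[OF h]) (auto simp: set_lebesgue_integral_def)
qed

lemma AE_zero_of_box_integrals:
  fixes h :: "'a::euclidean_space \<Rightarrow> real"
  assumes h: "integrable lebesgue h"
    and box: "\<And>a b. (LINT x:box a b|lebesgue. h x) = 0"
  shows "AE x in lebesgue. h x = 0"
proof -
  obtain h' where h'[measurable]: "h' \<in> borel_measurable lborel" and ae: "AE x in lborel. h x = h' x"
    using completion_ex_borel_measurable_real[of h lborel] h by auto
  have ae': "AE x in lebesgue. h x = h' x" using ae by (simp add: AE_completion_iff)
  have [measurable]: "h \<in> borel_measurable lebesgue" using h by auto
  have m: "h' \<in> borel_measurable lebesgue" using measurable_completion[OF h'] .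
  have "integrable lebesgue h'"
    using h m ae' by (subst integrable_cong_AE[of _ _ h]) auto
  then have "integrable lborel h'" by (subst (asm) integrable_completion) auto
  moreover have "(LINT x:box a b|lborel. h' x) = 0" for a b
  proof -
    have "(LINT x:box a b|lborel. h' x) = (LINT x|lebesgue. indicator (box a b) x *\<^sub>R h' x)"
      unfolding set_lebesgue_integral_def by (subst integral_completion) auto
    also have "\<dots> = (LINT x:box a b|lebesgue. h x)"
      unfolding set_lebesgue_integral_def
      using ae' m
      by (intro integral_cong_AE borel_measurable_scaleR borel_measurable_indicator) auto
    finally show ?thesis by (simp add: box)
  qed
  ultimately have "AE x in lborel. h' x = 0" by (rule AE_zero_of_box_integrals_lborel)
  then show ?thesis using ae by (auto simp: AE_completion_iff)
qed

section \<open>Smooth approximation of intervals, and uniqueness of weak derivatives\<close>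

definition plateau :: "nat \<Rightarrow> real \<Rightarrow> real \<Rightarrow> real \<Rightarrow> real" where
  "plateau m a b s = flat 0 (real (Suc m) * (s - a)) * flat 0 (real (Suc m) * (b - s))"

lemma smooth_upto_plateau: "smooth_upto k (plateau m a b)"
proof -
  have "smooth_upto k (\<lambda>s. flat 0 (real (Suc m) * s + - (real (Suc m) * a)) *
      flat 0 (- real (Suc m) * s + real (Suc m) * b))"
    by (intro smooth_upto_mult smooth_upto_affine smooth_upto_flat)
  then show ?thesis by (simp add: plateau_def[abs_def] algebra_simps)
qed

lemma plateau_bounds: "0 \<le> plateau m a b s" "plateau m a b s \<le> 1"
  unfolding plateau_def using flat_nonneg flat_0_le_1 by (auto intro!: mult_le_one)

lemma plateau_eq_0: "\<not> (a < s \<and> s < b) \<Longrightarrow> plateau m a b s = 0"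
  unfolding plateau_def
  by (auto simp: flat_def mult_less_0_iff zero_less_mult_iff)

text \<open>\<open>flat 0\<close> tends to 1 at infinity, so stretching by \<open>Suc m\<close> at
  both ends lifts the product to 1 on the open interval while its support never grows.\<close>

lemma plateau_tendsto: "(\<lambda>m. plateau m a b s) \<longlonglongrightarrow> indicator {a<..<b} s"
proof (cases "a < s \<and> s < b")
  case True
  have *: "(\<lambda>m. flat 0 (real (Suc m) * r)) \<longlonglongrightarrow> 1" if "r > 0" for r
  proof -
    have "(\<lambda>m. exp (- (1 / r) * (1 / real (Suc m)))) \<longlonglongrightarrow> exp (- (1 / r) * 0)"
      by (intro tendsto_intros LIMSEQ_Suc[OF lim_1_over_n])
    moreover have "exp (- (1 / r) * (1 / real (Suc m))) = flat 0 (real (Suc m) * r)" for m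
      using that by (simp add: flat_def divide_simps)
    ultimately show ?thesis by simp
  qed
  have "(\<lambda>m. plateau m a b s) \<longlonglongrightarrow> 1 * 1"
    unfolding plateau_def using True by (intro tendsto_mult *) auto
  then show ?thesis using True by simp
next
  case False
  then show ?thesis by (simp add: plateau_eq_0)
qed

lemma plateau_borel: "plateau m a b \<in> borel_measurable borel"
  using smooth_upto_continuous[OF smooth_upto_plateau] by (rule borel_measurable_continuous_onI)

text \<open>Dominated convergence under \<open>\<bar>H\<bar>\<close> replaces plateaus by intervals;
  after cutting \<open>H\<close> down to the interval from \<open>s1\<close> to \<open>s2\<close>,
  all its box integrals vanish.\<close>

lemma AE_zero_of_plateau_integrals:
  assumes H: "integrable lborel H"
    and int: "\<And>m a b. s1 \<le> a \<Longrightarrow> b \<le> s2 \<Longrightarrow> a < b \<Longrightarrow> (LINT t|lborel. H t * plateau m a b t) = 0"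
  shows "AE t in lborel. s1 < t \<and> t < s2 \<longrightarrow> H t = 0"
proof -
  have [measurable]: "H \<in> borel_measurable borel" using H by auto
  have zero: "(LINT t|lborel. H t * indicator {a<..<b} t) = 0" if "s1 \<le> a" "b \<le> s2" for a b
  proof (cases "a < b")
    case True
    have "(\<lambda>m. LINT t|lborel. H t * plateau m a b t) \<longlonglongrightarrow> (LINT t|lborel. H t * indicator {a<..<b} t)"
    proof (rule integral_dominated_convergence[where w = "\<lambda>t. \<bar>H t\<bar>"])
      show "AE x in lborel. (\<lambda>m. H x * plateau m a b x) \<longlonglongrightarrow> H x * indicator {a<..<b} x"
        by (intro AE_I2 tendsto_mult plateau_tendsto tendsto_const)
      show "AE x in lborel. norm (H x * plateau m a b x) \<le> \<bar>H x\<bar>" for m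
        using plateau_bounds by (auto simp: abs_mult mult_left_le)
    qed (use H plateau_borel in \<open>auto intro!: borel_measurable_times\<close>)
    then show ?thesis using int[OF that True] by (simp add: LIMSEQ_const_iff)
  qed simp
  have "AE t in lborel. indicator {s1<..<s2} t * H t = 0"
  proof (rule AE_zero_of_box_integrals_lborel)
    show "integrable lborel (\<lambda>t. indicator {s1<..<s2} t * H t)"
      using integrable_real_mult_indicator[OF _ H, of "{s1<..<s2}"] by (simp add: mult.commute)
    fix a b
    have "(LINT t:box a b|lborel. indicator {s1<..<s2} t * H t) =
        (LINT t|lborel. H t * indicator {max a s1<..<min b s2} t)"
      unfolding set_lebesgue_integral_def
      by (intro Bochner_Integration.integral_cong) (auto simp: indicator_def)
    then show "(LINT t:box a b|lborel. indicator {s1<..<s2} t * H t) = 0" by (simp add: zero)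
  qed
  then show ?thesis by eventually_elim (auto simp: indicator_def)
qed

lemma integrable_indicator_mult_continuous:
  assumes v: "v locally_integrable_on U" and K: "compact K" "K \<subseteq> U"
    and g: "continuous_on UNIV g"
  shows "integrable lebesgue (\<lambda>x. (indicator K x * v x) * g x)"
proof -
  have v': "integrable lebesgue (\<lambda>x. indicator K x * v x)"
    using v K by (auto simp: locally_integrable_on_def set_integrable_def)
  have "compact (g ` K)" using g K(1) continuous_on_subset by (blast intro: compact_continuous_image)
  then obtain B where B: "\<And>x. x \<in> K \<Longrightarrow> \<bar>g x\<bar> \<le> B"
    using compact_imp_bounded bounded_iff by (metis image_eqI real_norm_def)
  have gm: "g \<in> borel_measurable lebesgue"
    using borel_measurable_continuous_onI[OF g] by (auto intro: measurable_completion)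
  show ?thesis
  proof (rule Bochner_Integration.integrable_bound)
    show "integrable lebesgue (\<lambda>x. B * (indicator K x * v x))" using v' by auto
    show "(\<lambda>x. (indicator K x * v x) * g x) \<in> borel_measurable lebesgue"
      using borel_measurable_integrable[OF v'] gm by (rule borel_measurable_times)
    show "AE x in lebesgue. norm ((indicator K x * v x) * g x) \<le> norm (B * (indicator K x * v x))"
    proof (rule AE_I2)
      fix x
      show "norm ((indicator K x * v x) * g x) \<le> norm (B * (indicator K x * v x))"
      proof (cases "x \<in> K")
        case True
        have "\<bar>v x\<bar> * \<bar>g x\<bar> \<le> \<bar>v x\<bar> * \<bar>B\<bar>" using B[OF True] by (intro mult_left_mono) auto
        then show ?thesis using True by (simp add: abs_mult mult.commute)
      qed simp
    qed
  qed
qed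

lemma integrable_mult_compact_support:
  assumes v: "v locally_integrable_on U" and K: "compact K" "K \<subseteq> U"
    and g: "continuous_on UNIV g" "\<And>x. x \<notin> K \<Longrightarrow> g x = 0"
  shows "set_integrable lebesgue U (\<lambda>x. v x * g x)"
proof -
  have "indicator U x *\<^sub>R (v x * g x) = (indicator K x * v x) * g x" for x
    using K(2) g(2)[of x] by (auto simp: indicator_def)
  then show ?thesis
    unfolding set_integrable_def by (simp only: integrable_indicator_mult_continuous[OF v K g(1)])
qed

lemma test_functionD:
  assumes "test_function U g"
  shows "continuous_on UNIV g" "compact (closure {x. g x \<noteq> 0})" "closure {x. g x \<noteq> 0} \<subseteq> U"
    "\<And>x. x \<notin> closure {x. g x \<noteq> 0} \<Longrightarrow> g x = 0"
  using assms closure_subset[of "{x. g x \<noteq> 0}"] continuously_differentiable_continuous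
  unfolding test_function_def by blast+

lemma tensor_id_plateau_props:
  fixes a b :: "real ^ 'n"
  defines "g \<equiv> \<lambda>m. tensor (\<lambda>x. x) Basis (\<lambda>c. plateau m (a \<bullet> c) (b \<bullet> c))"
  shows "cbox a b \<subseteq> U \<Longrightarrow> test_function U (g m)"
    and "\<bar>g m x\<bar> \<le> indicator (cbox a b) x"
    and "(\<lambda>m. g m x) \<longlonglongrightarrow> indicator (box a b) x"
proof -
  have id: "orthogonal_transformation (\<lambda>x :: real ^ 'n. x)"
    by (simp add: orthogonal_transformation_def linear_id)
  show "test_function U (g m)" if "cbox a b \<subseteq> U"
    unfolding g_def
    by (rule test_function_tensor[OF id smooth_upto_plateau, where l = "\<lambda>c. a \<bullet> c" and r = "\<lambda>c. b \<bullet> c"])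
       (use that in \<open>auto simp: plateau_eq_0 cbox_def inner_commute\<close>)
  show "\<bar>g m x\<bar> \<le> indicator (cbox a b) x"
  proof (cases "x \<in> cbox a b")
    case True
    have "\<bar>g m x\<bar> \<le> 1"
      unfolding g_def tensor_def abs_prod using plateau_bounds by (intro prod_le_1) auto
    then show ?thesis using True by simp
  next
    case False
    then obtain c where "c \<in> Basis" "\<not> (a \<bullet> c \<le> x \<bullet> c \<and> x \<bullet> c \<le> b \<bullet> c)" by (auto simp: mem_box)
    then have "g m x = 0" unfolding g_def tensor_def
      by (intro prod_zero bexI[of _ c]) (auto simp: plateau_eq_0 inner_commute)
    then show ?thesis using False by simp
  qed
  have "(\<lambda>m. g m x) \<longlonglongrightarrow> (\<Prod>c\<in>Basis. indicator {a \<bullet> c<..<b \<bullet> c} (c \<bullet> x))"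
    unfolding g_def tensor_def by (intro tendsto_prod plateau_tendsto)
  moreover have "(\<Prod>c\<in>Basis. indicator {a \<bullet> c<..<b \<bullet> c} (c \<bullet> x)) = (indicator (box a b) x :: real)"
    by (cases "x \<in> box a b") (auto simp: mem_box inner_commute indicator_def intro!: prod.neutral)
  ultimately show "(\<lambda>m. g m x) \<longlonglongrightarrow> indicator (box a b) x" by simp
qed

text \<open>The assertion on vanishing gradients concerns every weak gradient, whereas the estimates
  are built on the one for which \<open>\<phi>\<close> of the norm is locally integrable; this
  result identifies the two. Products of plateaus give zero integrals of the difference over all
  open boxes whose closed box lies in \<open>U\<close>.\<close>

lemma weak_partial_unique:
  fixes U :: "(real ^ 'n) set"
  assumes U: "open U" and v: "weak_partial U j u v" and w: "weak_partial U j u w"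
  shows "AE x in lebesgue. x \<in> U \<longrightarrow> v x = w x"
proof -
  define d where "d x = v x - w x" for x
  have lv: "v locally_integrable_on U" and lw: "w locally_integrable_on U"
    using v w by (auto simp: weak_partial_def)
  have d: "d locally_integrable_on U"
    using lv lw by (auto simp: locally_integrable_on_def d_def[abs_def])
  have test: "(LINT x:U|lebesgue. d x * g x) = 0" if g: "test_function U g" for g
  proof -
    have "(LINT x:U|lebesgue. d x * g x) = (LINT x:U|lebesgue. v x * g x - w x * g x)"
      by (simp add: d_def algebra_simps)
    also have "\<dots> = (LINT x:U|lebesgue. v x * g x) - (LINT x:U|lebesgue. w x * g x)"
      using integrable_mult_compact_support[OF lv test_functionD(2,3,1,4)[OF g]]
        integrable_mult_compact_support[OF lw test_functionD(2,3,1,4)[OF g]]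
      by (rule set_integral_diff)
    finally show ?thesis using v w g by (simp add: weak_partial_def)
  qed
  have dK: "integrable lebesgue (\<lambda>x. indicator K x *\<^sub>R d x)" if "compact K" "K \<subseteq> U" for K
    using d that by (auto simp: locally_integrable_on_def set_integrable_def)
  have box: "(LINT x:box a b|lebesgue. d x) = 0" if ab: "cbox a b \<subseteq> U" for a b
  proof -
    define g where "g m = tensor (\<lambda>x. x) Basis (\<lambda>c. plateau m (a \<bullet> c) (b \<bullet> c))" for m
    have props: "test_function U (g m)" "\<bar>g m x\<bar> \<le> indicator (cbox a b) x"
      "(\<lambda>m. g m x) \<longlonglongrightarrow> indicator (box a b) x" for m x
      unfolding g_def using tensor_id_plateau_props ab by blast+
    have gm: "g m \<in> borel_measurable lebesgue" for m
      using borel_measurable_continuous_onI[OF test_functionD(1)[OF props(1)]]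
      by (auto intro: measurable_completion)
    have dm: "(\<lambda>x. indicator (cbox a b) x *\<^sub>R d x) \<in> borel_measurable lebesgue"
      using dK[OF compact_cbox ab] by auto
    have eq: "indicator U x *\<^sub>R (d x * g m x) = (indicator (cbox a b) x *\<^sub>R d x) * g m x" for m x
      using props(2)[of m x] ab by (auto simp: indicator_def split: if_splits)
    have eq2: "indicator (box a b) x *\<^sub>R d x = (indicator (cbox a b) x *\<^sub>R d x) * indicator (box a b) x" for x
      using box_subset_cbox[of a b] by (auto simp: indicator_def)
    have "(\<lambda>m. LINT x|lebesgue. (indicator (cbox a b) x *\<^sub>R d x) * g m x) \<longlonglongrightarrow>
        (LINT x|lebesgue. indicator (box a b) x *\<^sub>R d x)"
    proof (rule integral_dominated_convergence[where w = "\<lambda>x. \<bar>indicator (cbox a b) x *\<^sub>R d x\<bar>"])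
      show "(\<lambda>x. indicator (box a b) x *\<^sub>R d x) \<in> borel_measurable lebesgue"
        unfolding eq2 by (intro borel_measurable_times dm borel_measurable_indicator) auto
      show "(\<lambda>x. (indicator (cbox a b) x *\<^sub>R d x) * g m x) \<in> borel_measurable lebesgue" for m
        by (intro borel_measurable_times dm gm)
      show "integrable lebesgue (\<lambda>x. \<bar>indicator (cbox a b) x *\<^sub>R d x\<bar>)"
        by (intro integrable_abs dK compact_cbox ab)
      show "AE x in lebesgue. (\<lambda>m. (indicator (cbox a b) x *\<^sub>R d x) * g m x) \<longlonglongrightarrow> indicator (box a b) x *\<^sub>R d x"
        unfolding eq2 by (intro AE_I2 tendsto_mult tendsto_const props(3))
      show "AE x in lebesgue. norm ((indicator (cbox a b) x *\<^sub>R d x) * g m x) \<le> \<bar>indicator (cbox a b) x *\<^sub>R d x\<bar>" for m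
      proof (intro AE_I2)
        fix x
        have "\<bar>g m x\<bar> \<le> 1"
          by (rule order_trans[OF props(2)]) (simp add: indicator_def)
        then show "norm ((indicator (cbox a b) x *\<^sub>R d x) * g m x) \<le> \<bar>indicator (cbox a b) x *\<^sub>R d x\<bar>"
          unfolding real_norm_def abs_mult by (rule mult_left_le) simp
      qed
    qed
    moreover have "(LINT x|lebesgue. (indicator (cbox a b) x *\<^sub>R d x) * g m x) = 0" for m
      using test[OF props(1)] unfolding set_lebesgue_integral_def eq .
    ultimately show ?thesis unfolding set_lebesgue_integral_def
      using LIMSEQ_unique[OF _ tendsto_const] by simp
  qed
  have local: "AE x in lebesgue. x \<in> box a b \<longrightarrow> v x = w x" if ab: "cbox a b \<subseteq> U" for a b
  proof -
    have eq2: "indicator (box a b) x *\<^sub>R d x = (indicator (cbox a b) x *\<^sub>R d x) * indicator (box a b) x" for x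
      using box_subset_cbox[of a b] by (auto simp: indicator_def)
    have "AE x in lebesgue. indicator (box a b) x *\<^sub>R d x = 0"
    proof (rule AE_zero_of_box_integrals)
      show "integrable lebesgue (\<lambda>x. indicator (box a b) x *\<^sub>R d x)"
        unfolding eq2 by (intro integrable_real_mult_indicator dK compact_cbox ab) auto
      fix a' b'
      obtain p q where pq: "box a' b' \<inter> box a b = box p q" by (rule that[OF box_Int_box])
      have "(LINT x:box a' b'|lebesgue. indicator (box a b) x *\<^sub>R d x) = (LINT x:box p q|lebesgue. d x)"
        unfolding set_lebesgue_integral_def pq[symmetric]
        by (intro Bochner_Integration.integral_cong) (auto simp: indicator_def)
      also have "\<dots> = 0"
      proof (cases "box p q = {}")
        case False
        then have "cbox p q = closure (box p q)" by (simp add: closure_box)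
        also have "\<dots> \<subseteq> closure (cbox a b)"
          using pq box_subset_cbox[of a b] by (intro closure_mono) blast
        also have "\<dots> \<subseteq> U" using ab by simp
        finally show ?thesis by (rule box)
      qed (simp add: set_lebesgue_integral_def)
      finally show "(LINT x:box a' b'|lebesgue. indicator (box a b) x *\<^sub>R d x) = 0" .
    qed
    then show ?thesis by eventually_elim (auto simp: indicator_def d_def)
  qed
  \<comment> \<open>Countably many closed boxes exhaust \<open>U\<close>; their frontiers, which the
    local argument misses, are null.\<close>
  obtain \<D> where D: "countable \<D>" "\<D> \<subseteq> Pow U" "\<And>X. X \<in> \<D> \<Longrightarrow> \<exists>a b. X = cbox a b" "\<Union>\<D> = U"
    using open_countable_Union_open_cbox[OF U] by blast
  have "AE x in lebesgue. x \<in> X \<longrightarrow> v x = w x" if X: "X \<in> \<D>" for X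
  proof -
    obtain a b where ab: "X = cbox a b" using D(3)[OF X] by blast
    have "cbox a b - box a b \<in> null_sets lebesgue"
      using negligible_frontier_interval negligible_iff_null_sets by blast
    moreover have "cbox a b \<subseteq> U" using D(2) X ab by blast
    ultimately show ?thesis
      using AE_not_in[of "cbox a b - box a b" lebesgue] local[of a b] by (auto simp: ab)
  qed
  then have "AE x in lebesgue. \<forall>X\<in>\<D>. x \<in> X \<longrightarrow> v x = w x"
    unfolding AE_ball_countable[OF D(1)] by blast
  then show ?thesis by eventually_elim (use D(4) in blast)
qed

section \<open>Slicing by parallel hyperplanes\<close>

lemma nn_integral_lborel_shift:
  fixes F :: "'a::euclidean_space \<Rightarrow> ennreal"
  assumes [measurable]: "F \<in> borel_measurable borel"
  shows "(\<integral>\<^sup>+x. F (c + x) \<partial>lborel) = (\<integral>\<^sup>+x. F x \<partial>lborel)"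
    and "(\<integral>\<^sup>+x. F (c - x) \<partial>lborel) = (\<integral>\<^sup>+x. F x \<partial>lborel)"
proof -
  have 0: "(\<integral>\<^sup>+x. F x \<partial>lborel) = (\<integral>\<^sup>+x. F x \<partial>density (distr lborel borel (\<lambda>x. c + a *\<^sub>R x)) (\<lambda>_. \<bar>a\<bar> ^ DIM('a)))"
    if "a \<noteq> 0" for a
    using lborel_affine[OF that, of c] by simp
  have *: "(\<integral>\<^sup>+x. F x \<partial>lborel) = (\<integral>\<^sup>+x. F (c + a *\<^sub>R x) \<partial>lborel)" if a: "\<bar>a\<bar> = 1" for a
  proof -
    have "a \<noteq> 0" using a by auto
    from 0[OF this] show ?thesis by (simp add: nn_integral_density nn_integral_distr a)
  qed
  show "(\<integral>\<^sup>+x. F (c + x) \<partial>lborel) = (\<integral>\<^sup>+x. F x \<partial>lborel)" using *[of 1] by simp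
  show "(\<integral>\<^sup>+x. F (c - x) \<partial>lborel) = (\<integral>\<^sup>+x. F x \<partial>lborel)" using *[of "-1"] by simp
qed

text \<open>The image of \<^term>\<open>lborel\<close> is translation invariant, hence proportional to \<^term>\<open>lborel\<close>; the unit
  ball, which the transformation preserves, shows that the factor is \<open>1\<close>.\<close>

lemma lborel_orthogonal_transformation:
  fixes T :: "'a::euclidean_space \<Rightarrow> 'a"
  assumes T: "orthogonal_transformation T"
  shows "distr lborel borel T = lborel"
proof (rule measure_eqI)
  have lin: "linear T" using T by (rule orthogonal_transformation_linear)
  have [measurable]: "T \<in> borel_measurable borel"
    using linear_continuous_on[OF lin[unfolded linear_conv_bounded_linear]]
    by (rule borel_measurable_continuous_onI)
  define T' where "T' = inv T"
  have TT': "T (T' y) = y" for y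
    unfolding T'_def by (simp add: surj_f_inv_f[OF orthogonal_transformation_surj[OF T]])
  fix A assume "A \<in> sets (distr lborel borel T)"
  then have [measurable]: "A \<in> sets borel" by simp
  define B where "B = (ball 0 1 :: 'a set)"
  have [measurable]: "B \<in> sets borel" by (simp add: B_def)
  let ?iA = "indicator A :: 'a \<Rightarrow> ennreal" and ?iB = "indicator B :: 'a \<Rightarrow> ennreal"
  have em: "(\<integral>\<^sup>+x. indicator S (T x) \<partial>lborel) = emeasure (distr lborel borel T) S"
    if [measurable]: "S \<in> sets borel" for S
    by (subst nn_integral_indicator[symmetric], simp, subst nn_integral_distr) auto
  have "emeasure (distr lborel borel T) A * emeasure lborel B = (\<integral>\<^sup>+x. ?iA (T x) * emeasure lborel B \<partial>lborel)"
    by (subst em[symmetric]) (auto simp: nn_integral_multc)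
  also have "\<dots> = (\<integral>\<^sup>+x. ?iA (T x) * (\<integral>\<^sup>+y. ?iB (T x + y) \<partial>lborel) \<partial>lborel)"
    by (subst nn_integral_lborel_shift) auto
  also have "\<dots> = (\<integral>\<^sup>+x. \<integral>\<^sup>+y. ?iA (T x) * ?iB (T x + y) \<partial>lborel \<partial>lborel)"
    by (subst nn_integral_cmult[symmetric]) auto
  also have "\<dots> = (\<integral>\<^sup>+y. \<integral>\<^sup>+x. ?iA (T x) * ?iB (T x + y) \<partial>lborel \<partial>lborel)"
    by (rule lborel_pair.Fubini'[symmetric]) measurable
  also have "\<dots> = (\<integral>\<^sup>+y. \<integral>\<^sup>+x. ?iA (T x - y) * ?iB (T x) \<partial>lborel \<partial>lborel)"
  proof (rule nn_integral_cong)
    fix y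
    have "(\<integral>\<^sup>+x. ?iA (T x) * ?iB (T x + y) \<partial>lborel) =
        (\<integral>\<^sup>+x. ?iA (T (- T' y + x)) * ?iB (T (- T' y + x) + y) \<partial>lborel)"
      by (rule nn_integral_lborel_shift[symmetric]) measurable
    then show "(\<integral>\<^sup>+x. ?iA (T x) * ?iB (T x + y) \<partial>lborel) = (\<integral>\<^sup>+x. ?iA (T x - y) * ?iB (T x) \<partial>lborel)"
      by (simp add: linear_diff[OF lin] TT')
  qed
  also have "\<dots> = (\<integral>\<^sup>+x. \<integral>\<^sup>+y. ?iA (T x - y) * ?iB (T x) \<partial>lborel \<partial>lborel)"
    by (rule lborel_pair.Fubini') measurable
  also have "\<dots> = (\<integral>\<^sup>+x. (\<integral>\<^sup>+y. ?iA (T x - y) \<partial>lborel) * ?iB (T x) \<partial>lborel)"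
    by (subst nn_integral_multc) auto
  also have "\<dots> = emeasure lborel A * emeasure (distr lborel borel T) B"
    by (subst nn_integral_lborel_shift) (auto simp: nn_integral_cmult em)
  also have "emeasure (distr lborel borel T) B = emeasure lborel B"
  proof -
    have "T -` B = B" unfolding B_def by (auto simp: orthogonal_transformation_norm[OF T])
    then show ?thesis by (simp add: emeasure_distr)
  qed
  finally have "emeasure (distr lborel borel T) A * emeasure lborel B = emeasure lborel A * emeasure lborel B" .
  moreover have "emeasure lborel B \<noteq> 0" "emeasure lborel B < top"
    using less_imp_neq[OF unit_ball_vol_pos[of "real DIM('a)", OF of_nat_0_le_iff]]
    by (auto simp: B_def emeasure_ball)
  ultimately show "emeasure (distr lborel borel T) A = emeasure lborel A"
    by (auto simp: ennreal_mult_cancel_left mult.commute[of _ "emeasure lborel B"])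
qed simp

section \<open>Lebesgue measure in rotated coordinates, with \<open>T e\<^sub>0\<close> as the unit
  normal\<close>

locale rotated_coordinates =
  fixes T :: "real ^ 'n \<Rightarrow> real ^ 'n" and e\<^sub>0 :: "real ^ 'n"
  assumes T: "orthogonal_transformation T" and e0: "e\<^sub>0 \<in> Basis"
begin

definition J :: "(real ^ 'n) set" where "J = Basis - {e\<^sub>0}"

definition embed :: "real \<Rightarrow> (real ^ 'n \<Rightarrow> real) \<Rightarrow> real ^ 'n" where
  "embed t y = t *\<^sub>R T e\<^sub>0 + (\<Sum>b\<in>J. y b *\<^sub>R T b)"

text \<open>Lebesgue measure of dimension \<open>card J\<close> on the hyperplane at height
  \<open>t\<close>, but regarded as a Borel measure on the whole space, so that the same sets and
  functions can be integrated at every height.\<close>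

definition slice :: "real \<Rightarrow> (real ^ 'n) measure" where
  "slice t = distr (\<Pi>\<^sub>M b\<in>J. lborel) borel (embed t)"

lemma finite_J [simp]: "finite J"
  by (simp add: J_def)

lemma J_subset: "b \<in> J \<Longrightarrow> b \<in> Basis"
  by (simp add: J_def)

lemma e0_notin_J [simp]: "e\<^sub>0 \<notin> J"
  by (simp add: J_def)

lemma Basis_eq_insert: "Basis = insert e\<^sub>0 J"
  using e0 by (auto simp: J_def)

lemma card_J: "card J = CARD('n) - 1"
  using e0 by (simp add: J_def card_Diff_singleton)

lemma inner_embed: "b \<in> J \<Longrightarrow> T b \<bullet> embed t y = y b" "T e\<^sub>0 \<bullet> embed t y = t"
proof -
  have "T c \<bullet> embed t y = t * (if c = e\<^sub>0 then 1 else 0) + (\<Sum>b\<in>J. y b * (if c = b then 1 else 0))"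
    if "c \<in> Basis" for c
    using that e0 J_subset unfolding embed_def
    by (simp add: inner_add_right inner_sum_right orthogonal_inner_Basis[OF T])
  note * = this
  show "b \<in> J \<Longrightarrow> T b \<bullet> embed t y = y b" using *[of b] J_subset[of b] e0_notin_J
    by (auto simp: sum.delta if_distrib[of "\<lambda>z. y _ * z"] cong: if_cong)
  show "T e\<^sub>0 \<bullet> embed t y = t" using *[of "e\<^sub>0"] e0
    by (auto intro!: sum.neutral)
qed

lemma continuous_T: "continuous_on S T"
  using linear_continuous_on[OF orthogonal_transformation_linear[OF T, unfolded linear_conv_bounded_linear]] .

lemma measurable_inner_T [measurable]: "(\<lambda>x. T b \<bullet> x) \<in> borel_measurable borel"
  by (intro borel_measurable_continuous_onI continuous_intros)

lemma measurable_embed_pair [measurable]: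
  "(\<lambda>(t, y). embed t y) \<in> lborel \<Otimes>\<^sub>M (\<Pi>\<^sub>M b\<in>J. lborel) \<rightarrow>\<^sub>M borel"
  unfolding embed_def split_beta'
  by (intro borel_measurable_add borel_measurable_scaleR borel_measurable_sum borel_measurable_const
      measurable_compose[OF measurable_snd])
     (auto intro!: measurable_compose[OF measurable_component_singleton])

lemma measurable_embed [measurable]: "embed t \<in> (\<Pi>\<^sub>M b\<in>J. lborel) \<rightarrow>\<^sub>M borel"
  unfolding embed_def
  by (intro borel_measurable_add borel_measurable_scaleR borel_measurable_sum borel_measurable_const)
     (auto intro!: measurable_compose[OF measurable_component_singleton])

lemma sets_slice [simp, measurable_cong]: "sets (slice t) = sets borel"
  by (simp add: slice_def)

lemma space_slice [simp]: "space (slice t) = UNIV"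
  by (simp add: slice_def)

lemma nn_integral_slice_eq:
  "F \<in> borel_measurable borel \<Longrightarrow> (\<integral>\<^sup>+x. F x \<partial>slice t) = (\<integral>\<^sup>+y. F (embed t y) \<partial>(\<Pi>\<^sub>M b\<in>J. lborel))"
  unfolding slice_def by (subst nn_integral_distr) auto

sublocale product_sigma_finite "\<lambda>b :: real ^ 'n. lborel :: real measure"
  by standard

text \<open>Lebesgue measure is invariant under \<open>T\<close> and is the product of its
  coordinate measures; the factor belonging to \<open>e\<^sub>0\<close> is split off.\<close>

lemma nn_integral_lborel_slice:
  assumes [measurable]: "F \<in> borel_measurable borel"
  shows "(\<integral>\<^sup>+x. F x \<partial>lborel) = (\<integral>\<^sup>+t. \<integral>\<^sup>+x. F x \<partial>slice t \<partial>lborel)"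
proof -
  have [measurable]: "T \<in> borel_measurable borel"
    by (intro borel_measurable_continuous_onI continuous_T)
  have sumT: "T (\<Sum>b\<in>Basis. f b *\<^sub>R b) = (\<Sum>b\<in>Basis. f b *\<^sub>R T b)" for f
    by (simp add: linear_sum[OF orthogonal_transformation_linear[OF T]]
        linear_scale[OF orthogonal_transformation_linear[OF T]])
  have m: "(\<lambda>f. \<Sum>b\<in>Basis. f b *\<^sub>R b) \<in> (\<Pi>\<^sub>M b\<in>(Basis :: (real ^ 'n) set). lborel) \<rightarrow>\<^sub>M borel"
    by (intro borel_measurable_scaleR borel_measurable_sum borel_measurable_const)
     (auto intro!: measurable_compose[OF measurable_component_singleton])
  have m2: "(\<lambda>f. \<Sum>b\<in>Basis. f b *\<^sub>R T b) \<in> (\<Pi>\<^sub>M b\<in>(Basis :: (real ^ 'n) set). lborel) \<rightarrow>\<^sub>M borel"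
    by (intro borel_measurable_scaleR borel_measurable_sum borel_measurable_const)
     (auto intro!: measurable_compose[OF measurable_component_singleton])
  have "(\<integral>\<^sup>+x. F x \<partial>lborel) = (\<integral>\<^sup>+x. F (T x) \<partial>lborel)"
    by (subst lborel_orthogonal_transformation[OF T, symmetric], subst nn_integral_distr) auto
  also have "\<dots> = (\<integral>\<^sup>+f. F (T (\<Sum>b\<in>Basis. f b *\<^sub>R b)) \<partial>(\<Pi>\<^sub>M b\<in>Basis. lborel))"
    using m by (subst lborel_def, subst nn_integral_distr) (auto simp: lborel_eq_real)
  also have "\<dots> = (\<integral>\<^sup>+f. F (\<Sum>b\<in>Basis. f b *\<^sub>R T b) \<partial>(\<Pi>\<^sub>M b\<in>insert e\<^sub>0 J. lborel))"
    by (simp only: sumT Basis_eq_insert[symmetric])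
  also have "\<dots> = (\<integral>\<^sup>+t. \<integral>\<^sup>+y. F (\<Sum>b\<in>Basis. (y(e\<^sub>0 := t)) b *\<^sub>R T b) \<partial>(\<Pi>\<^sub>M b\<in>J. lborel) \<partial>lborel)"
    using m2 by (subst product_nn_integral_insert_rev) (auto simp: Basis_eq_insert[symmetric])
  also have "\<dots> = (\<integral>\<^sup>+t. \<integral>\<^sup>+y. F (embed t y) \<partial>(\<Pi>\<^sub>M b\<in>J. lborel) \<partial>lborel)"
  proof -
    have "(\<Sum>b\<in>Basis. (y(e\<^sub>0 := t)) b *\<^sub>R T b) = embed t y" for y t
      unfolding Basis_eq_insert embed_def by (auto intro!: sum.cong)
    then show ?thesis by simp
  qed
  finally show ?thesis by (simp add: nn_integral_slice_eq)
qed

lemma measurable_nn_integral_slice: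
  assumes [measurable]: "F \<in> borel_measurable borel"
  shows "(\<lambda>t. \<integral>\<^sup>+x. F x \<partial>slice t) \<in> borel_measurable lborel"
proof -
  interpret P: sigma_finite_measure "\<Pi>\<^sub>M b\<in>J. lborel :: real measure"
    by (rule sigma_finite) simp
  have "(\<lambda>p. F (case p of (t, y) \<Rightarrow> embed t y)) \<in> borel_measurable (lborel \<Otimes>\<^sub>M (\<Pi>\<^sub>M b\<in>J. lborel))"
    by measurable
  from P.borel_measurable_nn_integral_fst[OF this] show ?thesis by (simp add: nn_integral_slice_eq)
qed

lemma AE_slice:
  assumes "AE x in lborel. P x"
  shows "AE t in lborel. AE x in slice t. P x"
proof -
  obtain N where N: "{x. \<not> P x} \<subseteq> N" "N \<in> null_sets lborel"
    using assms unfolding eventually_ae_filter by auto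
  then have [measurable]: "N \<in> sets borel" by auto
  have "(\<integral>\<^sup>+t. emeasure (slice t) N \<partial>lborel) = (\<integral>\<^sup>+t. \<integral>\<^sup>+x. indicator N x \<partial>slice t \<partial>lborel)"
    by simp
  also have "\<dots> = (\<integral>\<^sup>+x. indicator N x \<partial>lborel)"
    by (rule nn_integral_lborel_slice[symmetric]) auto
  also have "\<dots> = 0" using N(2) by auto
  finally have 0: "(\<integral>\<^sup>+t. emeasure (slice t) N \<partial>lborel) = 0" .
  have "(\<lambda>t. emeasure (slice t) N) \<in> borel_measurable lborel"
    using measurable_nn_integral_slice[of "indicator N"] by simp
  with 0 have "AE t in lborel. emeasure (slice t) N = 0"
    by (subst (asm) nn_integral_0_iff_AE) auto
  then show ?thesis
  proof eventually_elim
    case (elim t)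
    then have "N \<in> null_sets (slice t)" by (auto simp: null_sets_def)
    then show ?case using N(1) by (auto simp: eventually_ae_filter)
  qed
qed

text \<open>Presents the slicing as the image of a product of two measures, so that Fubini's theorem
  for signed integrable functions carries over.\<close>

lemma lborel_eq_distr_embed:
  "distr (lborel \<Otimes>\<^sub>M (\<Pi>\<^sub>M b\<in>J. lborel)) borel (\<lambda>(t, y). embed t y) = lborel"
proof (rule measure_eqI)
  interpret P: sigma_finite_measure "\<Pi>\<^sub>M b\<in>J. lborel :: real measure"
    by (rule sigma_finite) simp
  fix A :: "(real ^ 'n) set" assume "A \<in> sets (distr (lborel \<Otimes>\<^sub>M (\<Pi>\<^sub>M b\<in>J. lborel)) borel (\<lambda>(t, y). embed t y))"
  then have [measurable]: "A \<in> sets borel" by simp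
  have "emeasure (distr (lborel \<Otimes>\<^sub>M (\<Pi>\<^sub>M b\<in>J. lborel)) borel (\<lambda>(t, y). embed t y)) A =
      (\<integral>\<^sup>+p. indicator A (case p of (t, y) \<Rightarrow> embed t y) \<partial>(lborel \<Otimes>\<^sub>M (\<Pi>\<^sub>M b\<in>J. lborel)))"
    by (subst nn_integral_indicator[symmetric], simp, subst nn_integral_distr) auto
  also have "\<dots> = (\<integral>\<^sup>+t. \<integral>\<^sup>+y. indicator A (embed t y) \<partial>(\<Pi>\<^sub>M b\<in>J. lborel) \<partial>lborel)"
    by (subst P.nn_integral_fst[symmetric]) auto
  also have "\<dots> = (\<integral>\<^sup>+t. \<integral>\<^sup>+x. indicator A x \<partial>slice t \<partial>lborel)"
    by (simp add: nn_integral_slice_eq[of "indicator A"] del: nn_integral_indicator)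
  also have "\<dots> = (\<integral>\<^sup>+x. indicator A x \<partial>lborel)" by (rule nn_integral_lborel_slice[symmetric]) auto
  finally show "emeasure (distr (lborel \<Otimes>\<^sub>M (\<Pi>\<^sub>M b\<in>J. lborel)) borel (\<lambda>(t, y). embed t y)) A = emeasure lborel A"
    by simp
qed simp

lemma
  fixes h :: "real ^ 'n \<Rightarrow> real"
  assumes h: "integrable lborel h"
  shows AE_integrable_slice: "AE t in lborel. integrable (slice t) h"
    and integrable_slice_integral: "integrable lborel (\<lambda>t. LINT x|slice t. h x)"
    and integral_slice_integral: "(LINT t|lborel. LINT x|slice t. h x) = (LINT x|lborel. h x)"
proof -
  interpret P: sigma_finite_measure "\<Pi>\<^sub>M b\<in>J. lborel :: real measure"
    by (rule sigma_finite) simp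
  interpret PP: pair_sigma_finite lborel "\<Pi>\<^sub>M b\<in>J. lborel :: real measure" ..
  have [measurable]: "h \<in> borel_measurable borel" using h by auto
  have "integrable (lborel \<Otimes>\<^sub>M (\<Pi>\<^sub>M b\<in>J. lborel)) (\<lambda>p. h (case p of (t, y) \<Rightarrow> embed t y))"
    using h by (subst (asm) lborel_eq_distr_embed[symmetric], subst (asm) integrable_distr_eq) auto
  then have int: "integrable (lborel \<Otimes>\<^sub>M (\<Pi>\<^sub>M b\<in>J. lborel)) (\<lambda>(t, y). h (embed t y))"
    by (simp add: split_beta')
  have sl: "(LINT x|slice t. h x) = (LINT y|(\<Pi>\<^sub>M b\<in>J. lborel). h (embed t y))" for t
    unfolding slice_def by (rule integral_distr) auto
  show "AE t in lborel. integrable (slice t) h"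
    using PP.AE_integrable_fst[OF int]
    by eventually_elim (simp add: slice_def integrable_distr_eq)
  show "integrable lborel (\<lambda>t. LINT x|slice t. h x)"
    using PP.integrable_fst[OF int] by (simp add: sl)
  have "(LINT x|lborel. h x) = (LINT p|(lborel \<Otimes>\<^sub>M (\<Pi>\<^sub>M b\<in>J. lborel)). h (case p of (t, y) \<Rightarrow> embed t y))"
    by (subst lborel_eq_distr_embed[symmetric], subst integral_distr) auto
  then show "(LINT t|lborel. LINT x|slice t. h x) = (LINT x|lborel. h x)"
    using PP.integral_fst[OF int] by (simp add: sl split_beta')
qed

lemma AE_slice_height: "AE x in slice t. T e\<^sub>0 \<bullet> x = t"
proof -
  have "AE y in (\<Pi>\<^sub>M b\<in>J. lborel). T e\<^sub>0 \<bullet> embed t y = t" by (simp add: inner_embed)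
  then show ?thesis unfolding slice_def by (subst AE_distr_iff) auto
qed

lemma emeasure_slice_box:
  assumes [measurable]: "\<And>b. b \<in> J \<Longrightarrow> I b \<in> sets borel"
  shows "emeasure (slice t) {x. \<forall>b\<in>J. T b \<bullet> x \<in> I b} = (\<Prod>b\<in>J. emeasure lborel (I b))"
proof -
  have m: "{x. \<forall>b\<in>J. T b \<bullet> x \<in> I b} \<in> sets borel"
  proof -
    have "{x. \<forall>b\<in>J. T b \<bullet> x \<in> I b} = (\<Inter>b\<in>J. (\<lambda>x. T b \<bullet> x) -` I b) \<inter> UNIV" by auto
    moreover have "(\<lambda>x. T b \<bullet> x) -` I b \<in> sets borel" if "b \<in> J" for b
      using measurable_sets[OF measurable_inner_T assms[OF that]] by simp
    ultimately show ?thesis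
      by (cases "J = {}") (auto intro!: sets.finite_INT)
  qed
  have "embed t -` {x. \<forall>b\<in>J. T b \<bullet> x \<in> I b} \<inter> space (\<Pi>\<^sub>M b\<in>J. lborel) = (\<Pi>\<^sub>E b\<in>J. I b)"
    by (auto simp: inner_embed space_PiM PiE_iff)
  then have "emeasure (slice t) {x. \<forall>b\<in>J. T b \<bullet> x \<in> I b} = emeasure (\<Pi>\<^sub>M b\<in>J. lborel) (\<Pi>\<^sub>E b\<in>J. I b)"
    unfolding slice_def using m by (subst emeasure_distr) auto
  also have "\<dots> = (\<Prod>b\<in>J. emeasure lborel (I b))"
    by (rule emeasure_PiM) auto
  finally show ?thesis .
qed

lemma
  assumes \<gamma>: "\<And>b. b \<in> J \<Longrightarrow> integrable lborel (\<gamma> b)"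
  shows integrable_slice_tensor: "integrable (slice t) (tensor T J \<gamma>)"
    and integral_slice_tensor: "(LINT x|slice t. tensor T J \<gamma> x) = (\<Prod>b\<in>J. LINT s|lborel. \<gamma> b s)"
proof -
  have [measurable]: "\<And>b. b \<in> J \<Longrightarrow> \<gamma> b \<in> borel_measurable borel" using \<gamma> by auto
  have m: "tensor T J \<gamma> \<in> borel_measurable borel"
    unfolding tensor_def[abs_def]
    by (intro borel_measurable_prod measurable_compose[OF measurable_inner_T]) auto
  have eq: "tensor T J \<gamma> (embed t y) = (\<Prod>b\<in>J. \<gamma> b (y b))" for y
    unfolding tensor_def by (intro prod.cong) (auto simp: inner_embed)
  show "integrable (slice t) (tensor T J \<gamma>)"
    unfolding slice_def using m
    by (subst integrable_distr_eq) (auto simp: eq intro!: product_integrable_prod \<gamma>)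
  have "(LINT x|slice t. tensor T J \<gamma> x) = (LINT y|(\<Pi>\<^sub>M b\<in>J. lborel). (\<Prod>b\<in>J. \<gamma> b (y b)))"
    unfolding slice_def using m by (subst integral_distr) (auto simp: eq)
  then show "(LINT x|slice t. tensor T J \<gamma> x) = (\<Prod>b\<in>J. LINT s|lborel. \<gamma> b s)"
    by (simp add: product_integral_prod \<gamma>)
qed

lemma slice_compact_finite:
  assumes "compact K" shows "emeasure (slice t) K < \<infinity>"
proof -
  obtain B where B: "\<And>x. x \<in> K \<Longrightarrow> norm x \<le> B"
    using compact_imp_bounded[OF assms] bounded_iff by blast
  have "\<bar>T b \<bullet> x\<bar> \<le> B" if "x \<in> K" "b \<in> J" for b x
  proof -
    have "\<bar>T b \<bullet> x\<bar> \<le> norm (T b) * norm x" by (rule Cauchy_Schwarz_ineq2)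
    also have "\<dots> \<le> B" using that B J_subset by (simp add: orthogonal_transformation_norm[OF T])
    finally show ?thesis .
  qed
  then have "K \<subseteq> {x. \<forall>b\<in>J. T b \<bullet> x \<in> {-B..B}}" by (force simp: abs_le_iff)
  then have "emeasure (slice t) K \<le> emeasure (slice t) {x. \<forall>b\<in>J. T b \<bullet> x \<in> {-B..B}}"
    by (intro emeasure_mono) auto
  also have "\<dots> = (\<Prod>b\<in>J. emeasure lborel {-B..B})" by (rule emeasure_slice_box) auto
  also have "\<dots> < \<infinity>"
    by (simp add: emeasure_lborel_Icc_eq power_less_top_ennreal)
  finally show ?thesis .
qed

end

section \<open>Integration by parts on almost every hyperplane\<close>

text \<open>Local integrability gives measurability on compact subsets only; the function cut off to
  \<open>U\<close> is the pointwise limit along a compact exhaustion.\<close>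

lemma indicator_mult_measurable:
  assumes U: "open U" and v: "v locally_integrable_on U"
  shows "(\<lambda>x. indicator U x * v x) \<in> borel_measurable lebesgue"
proof -
  obtain C :: "nat \<Rightarrow> _" where C: "\<And>n. compact (C n)" "\<And>n. C n \<subseteq> U" "\<Union>(range C) = U"
      "\<And>K. \<lbrakk>compact K; K \<subseteq> U\<rbrakk> \<Longrightarrow> \<exists>N. \<forall>n\<ge>N. K \<subseteq> C n"
    using open_Union_compact_subsets[OF U] by metis
  have "(\<lambda>x. indicator (C n) x * v x) \<in> borel_measurable lebesgue" for n
    using v C(1,2)[of n] by (auto simp: locally_integrable_on_def set_integrable_def)
  moreover have "(\<lambda>n. indicator (C n) x * v x) \<longlonglongrightarrow> indicator U x * v x" for x
  proof (cases "x \<in> U")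
    case True
    then obtain N where "\<forall>n\<ge>N. {x} \<subseteq> C n" using C(4)[of "{x}"] by auto
    then have "eventually (\<lambda>n. indicator (C n) x * v x = indicator U x * v x) sequentially"
      using True by (auto simp: eventually_sequentially intro!: exI[of _ N])
    then show ?thesis by (rule tendsto_eventually)
  next
    case False
    then have "x \<notin> C n" for n using C(2)[of n] by auto
    with False show ?thesis by simp
  qed
  ultimately show ?thesis
    by (rule borel_measurable_LIMSEQ_real[where u = "\<lambda>n x. indicator (C n) x * v x", rotated])
qed

lemma partial_deriv_outside_support:
  assumes "x \<notin> closure {x. g x \<noteq> 0}" shows "partial_deriv j g x = 0"
proof -
  have "(g has_derivative (\<lambda>_. 0)) (at x)"
  proof (rule has_derivative_transform_within_open[OF has_derivative_const])
    show "open (- closure {x. g x \<noteq> 0})" by auto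
    show "x \<in> - closure {x. g x \<noteq> 0}" using assms by simp
    show "\<And>y. y \<in> - closure {x. g x \<noteq> 0} \<Longrightarrow> 0 = g y"
      using closure_subset[of "{x. g x \<noteq> 0}"] by auto
  qed
  then show ?thesis by (simp add: partial_deriv_eq)
qed

lemma weak_partial_direction:
  fixes T :: "real ^ 'n \<Rightarrow> real ^ 'n"
  assumes v: "\<And>j. weak_partial U j u (v j)" and g: "test_function U g"
  shows "set_integrable lebesgue U (\<lambda>x. u x * (\<Sum>j\<in>UNIV. c $ j * partial_deriv j g x))"
    and "set_integrable lebesgue U (\<lambda>x. (\<Sum>j\<in>UNIV. c $ j * v j x) * g x)"
    and "(LINT x:U|lebesgue. u x * (\<Sum>j\<in>UNIV. c $ j * partial_deriv j g x)) =
      - (LINT x:U|lebesgue. (\<Sum>j\<in>UNIV. c $ j * v j x) * g x)"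
proof -
  note gD = test_functionD[OF g]
  have lu: "u locally_integrable_on U" and lv: "\<And>j. v j locally_integrable_on U"
    and w: "\<And>j. (LINT x:U|lebesgue. u x * partial_deriv j g x) = - (LINT x:U|lebesgue. v j x * g x)"
    using v g by (auto simp: weak_partial_def)
  have "continuous_on UNIV (partial_deriv j g)" for j
    using g continuously_differentiable_continuous[of 0]
    by (metis continuously_differentiable.simps(2) test_function_def)
  then have 1: "set_integrable lebesgue U (\<lambda>x. u x * partial_deriv j g x)" for j
    by (intro integrable_mult_compact_support[OF lu gD(2,3)] partial_deriv_outside_support)
  have 2: "set_integrable lebesgue U (\<lambda>x. v j x * g x)" for j
    by (intro integrable_mult_compact_support[OF lv gD(2,3,1,4)])
  have e1: "indicator U x *\<^sub>R (u x * (\<Sum>j\<in>UNIV. c $ j * partial_deriv j g x)) =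
      (\<Sum>j\<in>UNIV. c $ j * (indicator U x *\<^sub>R (u x * partial_deriv j g x)))" for x
    by (simp add: sum_distrib_left mult_ac)
  have e2: "indicator U x *\<^sub>R ((\<Sum>j\<in>UNIV. c $ j * v j x) * g x) =
      (\<Sum>j\<in>UNIV. c $ j * (indicator U x *\<^sub>R (v j x * g x)))" for x
    by (simp add: sum_distrib_left sum_distrib_right mult_ac)
  show "set_integrable lebesgue U (\<lambda>x. u x * (\<Sum>j\<in>UNIV. c $ j * partial_deriv j g x))"
    unfolding set_integrable_def e1 using 1[unfolded set_integrable_def] by auto
  show "set_integrable lebesgue U (\<lambda>x. (\<Sum>j\<in>UNIV. c $ j * v j x) * g x)"
    unfolding set_integrable_def e2 using 2[unfolded set_integrable_def] by auto
  have "(LINT x:U|lebesgue. u x * (\<Sum>j\<in>UNIV. c $ j * partial_deriv j g x)) =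
      (\<Sum>j\<in>UNIV. c $ j * (LINT x:U|lebesgue. u x * partial_deriv j g x))"
    unfolding set_lebesgue_integral_def e1
    using 1[unfolded set_integrable_def] by (subst Bochner_Integration.integral_sum) auto
  also have "\<dots> = - (\<Sum>j\<in>UNIV. c $ j * (LINT x:U|lebesgue. v j x * g x))"
    by (simp add: w sum_negf)
  also have "(\<Sum>j\<in>UNIV. c $ j * (LINT x:U|lebesgue. v j x * g x)) =
      (LINT x:U|lebesgue. (\<Sum>j\<in>UNIV. c $ j * v j x) * g x)"
    unfolding set_lebesgue_integral_def e2
    using 2[unfolded set_integrable_def] by (subst Bochner_Integration.integral_sum) auto
  finally show "(LINT x:U|lebesgue. u x * (\<Sum>j\<in>UNIV. c $ j * partial_deriv j g x)) =
      - (LINT x:U|lebesgue. (\<Sum>j\<in>UNIV. c $ j * v j x) * g x)" .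
qed

context rotated_coordinates
begin

lemma tensor_Basis_upd: "tensor T Basis (\<gamma>(e\<^sub>0 := \<eta>)) x = \<eta> (T e\<^sub>0 \<bullet> x) * tensor T J \<gamma> x"
  unfolding tensor_def Basis_eq_insert by (auto intro!: prod.cong)

lemma tensor_J_measurable:
  assumes "\<And>b k. b \<in> J \<Longrightarrow> smooth_upto k (\<gamma> b)"
  shows "tensor T J \<gamma> \<in> borel_measurable borel"
  unfolding tensor_def[abs_def]
  by (intro borel_measurable_prod measurable_compose[OF measurable_inner_T]
      borel_measurable_continuous_onI smooth_upto_continuous assms)

lemma tensor_eq_0: "b \<in> J \<Longrightarrow> \<gamma> b (T b \<bullet> x) = 0 \<Longrightarrow> tensor T J \<gamma> x = 0"
  unfolding tensor_def by (rule prod_zero) auto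

lemma tensor_continuous:
  assumes "\<And>b k. b \<in> J \<Longrightarrow> smooth_upto k (\<gamma> b)"
  shows "continuous_on UNIV (tensor T J \<gamma>)"
  unfolding tensor_def[abs_def]
  by (intro continuous_on_prod continuous_on_compose2[OF smooth_upto_continuous[OF assms]]
      continuous_intros) auto

lemma slab_eq:
  "{x. (\<forall>c\<in>J. l c \<le> T c \<bullet> x \<and> T c \<bullet> x \<le> r c) \<and> s1 \<le> T e\<^sub>0 \<bullet> x \<and> T e\<^sub>0 \<bullet> x \<le> s2} =
    {x. \<forall>c\<in>Basis. (l(e\<^sub>0 := s1)) c \<le> T c \<bullet> x \<and> T c \<bullet> x \<le> (r(e\<^sub>0 := s2)) c}"
proof -
  have upd: "(f(e\<^sub>0 := s)) c = f c" if "c \<in> J" for f :: "real ^ 'n \<Rightarrow> real" and s c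
    using that by (metis e0_notin_J fun_upd_other)
  show ?thesis
    by (simp only: Basis_eq_insert ball_insert upd fun_upd_same conj_commute cong: ball_cong)
qed

text \<open>The test function is a product over \<open>J\<close> times a factor
  \<open>\<eta>\<close> of the height. Since \<open>b\<close> lies in \<open>J\<close>,
  differentiation along \<open>T b\<close> does not touch \<open>\<eta>\<close>, so the slice
  integral of the integration-by-parts defect is orthogonal to every plateau between
  \<open>s1\<close> and \<open>s2\<close> and vanishes at almost every height. Only an inequality
  with \<open>g\<close> is recorded, which frees the conclusion from the choice of the weak
  derivatives.\<close>

lemma AE_slice_integration_by_parts:
  fixes U :: "(real ^ 'n) set"
  assumes U: "open U" and u: "continuous_on U u"
    and v: "\<And>j. weak_partial U j u (v j)"
    and g: "g \<in> borel_measurable borel" "\<And>x. g x \<ge> 0"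
    and bound: "AE x in lebesgue. x \<in> U \<longrightarrow> \<bar>\<Sum>j\<in>UNIV. T b $ j * v j x\<bar> \<le> g x"
    and b: "b \<in> J"
    and smooth: "\<And>c k. c \<in> J \<Longrightarrow> smooth_upto k (\<gamma> c)" "\<And>k. smooth_upto k \<gamma>'"
    and deriv: "\<And>s. (\<gamma> b has_real_derivative \<gamma>' s) (at s)"
    and supp: "\<And>c s. c \<in> J \<Longrightarrow> \<not> (l c \<le> s \<and> s \<le> r c) \<Longrightarrow> \<gamma> c s = 0"
      "\<And>s. \<not> (l b \<le> s \<and> s \<le> r b) \<Longrightarrow> \<gamma>' s = 0"
    and W: "{x. (\<forall>c\<in>J. l c \<le> T c \<bullet> x \<and> T c \<bullet> x \<le> r c) \<and> s1 \<le> T e\<^sub>0 \<bullet> x \<and> T e\<^sub>0 \<bullet> x \<le> s2} \<subseteq> U"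
      (is "?W \<subseteq> U")
  shows "AE t in lborel. s1 < t \<and> t < s2 \<longrightarrow>
    ennreal \<bar>LINT x|slice t. indicator U x * u x * tensor T J (\<gamma>(b := \<gamma>')) x\<bar> \<le>
    (\<integral>\<^sup>+x. ennreal (g x * \<bar>tensor T J \<gamma> x\<bar>) \<partial>slice t)"
proof -
  define G where "G = tensor T J \<gamma>"
  define G' where "G' = tensor T J (\<gamma>(b := \<gamma>'))"
  define w where "w x = (\<Sum>j\<in>UNIV. T b $ j * v j x)" for x
  have Wc: "compact ?W"
    unfolding slab_eq by (rule compact_orthogonal_box[OF T])
  have Wm [measurable]: "?W \<in> sets borel" using compact_imp_closed[OF Wc] by simp
  have lv: "v j locally_integrable_on U" for j using v by (simp add: weak_partial_def)
  \<comment> \<open>The weak derivatives are merely Lebesgue measurable, while the slices are Borel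
    measures; hence the Borel representative \<open>w'\<close>.\<close>
  have "(\<lambda>x. \<Sum>j\<in>UNIV. T b $ j * (indicator U x * v j x)) \<in> borel_measurable lebesgue"
    by (intro borel_measurable_sum borel_measurable_times[OF borel_measurable_const]
        indicator_mult_measurable[OF U lv])
  then obtain w' where w'[measurable]: "w' \<in> borel_measurable borel"
    and ae_w: "AE x in lborel. (\<Sum>j\<in>UNIV. T b $ j * (indicator U x * v j x)) = w' x"
    using completion_ex_borel_measurable_real[of _ lborel] by force
  have ae_w': "AE x in lborel. x \<in> U \<longrightarrow> w x = w' x"
    using ae_w by eventually_elim (auto simp: w_def)
  have ae_bound: "AE x in lborel. x \<in> U \<longrightarrow> \<bar>w' x\<bar> \<le> g x"
    using ae_w' bound[unfolded AE_completion_iff] by eventually_elim (auto simp: w_def)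
  define u' where "u' x = indicator U x * u x" for x
  have [measurable]: "u' \<in> borel_measurable borel"
    using borel_measurable_continuous_on_indicator[OF _ u] U by (simp add: u'_def[abs_def])
  have [measurable]: "g \<in> borel_measurable borel" by (rule g)
  have [measurable]: "G \<in> borel_measurable borel" unfolding G_def using smooth by (intro tensor_J_measurable)
  have [measurable]: "G' \<in> borel_measurable borel" unfolding G'_def using smooth by (intro tensor_J_measurable) auto
  have G0: "G x = 0 \<and> G' x = 0" if "c \<in> J" "\<not> (l c \<le> T c \<bullet> x \<and> T c \<bullet> x \<le> r c)" for c x
    unfolding G_def G'_def using supp that by (auto intro!: tensor_eq_0[OF that(1)])
  \<comment> \<open>Cutting down to the compact slab makes \<open>h\<close> integrable. At heights
    between \<open>s1\<close> and \<open>s2\<close> nothing is lost, because \<open>G\<close> and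
    \<open>G'\<close> vanish outside the box in the coordinates of \<open>J\<close>.\<close>
  define h where "h x = indicator ?W x * (u' x * G' x + w' x * G x)" for x
  have [measurable]: "h \<in> borel_measurable borel" unfolding h_def[abs_def] by measurable

  have test: "integrable lborel (\<lambda>x. h x * \<eta> (T e\<^sub>0 \<bullet> x)) \<and> (LINT x|lborel. h x * \<eta> (T e\<^sub>0 \<bullet> x)) = 0"
    if \<eta>: "\<And>k. smooth_upto k \<eta>" "\<And>s. \<not> (s1 \<le> s \<and> s \<le> s2) \<Longrightarrow> \<eta> s = 0" for \<eta>
  proof -
    define g0 where "g0 = tensor T Basis (\<gamma>(e\<^sub>0 := \<eta>))"
    have tf: "test_function U g0" unfolding g0_def
    proof (rule test_function_tensor[OF T])
      show "smooth_upto k ((\<gamma>(e\<^sub>0 := \<eta>)) c)" if "c \<in> Basis" for c k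
        using that \<eta> smooth by (auto simp: Basis_eq_insert)
      show "(\<gamma>(e\<^sub>0 := \<eta>)) c s = 0" if "c \<in> Basis" "\<not> ((l(e\<^sub>0 := s1)) c \<le> s \<and> s \<le> (r(e\<^sub>0 := s2)) c)" for c s
        using that \<eta> supp by (cases "c = e\<^sub>0") (auto simp: Basis_eq_insert)
      show "{x. \<forall>c\<in>Basis. (l(e\<^sub>0 := s1)) c \<le> T c \<bullet> x \<and> T c \<bullet> x \<le> (r(e\<^sub>0 := s2)) c} \<subseteq> U"
        using W unfolding slab_eq .
    qed
    have bB: "b \<in> Basis" "b \<noteq> e\<^sub>0" using b e0_notin_J by (auto intro: J_subset)
    \<comment> \<open>The product rule asks for a derivative of every factor, including those that
      are not differentiated in the end; these are chosen from the smoothness assumption.\<close>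
    define \<delta> where "\<delta> c = (if c = b then \<gamma>' else (SOME d. \<forall>s. ((\<gamma>(e\<^sub>0 := \<eta>)) c has_real_derivative d s) (at s)))" for c
    have d: "((\<gamma>(e\<^sub>0 := \<eta>)) c has_real_derivative \<delta> c s) (at s)" if "c \<in> Basis" for c s
    proof (cases "c = b")
      case True
      then show ?thesis using deriv bB by (simp add: \<delta>_def)
    next
      case False
      have "smooth_upto (Suc 0) ((\<gamma>(e\<^sub>0 := \<eta>)) c)"
        using that \<eta>(1)[of "Suc 0"] smooth(1)[of c "Suc 0"]
        by (auto simp: Basis_eq_insert simp del: smooth_upto.simps)
      then have "\<exists>d. \<forall>s. ((\<gamma>(e\<^sub>0 := \<eta>)) c has_real_derivative d s) (at s)"
        unfolding smooth_upto.simps by blast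
      from someI_ex[OF this] show ?thesis using False by (simp add: \<delta>_def)
    qed
    have g0: "g0 x = \<eta> (T e\<^sub>0 \<bullet> x) * G x" for x
      unfolding g0_def G_def by (rule tensor_Basis_upd)
    have dg0: "(\<Sum>j\<in>UNIV. T b $ j * partial_deriv j g0 x) = \<eta> (T e\<^sub>0 \<bullet> x) * G' x" for x
    proof -
      have "(\<Sum>j\<in>UNIV. T b $ j * partial_deriv j g0 x) = tensor T Basis ((\<gamma>(e\<^sub>0 := \<eta>))(b := \<delta> b)) x"
        unfolding g0_def by (rule tensor_dir_deriv[OF T bB(1) d])
      also have "(\<gamma>(e\<^sub>0 := \<eta>))(b := \<delta> b) = (\<gamma>(b := \<gamma>'))(e\<^sub>0 := \<eta>)"
        using bB by (auto simp: \<delta>_def fun_upd_twist)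
      finally show ?thesis unfolding G'_def tensor_Basis_upd .
    qed
    note wk = weak_partial_direction[OF v tf, where c = "T b", unfolded dg0, folded w_def]
    have eq: "AE x in lebesgue. indicator U x *\<^sub>R (u x * (\<eta> (T e\<^sub>0 \<bullet> x) * G' x)) +
        indicator U x *\<^sub>R (w x * g0 x) = h x * \<eta> (T e\<^sub>0 \<bullet> x)"
      using AE_completion[OF ae_w']
    proof eventually_elim
      case (elim x)
      show ?case
      proof (cases "x \<in> ?W")
        case True
        then have "x \<in> U" using W by blast
        with elim have "w x = w' x" by blast
        moreover have "h x = u x * G' x + w' x * G x"
          unfolding h_def indicator_eq_1_iff[THEN iffD2, OF True] using \<open>x \<in> U\<close> by (simp add: u'_def)
        ultimately show ?thesis using \<open>x \<in> U\<close> by (simp add: g0 algebra_simps)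
      next
        case False
        then have "\<eta> (T e\<^sub>0 \<bullet> x) = 0 \<or> (G x = 0 \<and> G' x = 0)" using G0 \<eta>(2) by blast
        moreover have "h x = 0"
          unfolding h_def indicator_eq_0_iff[THEN iffD2, OF False] by simp
        ultimately show ?thesis by (auto simp only: g0 mult_zero_left mult_zero_right scaleR_zero_right add_0_left)
      qed
    qed
    have m\<eta>: "\<eta> \<in> borel_measurable borel"
      by (rule borel_measurable_continuous_onI[OF smooth_upto_continuous[OF \<eta>(1)]])
    have meas: "(\<lambda>x. h x * \<eta> (T e\<^sub>0 \<bullet> x)) \<in> borel_measurable borel"
      by (intro borel_measurable_times measurable_compose[OF measurable_inner_T m\<eta>]) measurable
    then have meas': "(\<lambda>x. h x * \<eta> (T e\<^sub>0 \<bullet> x)) \<in> borel_measurable lborel"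
      and meas'': "(\<lambda>x. h x * \<eta> (T e\<^sub>0 \<bullet> x)) \<in> borel_measurable lebesgue"
      by (auto intro: measurable_completion)
    have int: "integrable lebesgue (\<lambda>x. indicator U x *\<^sub>R (u x * (\<eta> (T e\<^sub>0 \<bullet> x) * G' x)) +
        indicator U x *\<^sub>R (w x * g0 x))"
      using wk(1,2) unfolding set_integrable_def by (rule Bochner_Integration.integrable_add)
    have "integrable lebesgue (\<lambda>x. h x * \<eta> (T e\<^sub>0 \<bullet> x))"
      by (rule iffD1[OF integrable_cong_AE[OF borel_measurable_integrable[OF int] meas'' eq] int])
    then have 1: "integrable lborel (\<lambda>x. h x * \<eta> (T e\<^sub>0 \<bullet> x))"
      using integrable_completion[OF meas'] by simp
    have "(LINT x|lborel. h x * \<eta> (T e\<^sub>0 \<bullet> x)) = (LINT x|lebesgue. h x * \<eta> (T e\<^sub>0 \<bullet> x))"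
      using integral_completion[OF meas'] by simp
    also have "\<dots> = (LINT x|lebesgue. indicator U x *\<^sub>R (u x * (\<eta> (T e\<^sub>0 \<bullet> x) * G' x)) +
        indicator U x *\<^sub>R (w x * g0 x))"
      using integral_cong_AE[OF borel_measurable_integrable[OF int] meas'' eq] by simp
    also have "\<dots> = 0"
      using wk unfolding set_integrable_def set_lebesgue_integral_def by simp
    finally show ?thesis using 1 by simp
  qed

  have int_h: "integrable lborel h"
  proof -
    have lu: "u locally_integrable_on U" using v by (simp add: weak_partial_def)
    note i = integrable_indicator_mult_continuous[OF _ Wc W]
    have cG: "continuous_on UNIV G" unfolding G_def using smooth by (intro tensor_continuous)
    have cG': "continuous_on UNIV G'" unfolding G'_def using smooth by (intro tensor_continuous) auto
    have int: "integrable lebesgue (\<lambda>x. (indicator ?W x * u x) * G' x + (\<Sum>j\<in>UNIV. T b $ j * ((indicator ?W x * v j x) * G x)))"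
      using i[OF lu cG'] i[OF lv cG]
      by (intro Bochner_Integration.integrable_add Bochner_Integration.integrable_sum integrable_mult_right)
    have ae_h: "AE x in lebesgue. (indicator ?W x * u x) * G' x + (\<Sum>j\<in>UNIV. T b $ j * ((indicator ?W x * v j x) * G x)) = h x"
      using AE_completion[OF ae_w']
    proof eventually_elim
      case (elim x)
      show ?case
      proof (cases "x \<in> ?W")
        case True
        then have "x \<in> U" using W by auto
        with elim have "w' x = w x" by simp
        then show ?thesis using True \<open>x \<in> U\<close>
          by (simp add: h_def u'_def w_def sum_distrib_right sum_distrib_left mult_ac)
      qed (simp add: h_def)
    qed
    have hm: "h \<in> borel_measurable lebesgue" by (intro measurable_completion) simp
    from int have "integrable lebesgue h"
      by (rule iffD1[OF integrable_cong_AE[OF borel_measurable_integrable[OF int] hm ae_h]])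
    then show ?thesis using integrable_completion[of h lborel] by simp
  qed

  have "AE t in lborel. s1 < t \<and> t < s2 \<longrightarrow> (LINT x|slice t. h x) = 0"
  proof (rule AE_zero_of_plateau_integrals)
    show "integrable lborel (\<lambda>t. LINT x|slice t. h x)" by (rule integrable_slice_integral[OF int_h])
    fix m a c assume "s1 \<le> a" "c \<le> s2" "a < c"
    then have "\<not> (s1 \<le> s \<and> s \<le> s2) \<Longrightarrow> plateau m a c s = 0" for s
      by (intro plateau_eq_0) linarith
    from test[OF smooth_upto_plateau this]
    have "integrable lborel (\<lambda>x. h x * plateau m a c (T e\<^sub>0 \<bullet> x))"
      and 0: "(LINT x|lborel. h x * plateau m a c (T e\<^sub>0 \<bullet> x)) = 0" by blast+
    then have "(LINT t|lborel. LINT x|slice t. h x * plateau m a c (T e\<^sub>0 \<bullet> x)) = 0"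
      using integral_slice_integral by simp
    \<comment> \<open>On one slice the height is almost everywhere equal to \<open>t\<close>, so the
      plateau is a constant factor.\<close>
    moreover have "(LINT x|slice t. h x * plateau m a c (T e\<^sub>0 \<bullet> x)) = (LINT x|slice t. h x) * plateau m a c t" for t
    proof -
      have "(LINT x|slice t. h x * plateau m a c (T e\<^sub>0 \<bullet> x)) = (LINT x|slice t. h x * plateau m a c t)"
        using AE_slice_height[of t] plateau_borel
        by (intro integral_cong_AE borel_measurable_times measurable_compose[OF measurable_inner_T]) auto
      then show ?thesis by simp
    qed
    ultimately show "(LINT t|lborel. (LINT x|slice t. h x) * plateau m a c t) = 0" by simp
  qed
  moreover have "AE t in lborel. AE x in slice t. x \<in> U \<longrightarrow> \<bar>w' x\<bar> \<le> g x" by (rule AE_slice[OF ae_bound])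
  moreover note AE_integrable_slice[OF int_h]
  ultimately show ?thesis
  proof (eventually_elim, intro impI)
    case (elim t)
    assume t: "s1 < t \<and> t < s2"
    have ae: "AE x in slice t. (x \<notin> ?W \<longrightarrow> G x = 0 \<and> G' x = 0)"
      using AE_slice_height[of t] by eventually_elim (use t G0 in force)
    have "compact (u ` ?W)" using Wc W u by (intro compact_continuous_image) (auto intro: continuous_on_subset)
    then obtain Bu where Bu: "\<forall>y\<in>u ` ?W. norm y \<le> Bu" using compact_imp_bounded bounded_iff by blast
    have "continuous_on UNIV G'" unfolding G'_def using smooth by (intro tensor_continuous) auto
    then have "compact (G' ` ?W)" using Wc by (intro compact_continuous_image) (auto intro: continuous_on_subset)
    then obtain BG where BG: "\<forall>y\<in>G' ` ?W. norm y \<le> BG" using compact_imp_bounded bounded_iff by blast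
    \<comment> \<open>The part with \<open>u\<close> is bounded on a set of finite slice measure. It
      is thus integrable by itself, and so is the remaining part of \<open>h\<close>, which
      justifies splitting the integral.\<close>
    have iuG: "integrable (slice t) (\<lambda>x. indicator ?W x * (u' x * G' x))"
    proof (rule Bochner_Integration.integrable_bound)
      show "integrable (slice t) (\<lambda>x. (Bu * BG) * indicator ?W x)"
        using slice_compact_finite[OF Wc] by auto
      have "\<bar>u' x * G' x\<bar> \<le> Bu * BG" if "x \<in> ?W" for x
      proof -
        have "\<bar>u' x\<bar> \<le> Bu" "\<bar>G' x\<bar> \<le> BG" using Bu BG that W by (auto simp: u'_def)
        then show ?thesis by (simp add: abs_mult mult_mono')
      qed
      then show "AE x in slice t. norm (indicator ?W x * (u' x * G' x)) \<le> norm ((Bu * BG) * indicator ?W x)"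
        by (force simp: indicator_def)
    qed measurable
    have "(\<lambda>x. indicator ?W x * (w' x * G x)) = (\<lambda>x. h x - indicator ?W x * (u' x * G' x))"
      by (auto simp: h_def algebra_simps)
    then have iwG: "integrable (slice t) (\<lambda>x. indicator ?W x * (w' x * G x))"
      using elim(3) iuG by auto
    have "(LINT x|slice t. h x) = (LINT x|slice t. indicator ?W x * (u' x * G' x)) + (LINT x|slice t. indicator ?W x * (w' x * G x))"
      unfolding Bochner_Integration.integral_add[OF iuG iwG, symmetric] by (simp only: h_def[abs_def] distrib_left)
    then have sum0: "(LINT x|slice t. indicator ?W x * (u' x * G' x)) = - (LINT x|slice t. indicator ?W x * (w' x * G x))"
      using elim(1) t by simp
    have "(LINT x|slice t. indicator U x * u x * tensor T J (\<gamma>(b := \<gamma>')) x) = (LINT x|slice t. u' x * G' x)"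
      by (simp add: u'_def G'_def)
    also have "\<dots> = (LINT x|slice t. indicator ?W x * (u' x * G' x))"
    proof (rule integral_cong_AE)
      show "AE x in slice t. u' x * G' x = indicator ?W x * (u' x * G' x)"
        using ae by eventually_elim (auto simp: indicator_def)
    qed measurable
    finally have "\<bar>LINT x|slice t. indicator U x * u x * tensor T J (\<gamma>(b := \<gamma>')) x\<bar> = norm (LINT x|slice t. indicator ?W x * (w' x * G x))"
      using sum0 by simp
    then have "ennreal \<bar>LINT x|slice t. indicator U x * u x * tensor T J (\<gamma>(b := \<gamma>')) x\<bar> \<le>
        (\<integral>\<^sup>+x. ennreal (norm (indicator ?W x * (w' x * G x))) \<partial>slice t)"
      using integral_norm_bound_ennreal[OF iwG] by simp
    also have "\<dots> \<le> (\<integral>\<^sup>+x. ennreal (g x * \<bar>G x\<bar>) \<partial>slice t)"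
    proof (rule nn_integral_mono_AE)
      show "AE x in slice t. ennreal (norm (indicator ?W x * (w' x * G x))) \<le> ennreal (g x * \<bar>G x\<bar>)"
        using elim(2)
      proof eventually_elim
        case (elim x)
        show ?case
          using elim W g(2)[of x] by (cases "x \<in> ?W") (auto simp: abs_mult intro!: ennreal_leI mult_right_mono)
      qed
    qed
    finally show "ennreal \<bar>LINT x|slice t. indicator U x * u x * tensor T J (\<gamma>(b := \<gamma>')) x\<bar> \<le>
        (\<integral>\<^sup>+x. ennreal (g x * \<bar>tensor T J \<gamma> x\<bar>) \<partial>slice t)" by (simp add: G_def)
  qed
qed

end

section \<open>Dyadic cubes in a hyperplane\<close>

definition dyadic_bump :: "nat \<Rightarrow> int \<Rightarrow> real \<Rightarrow> real" where
  "dyadic_bump m k s = 2 ^ m * bump (2 ^ m * s - of_int k)"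

definition dyadic_step :: "nat \<Rightarrow> int \<Rightarrow> real \<Rightarrow> real" where
  "dyadic_step m k s = smooth_step (2 ^ m * s - of_int k)"

lemma smooth_upto_dyadic_bump: "smooth_upto i (dyadic_bump m k)"
proof -
  have "smooth_upto i (\<lambda>s. 2 ^ m * bump (2 ^ m * s + (- of_int k)))"
    by (intro smooth_upto_mult smooth_upto_const smooth_upto_affine smooth_upto_bump)
  then show ?thesis by (simp add: dyadic_bump_def[abs_def])
qed

lemma smooth_upto_dyadic_step: "smooth_upto i (dyadic_step m k)"
proof -
  have "smooth_upto i (\<lambda>s. smooth_step (2 ^ m * s + (- of_int k)))"
    by (intro smooth_upto_affine smooth_upto_smooth_step)
  then show ?thesis by (simp add: dyadic_step_def[abs_def])
qed

lemma dyadic_step_deriv: "(dyadic_step m k has_real_derivative dyadic_bump m k s) (at s)"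
  unfolding dyadic_step_def[abs_def] dyadic_bump_def
  by (rule DERIV_cong[OF DERIV_chain2[OF smooth_step_deriv, where g = "\<lambda>s. 2 ^ m * s - of_int k"]])
     (auto intro!: derivative_eq_intros)

lemma dyadic_bump_nonneg: "dyadic_bump m k s \<ge> 0"
  by (simp add: dyadic_bump_def bump_nonneg)

lemma dyadic_bump_floor: "dyadic_bump m k s \<noteq> 0 \<Longrightarrow> \<lfloor>2 ^ m * s\<rfloor> = k"
proof -
  assume "dyadic_bump m k s \<noteq> 0"
  then have "bump (2 ^ m * s - of_int k) \<noteq> 0" by (simp add: dyadic_bump_def)
  then have "\<not> (2 ^ m * s - of_int k \<le> 0 \<or> 2 ^ m * s - of_int k \<ge> 1)"
    using bump_eq_0 by blast
  then show ?thesis by (simp add: floor_eq_iff not_le)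
qed

lemma dyadic_floor_Suc: "\<lfloor>2 ^ Suc m * s\<rfloor> div 2 = \<lfloor>2 ^ m * (s::real)\<rfloor>"
proof -
  have "\<lfloor>2 ^ m * s\<rfloor> = \<lfloor>(2 ^ Suc m * s) / real_of_int 2\<rfloor>" by simp
  also have "\<dots> = \<lfloor>2 ^ Suc m * s\<rfloor> div 2" by (rule floor_divide_real_eq_div) simp
  finally show ?thesis by simp
qed

text \<open>To the left of the parent interval both steps are 0 and to the right both are 1. The
  equal mass of child and parent bump thus makes the primitive of their difference compactly
  supported.\<close>

lemma dyadic_step_diff_floor:
  assumes "dyadic_step (Suc m) k s - dyadic_step m (k div 2) s \<noteq> 0"
  shows "\<lfloor>2 ^ m * s\<rfloor> = k div 2"
proof -
  have k: "2 * real_of_int (k div 2) \<le> real_of_int k" "real_of_int k \<le> 2 * real_of_int (k div 2) + 1"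
    by linarith+
  have "\<not> 2 ^ m * s \<le> real_of_int (k div 2)"
  proof
    assume "2 ^ m * s \<le> real_of_int (k div 2)"
    then have "2 ^ Suc m * s - real_of_int k \<le> 0" "2 ^ m * s - real_of_int (k div 2) \<le> 0" using k by auto
    then show False using assms smooth_step_le_0 by (simp add: dyadic_step_def)
  qed
  moreover have "\<not> real_of_int (k div 2) + 1 \<le> 2 ^ m * s"
  proof
    assume "real_of_int (k div 2) + 1 \<le> 2 ^ m * s"
    then have "1 \<le> 2 ^ Suc m * s - real_of_int k" "1 \<le> 2 ^ m * s - real_of_int (k div 2)" using k by auto
    then show False using assms smooth_step_ge_1 by (simp add: dyadic_step_def)
  qed
  ultimately show ?thesis by (simp add: floor_eq_iff)
qed

lemma dyadic_step_diff_le_1: "\<bar>dyadic_step m k s - dyadic_step m' k' s\<bar> \<le> 1"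
  unfolding dyadic_step_def using smooth_step_bounds by (smt (verit))

lemma dyadic_floor_bounds:
  "\<lfloor>2 ^ m * s\<rfloor> = k \<longleftrightarrow> real_of_int k / 2 ^ m \<le> s \<and> s < (real_of_int k + 1) / 2 ^ m"
  by (simp add: floor_eq_iff field_simps)

lemma
  shows integrable_dyadic_bump: "integrable lborel (dyadic_bump m k)"
    and integral_dyadic_bump: "(LINT s|lborel. dyadic_bump m k s) = 1"
proof -
  let ?a = "real_of_int k / 2 ^ m" and ?b = "(real_of_int k + 1) / 2 ^ m"
  have ab: "?a \<le> ?b" by (simp add: divide_right_mono)
  have "has_bochner_integral lborel (\<lambda>x. indicator {?a..?b} x *\<^sub>R dyadic_bump m k x)
      (dyadic_step m k ?b - dyadic_step m k ?a)"
    by (rule has_bochner_integral_FTC_Icc[OF ab])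
       (auto intro: continuous_on_subset[OF smooth_upto_continuous[OF smooth_upto_dyadic_bump]]
          has_vector_derivative_at_within dyadic_step_deriv[unfolded has_real_derivative_iff_has_vector_derivative])
  moreover have "indicator {?a..?b} x *\<^sub>R dyadic_bump m k x = dyadic_bump m k x" for x
    using dyadic_bump_floor[of m k x] by (auto simp: dyadic_floor_bounds indicator_def)
  moreover have "dyadic_step m k ?b - dyadic_step m k ?a = 1"
    by (simp add: dyadic_step_def smooth_step_le_0 smooth_step_ge_1)
  ultimately have "has_bochner_integral lborel (dyadic_bump m k) 1" by (simp only:)
  then show "integrable lborel (dyadic_bump m k)" "(LINT s|lborel. dyadic_bump m k s) = 1"
    by (auto simp: has_bochner_integral_iff)
qed

text \<open>The factors of a test function that interpolates between the child cube \<open>z\<close> of generation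
  \<open>m + 1\<close> (coordinates in \<open>S\<close>) and its parent of generation \<open>m\<close> (remaining coordinates).\<close>

definition mixed_bump :: "nat \<Rightarrow> ('a \<Rightarrow> int) \<Rightarrow> 'a set \<Rightarrow> 'a \<Rightarrow> real \<Rightarrow> real" where
  "mixed_bump m z S c = (if c \<in> S then dyadic_bump (Suc m) (z c) else dyadic_bump m (z c div 2))"

lemma smooth_upto_mixed_bump: "smooth_upto k (mixed_bump m z S c)"
  by (simp add: mixed_bump_def smooth_upto_dyadic_bump)

lemma mixed_bump_nonneg: "mixed_bump m z S c s \<ge> 0"
  by (simp add: mixed_bump_def dyadic_bump_nonneg)

lemma mixed_bump_floor: "mixed_bump m z S c s \<noteq> 0 \<Longrightarrow> \<lfloor>2 ^ m * s\<rfloor> = z c div 2"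
  unfolding mixed_bump_def
  using dyadic_bump_floor[of "Suc m" "z c" s] dyadic_bump_floor[of m "z c div 2" s] dyadic_floor_Suc[of m s]
  by (auto split: if_splits)

context rotated_coordinates
begin

text \<open>Cubes constrain only the coordinates along the hyperplanes, so they are unbounded in the direction
  \<open>T e\<^sub>0\<close>; the hyperplane itself is imposed by the measure \<^term>\<open>slice t\<close> or by intersecting with
  \<open>plane t\<close>.\<close>

definition dcube :: "nat \<Rightarrow> (real ^ 'n \<Rightarrow> int) \<Rightarrow> (real ^ 'n) set" where
  "dcube m z = {x. \<forall>b\<in>J. \<lfloor>2 ^ m * (T b \<bullet> x)\<rfloor> = z b}"

definition closed_dcube :: "real \<Rightarrow> nat \<Rightarrow> (real ^ 'n \<Rightarrow> int) \<Rightarrow> (real ^ 'n) set" where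
  "closed_dcube t m z = {x. (\<forall>b\<in>J. real_of_int (z b) / 2 ^ m \<le> T b \<bullet> x \<and>
     T b \<bullet> x \<le> (real_of_int (z b) + 1) / 2 ^ m) \<and> T e\<^sub>0 \<bullet> x = t}"

definition addr :: "nat \<Rightarrow> real ^ 'n \<Rightarrow> real ^ 'n \<Rightarrow> int" where
  "addr m x b = \<lfloor>2 ^ m * (T b \<bullet> x)\<rfloor>"

definition plane :: "real \<Rightarrow> (real ^ 'n) set" where
  "plane t = {x. T e\<^sub>0 \<bullet> x = t}"

definition step_diff :: "nat \<Rightarrow> (real ^ 'n \<Rightarrow> int) \<Rightarrow> real ^ 'n \<Rightarrow> real \<Rightarrow> real" where
  "step_diff m z b s = dyadic_step (Suc m) (z b) s - dyadic_step m (z b div 2) s"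

definition bump_diff :: "nat \<Rightarrow> (real ^ 'n \<Rightarrow> int) \<Rightarrow> real ^ 'n \<Rightarrow> real \<Rightarrow> real" where
  "bump_diff m z b s = dyadic_bump (Suc m) (z b) s - dyadic_bump m (z b div 2) s"

text \<open>All that is retained of the weak derivatives on one hyperplane. The index
  \<open>z\<close> addresses a child cube, whereas the condition on \<open>U\<close> concerns its
  parent, which supports all the products involved.\<close>

definition ibp_slice :: "(real ^ 'n) set \<Rightarrow> (real ^ 'n \<Rightarrow> real) \<Rightarrow> (real ^ 'n \<Rightarrow> real) \<Rightarrow> real \<Rightarrow> bool" where
  "ibp_slice U u g t \<longleftrightarrow> (\<forall>m z S b. S \<subseteq> J \<longrightarrow> b \<in> J \<longrightarrow> closed_dcube t m (\<lambda>c. z c div 2) \<subseteq> U \<longrightarrow>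
     ennreal \<bar>LINT x|slice t. indicator U x * u x * tensor T J ((mixed_bump m z S)(b := bump_diff m z b)) x\<bar> \<le>
     (\<integral>\<^sup>+x. ennreal (g x * \<bar>tensor T J ((mixed_bump m z S)(b := step_diff m z b)) x\<bar>) \<partial>slice t))"

lemma addr_self: "x \<in> dcube m (addr m x)"
  by (simp add: dcube_def addr_def)

lemma addr_Suc: "addr (Suc m) x b div 2 = addr m x b"
  unfolding addr_def by (rule dyadic_floor_Suc)

lemma dcube_addr_subset: "dcube (m + j) (addr (m + j) x) \<subseteq> dcube m (addr m x)"
proof (induction j)
  case (Suc j)
  have "dcube (m + Suc j) (addr (m + Suc j) x) \<subseteq> dcube (m + j) (addr (m + j) x)"
  proof
    fix y assume "y \<in> dcube (m + Suc j) (addr (m + Suc j) x)"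
    then have "\<And>b. b \<in> J \<Longrightarrow> addr (Suc (m + j)) y b = addr (Suc (m + j)) x b"
      by (auto simp: dcube_def addr_def)
    then have "\<And>b. b \<in> J \<Longrightarrow> addr (m + j) y b = addr (m + j) x b"
      using addr_Suc by metis
    then show "y \<in> dcube (m + j) (addr (m + j) x)" by (auto simp: dcube_def addr_def)
  qed
  with Suc show ?case by blast
qed simp

lemma dcube_plane_subset_closed: "dcube m z \<inter> plane t \<subseteq> closed_dcube t m z"
  by (auto simp: dcube_def plane_def closed_dcube_def dyadic_floor_bounds less_imp_le)

lemma compact_closed_dcube: "compact (closed_dcube t m z)"
proof -
  have "closed_dcube t m z = {x. (\<forall>c\<in>J. real_of_int (z c) / 2 ^ m \<le> T c \<bullet> x \<and>
      T c \<bullet> x \<le> (real_of_int (z c) + 1) / 2 ^ m) \<and> t \<le> T e\<^sub>0 \<bullet> x \<and> T e\<^sub>0 \<bullet> x \<le> t}"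
    by (auto simp: closed_dcube_def)
  then show ?thesis unfolding slab_eq by (simp only: compact_orthogonal_box[OF T])
qed

lemma dcube_measurable [measurable]: "dcube m z \<in> sets borel"
proof -
  have "{x. \<lfloor>2 ^ m * (T b \<bullet> x)\<rfloor> = z b} \<in> sets borel" for b
    unfolding dyadic_floor_bounds by measurable
  moreover have "dcube m z = (\<Inter>b\<in>J. {x. \<lfloor>2 ^ m * (T b \<bullet> x)\<rfloor> = z b}) \<inter> UNIV"
    by (auto simp: dcube_def)
  ultimately show ?thesis by (cases "J = {}") (auto intro!: sets.finite_INT)
qed

lemma emeasure_dcube: "emeasure (slice t) (dcube m z) = ennreal ((1 / 2 ^ m) ^ card J)"
proof -
  have "emeasure (slice t) (dcube m z) =
      emeasure (slice t) {x. \<forall>b\<in>J. T b \<bullet> x \<in> {real_of_int (z b) / 2 ^ m ..< (real_of_int (z b) + 1) / 2 ^ m}}"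
    by (simp add: dcube_def dyadic_floor_bounds)
  also have "\<dots> = (\<Prod>b\<in>J. emeasure lborel {real_of_int (z b) / 2 ^ m ..< (real_of_int (z b) + 1) / 2 ^ m})"
    by (rule emeasure_slice_box) auto
  also have "\<dots> = (\<Prod>b\<in>J. ennreal (1 / 2 ^ m))"
    by (intro prod.cong refl) (simp add: divide_right_mono add_divide_distrib)
  finally show ?thesis by (simp add: ennreal_power)
qed

lemma tensor_dcube:
  assumes "tensor T J \<gamma> x \<noteq> 0" and "\<And>b s. b \<in> J \<Longrightarrow> \<gamma> b s \<noteq> 0 \<Longrightarrow> \<lfloor>2 ^ m * s\<rfloor> = z b"
  shows "x \<in> dcube m z"
  using assms tensor_eq_0 unfolding dcube_def by blast

text \<open>Every factor, whether of child or parent type and also after the replacement in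
  coordinate \<open>b\<close>, lives on the parent interval; so the whole product is supported in
  the parent cube.\<close>

lemma mixed_upd_floor:
  assumes "b \<in> J"
  shows "((mixed_bump m z S)(b := step_diff m z b)) c s \<noteq> 0 \<Longrightarrow> \<lfloor>2 ^ m * s\<rfloor> = z c div 2"
    and "((mixed_bump m z S)(b := bump_diff m z b)) c s \<noteq> 0 \<Longrightarrow> \<lfloor>2 ^ m * s\<rfloor> = z c div 2"
proof -
  show "((mixed_bump m z S)(b := step_diff m z b)) c s \<noteq> 0 \<Longrightarrow> \<lfloor>2 ^ m * s\<rfloor> = z c div 2"
    using mixed_bump_floor[of m z S c s] dyadic_step_diff_floor[of m "z c" s]
    by (auto simp: step_diff_def split: if_splits)
  show "((mixed_bump m z S)(b := bump_diff m z b)) c s \<noteq> 0 \<Longrightarrow> \<lfloor>2 ^ m * s\<rfloor> = z c div 2"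
    using mixed_bump_floor[of m z S c s] mixed_bump_floor[of m z "{c}" c s] mixed_bump_floor[of m z "{}" c s]
    by (cases "c = b"; cases "dyadic_bump (Suc m) (z c) s = 0") (auto simp: bump_diff_def mixed_bump_def)
qed

text \<open>Each test product comes with its own null set of heights. Countability is reached by
  integer addresses on \<open>J\<close> together with rational bounds for the thickness of the slab
  above and below the cube.\<close>

lemma AE_ibp_slice:
  fixes U :: "(real ^ 'n) set"
  assumes U: "open U" and u: "continuous_on U u"
    and v: "\<And>j. weak_partial U j u (v j)"
    and g: "g \<in> borel_measurable borel" "\<And>x. g x \<ge> 0"
    and bound: "\<And>b. b \<in> J \<Longrightarrow> AE x in lebesgue. x \<in> U \<longrightarrow> \<bar>\<Sum>j\<in>UNIV. T b $ j * v j x\<bar> \<le> g x"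
  shows "AE t in lborel. ibp_slice U u g t"
proof -
  define P where "P m z S b t \<longleftrightarrow>
     ennreal \<bar>LINT x|slice t. indicator U x * u x * tensor T J ((mixed_bump m z S)(b := bump_diff m z b)) x\<bar> \<le>
     (\<integral>\<^sup>+x. ennreal (g x * \<bar>tensor T J ((mixed_bump m z S)(b := step_diff m z b)) x\<bar>) \<partial>slice t)"
    for m z S b t
  define l where "l m z c = real_of_int (z c div 2) / 2 ^ m" for m :: nat and z :: "real ^ 'n \<Rightarrow> int" and c
  define r where "r m z c = (real_of_int (z c div 2) + 1) / 2 ^ m" for m :: nat and z :: "real ^ 'n \<Rightarrow> int" and c
  define W where "W m z s1 s2 = {x. (\<forall>c\<in>J. l m z c \<le> T c \<bullet> x \<and> T c \<bullet> x \<le> r m z c) \<and> s1 \<le> T e\<^sub>0 \<bullet> x \<and> T e\<^sub>0 \<bullet> x \<le> s2}"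
    for m z s1 s2
  have single: "AE t in lborel. s1 < t \<and> t < s2 \<longrightarrow> P m z S b t"
    if "W m z s1 s2 \<subseteq> U" "b \<in> J" for m z S b s1 s2
  proof -
    have out: "\<lfloor>2 ^ m * s\<rfloor> = z c div 2 \<Longrightarrow> l m z c \<le> s \<and> s \<le> r m z c" for c s
      by (simp add: dyadic_floor_bounds l_def r_def)
    have "AE t in lborel. s1 < t \<and> t < s2 \<longrightarrow>
      ennreal \<bar>LINT x|slice t. indicator U x * u x *
        tensor T J (((mixed_bump m z S)(b := step_diff m z b))(b := bump_diff m z b)) x\<bar> \<le>
      (\<integral>\<^sup>+x. ennreal (g x * \<bar>tensor T J ((mixed_bump m z S)(b := step_diff m z b)) x\<bar>) \<partial>slice t)"
    proof (rule AE_slice_integration_by_parts[OF U u v g bound, where l = "l m z" and r = "r m z"])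
      show "smooth_upto k (((mixed_bump m z S)(b := step_diff m z b)) c)" for c k
        unfolding step_diff_def[abs_def]
        by (auto simp del: smooth_upto.simps
            intro: smooth_upto_mixed_bump smooth_upto_diff smooth_upto_dyadic_step)
      show "smooth_upto k (bump_diff m z b)" for k
        unfolding bump_diff_def[abs_def] by (intro smooth_upto_diff smooth_upto_dyadic_bump)
      show "(((mixed_bump m z S)(b := step_diff m z b)) b has_real_derivative bump_diff m z b s) (at s)" for s
        unfolding step_diff_def[abs_def] bump_diff_def fun_upd_same
        by (intro DERIV_diff dyadic_step_deriv)
      show "((mixed_bump m z S)(b := step_diff m z b)) c s = 0" if "\<not> (l m z c \<le> s \<and> s \<le> r m z c)" for c s
        using mixed_upd_floor(1)[OF \<open>b \<in> J\<close>, of m z S c s] out[of s c] that by blast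
      show "bump_diff m z b s = 0" if "\<not> (l m z b \<le> s \<and> s \<le> r m z b)" for s
        using mixed_upd_floor(2)[OF \<open>b \<in> J\<close>, of m z S b s] out[of s b] that by auto
    qed (use that in \<open>auto simp: W_def\<close>)
    then show ?thesis by (simp add: P_def)
  qed
  \<comment> \<open>Functions on \<open>J\<close> are taken extensional, since the set of all
    integer-valued functions on the ambient space would be uncountable.\<close>
  define I where "I = (UNIV :: nat set) \<times> (J \<rightarrow>\<^sub>E (UNIV :: int set)) \<times> Pow J \<times> J \<times> (\<rat> :: real set) \<times> (\<rat> :: real set)"
  have "countable I"
    unfolding I_def by (intro countable_SIGMA countable_PiE countable_finite[of "Pow J"] countable_finite[of J] countable_rat) auto
  moreover have "AE t in lborel. W m z s1 s2 \<subseteq> U \<longrightarrow> s1 < t \<and> t < s2 \<longrightarrow> P m z S b t"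
    if "(m, z, S, b, s1, s2) \<in> I" for m z S b s1 s2
    using single[of m z s1 s2 b S] that by (cases "W m z s1 s2 \<subseteq> U") (auto simp: I_def)
  ultimately have "AE t in lborel. \<forall>i\<in>I. (case i of (m, z, S, b, s1, s2) \<Rightarrow>
      W m z s1 s2 \<subseteq> U \<longrightarrow> s1 < t \<and> t < s2 \<longrightarrow> P m z S b t)"
    by (subst AE_ball_countable) auto
  then show ?thesis
  proof eventually_elim
    case (elim t)
    show ?case unfolding ibp_slice_def
    proof (intro allI impI)
      fix m and z :: "real ^ 'n \<Rightarrow> int" and S b
      assume S: "S \<subseteq> J" and b: "b \<in> J" and cl: "closed_dcube t m (\<lambda>c. z c div 2) \<subseteq> U"
      \<comment> \<open>Only the values on \<open>J\<close> enter the products and cubes, so the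
        arbitrary address is replaced by its extensional version.\<close>
      define z' where "z' = restrict z J"
      \<comment> \<open>The closed parent cube at height \<open>t\<close> is compact, hence some
        neighbourhood of it lies in \<open>U\<close> and contains a thin slab with rational bounds
        around \<open>t\<close>.\<close>
      obtain \<epsilon> where \<epsilon>: "\<epsilon> > 0" "(\<Union>x\<in>closed_dcube t m (\<lambda>c. z c div 2). ball x \<epsilon>) \<subseteq> U"
        using compact_subset_open_imp_ball_epsilon_subset[OF compact_closed_dcube U cl] by blast
      obtain s1 where s1: "s1 \<in> \<rat>" "t - \<epsilon> < s1" "s1 < t" using Rats_dense_in_real[of "t - \<epsilon>" t] \<epsilon> by auto
      obtain s2 where s2: "s2 \<in> \<rat>" "t < s2" "s2 < t + \<epsilon>" using Rats_dense_in_real[of t "t + \<epsilon>"] \<epsilon> by auto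
      have "W m z' s1 s2 \<subseteq> U"
      proof
        fix x assume x: "x \<in> W m z' s1 s2"
        define y where "y = x + (t - T e\<^sub>0 \<bullet> x) *\<^sub>R T e\<^sub>0"
        have "T c \<bullet> y = T c \<bullet> x" if "c \<in> J" for c
        proof -
          have "T c \<bullet> T e\<^sub>0 = 0"
            using that J_subset[OF that] e0 e0_notin_J by (subst orthogonal_inner_Basis[OF T]) auto
          then show ?thesis by (simp add: y_def inner_add_right)
        qed
        moreover have "T e\<^sub>0 \<bullet> y = t"
          using e0 by (simp add: y_def inner_add_right orthogonal_inner_Basis[OF T])
        ultimately have "y \<in> closed_dcube t m (\<lambda>c. z c div 2)"
          using x by (auto simp: W_def closed_dcube_def l_def r_def z'_def)
        moreover have "dist y x < \<epsilon>"
        proof -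
          have "dist y x = \<bar>t - T e\<^sub>0 \<bullet> x\<bar>"
            using e0 by (simp add: y_def dist_norm orthogonal_transformation_norm[OF T])
          also have "\<dots> < \<epsilon>" using x s1 s2 by (auto simp: W_def)
          finally show ?thesis .
        qed
        then have "x \<in> ball y \<epsilon>" by simp
        ultimately show "x \<in> U" using \<epsilon>(2) by blast
      qed
      moreover have "(m, z', S, b, s1, s2) \<in> I" using S b s1 s2 by (auto simp: I_def z'_def)
      ultimately have "P m z' S b t" using elim s1 s2 by fastforce
      moreover have "tensor T J ((mixed_bump m z' S)(b := h)) = tensor T J ((mixed_bump m z S)(b := h))" for h
        unfolding tensor_def[abs_def] by (intro ext prod.cong) (auto simp: z'_def mixed_bump_def)
      moreover have "bump_diff m z' b = bump_diff m z b" "step_diff m z' b = step_diff m z b"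
        using b by (auto simp: z'_def bump_diff_def[abs_def] step_diff_def[abs_def])
      ultimately show "ennreal \<bar>LINT x|slice t. indicator U x * u x * tensor T J ((mixed_bump m z S)(b := bump_diff m z b)) x\<bar> \<le>
         (\<integral>\<^sup>+x. ennreal (g x * \<bar>tensor T J ((mixed_bump m z S)(b := step_diff m z b)) x\<bar>) \<partial>slice t)"
        by (simp add: P_def)
    qed
  qed
qed

end

section \<open>The oscillation estimate\<close>

text \<open>The summands telescope against \<open>x / (1 + x)\<close> along a sequence whose terms double.\<close>

lemma sum_min_geometric_le:
  fixes s :: real
  assumes s: "s > 0"
  shows "(\<Sum>j<N. min (s * 2 ^ j) (1 / (s * 2 ^ j))) \<le> 6"
proof -
  define F where "F x = x / (1 + x)" for x :: real
  \<comment> \<open>The difference of \<open>F\<close> is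
    \<open>x / ((1 + x) * (1 + 2 * x))\<close>; its denominator is at most 6 for
    \<open>x \<le> 1\<close> and at most 6 x^2 beyond, which is the origin of the constant
    6.\<close>
  have step: "min x (1 / x) \<le> 6 * (F (2 * x) - F x)" if x: "x > 0" for x
  proof -
    have F: "F (2 * x) - F x = x / ((1 + x) * (1 + 2 * x))"
      using x by (simp add: F_def divide_simps) (simp add: algebra_simps)
    show ?thesis
    proof (cases "x \<le> 1")
      case True
      have "(1 + x) * (1 + 2 * x) \<le> 2 * 3" using True x by (intro mult_mono) auto
      then have "x * ((1 + x) * (1 + 2 * x)) \<le> 6 * x" using mult_left_mono[of _ "2 * 3" x] x by simp
      moreover have "(1 + x) * (1 + 2 * x) > 0" using x by simp
      ultimately have "x \<le> 6 * x / ((1 + x) * (1 + 2 * x))" by (simp only: pos_le_divide_eq)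
      then show ?thesis unfolding F by simp
    next
      case False
      have "(1 + x) * (1 + 2 * x) \<le> (2 * x) * (3 * x)" using False by (intro mult_mono) auto
      then have "1 / x \<le> 6 * (x / ((1 + x) * (1 + 2 * x)))" using x by (simp add: field_simps)
      then show ?thesis unfolding F by linarith
    qed
  qed
  have "(\<Sum>j<N. min (s * 2 ^ j) (1 / (s * 2 ^ j))) \<le> (\<Sum>j<N. 6 * (F (s * 2 ^ Suc j) - F (s * 2 ^ j)))"
  proof (rule sum_mono)
    fix j
    show "min (s * 2 ^ j) (1 / (s * 2 ^ j)) \<le> 6 * (F (s * 2 ^ Suc j) - F (s * 2 ^ j))"
      using step[of "s * 2 ^ j"] s by (simp add: mult_ac)
  qed
  also have "\<dots> = 6 * (F (s * 2 ^ N) - F (s * 2 ^ 0))"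
    by (subst sum_distrib_left[symmetric], subst sum_lessThan_telescope) simp
  also have "\<dots> \<le> 6"
  proof -
    have "F (s * 2 ^ N) \<le> 1" "F (s * 2 ^ 0) \<ge> 0" using s by (auto simp: F_def add_nonneg_pos)
    then show ?thesis by simp
  qed
  finally show ?thesis .
qed

lemma convex_on_nonneg_power: "convex_on {0::real..} (\<lambda>x. x ^ k)"
proof (cases "even k")
  case True
  then show ?thesis
    by (rule convex_on_subset[OF convex_power_even]) (simp_all add: convex_real_interval)
qed (simp add: convex_power_odd)

text \<open>Jensen's inequality for the \<open>k\<close>-th power with weights
  \<open>q i / Q\<close>. It is Hoelder's inequality with exponents k and k/(k - 1), phrased with
  integer powers: the relation between \<open>s\<close>, \<open>w\<close> and \<open>q\<close> makes
  the weights cancel.\<close>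

lemma Holder_power_sum:
  fixes q r s w :: "'i \<Rightarrow> real"
  assumes I: "finite I" and k: "k \<ge> 1"
    and q: "\<And>i. i \<in> I \<Longrightarrow> q i > 0" and r: "\<And>i. i \<in> I \<Longrightarrow> r i \<ge> 0" and s: "\<And>i. i \<in> I \<Longrightarrow> s i \<ge> 0"
    and eq: "\<And>i. i \<in> I \<Longrightarrow> s i ^ k = w i * q i ^ (k - 1)"
  shows "(\<Sum>i\<in>I. s i * r i) ^ k \<le> (\<Sum>i\<in>I. q i) ^ (k - 1) * (\<Sum>i\<in>I. w i * r i ^ k)"
proof (cases "I = {}")
  case True
  then show ?thesis using k by (simp add: power_0_left)
next
  case False
  define Q where "Q = (\<Sum>i\<in>I. q i)"
  have Q: "Q > 0" unfolding Q_def using I False q by (intro sum_pos) auto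
  have qk: "q i ^ k = q i * q i ^ (k - 1)" for i using k by (cases k) auto
  have Qk: "Q ^ k = Q * Q ^ (k - 1)" using k by (cases k) auto
  have "(\<Sum>i\<in>I. (q i / Q) *\<^sub>R (s i * r i / q i)) ^ k \<le> (\<Sum>i\<in>I. (q i / Q) * (s i * r i / q i) ^ k)"
  proof (rule convex_on_sum[OF I False convex_on_nonneg_power])
    show "(\<Sum>i\<in>I. q i / Q) = 1" using Q by (simp add: sum_divide_distrib[symmetric] Q_def[symmetric])
  qed (use q r s Q in \<open>auto simp: less_imp_le\<close>)
  also have "(\<Sum>i\<in>I. (q i / Q) *\<^sub>R (s i * r i / q i)) = (\<Sum>i\<in>I. s i * r i) / Q"
    unfolding sum_divide_distrib using q Q by (intro sum.cong) (auto simp: less_imp_neq[symmetric])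
  also have "(\<Sum>i\<in>I. (q i / Q) * (s i * r i / q i) ^ k) = (\<Sum>i\<in>I. w i * r i ^ k) / Q"
    unfolding sum_divide_distrib
  proof (intro sum.cong refl)
    fix i assume i: "i \<in> I"
    then have "q i > 0" by (rule q)
    then show "q i / Q * (s i * r i / q i) ^ k = w i * r i ^ k / Q"
      using eq[OF i] Q by (simp add: power_divide power_mult_distrib qk field_simps)
  qed
  finally have "(\<Sum>i\<in>I. s i * r i) ^ k / (Q * Q ^ (k - 1)) \<le> (\<Sum>i\<in>I. w i * r i ^ k) / Q"
    by (simp add: power_divide Qk)
  then have "(\<Sum>i\<in>I. s i * r i) ^ k \<le> Q ^ (k - 1) * (\<Sum>i\<in>I. w i * r i ^ k)"
    using Q by (simp add: field_simps)
  then show ?thesis by (simp add: Q_def)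
qed

text \<open>Being constant on \<open>(0, 2]\<close> makes all small gradients a single level in the summation below; the
  value \<open>0\<close> at \<open>0\<close> is what makes the part of a cube where the gradient vanishes cost nothing.\<close>

definition lifted :: "(real \<Rightarrow> real) \<Rightarrow> real \<Rightarrow> real" where
  "lifted \<phi> s = (if s \<le> 0 then 0 else \<phi> (max s 2))"

text \<open>The maximum gives the lowest level (0, 2] the weight \<open>\<phi> 2\<close>, which the
  integral condition forces to be positive; \<open>\<phi> 1\<close> could be 0.\<close>

definition level_weight :: "(real \<Rightarrow> real) \<Rightarrow> nat \<Rightarrow> real" where
  "level_weight \<phi> i = \<phi> (2 ^ max 1 i)"

text \<open>With s = 2^(i+1) and w the weight of the level, this is the solution q of s^k = w
  q^(k-1) when \<alpha> = 1/(k - 1), as Hoelder's inequality demands.\<close>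

definition level_quotient :: "(real \<Rightarrow> real) \<Rightarrow> real \<Rightarrow> nat \<Rightarrow> real" where
  "level_quotient \<phi> \<alpha> i = 2 ^ Suc i * (2 ^ Suc i / level_weight \<phi> i) powr \<alpha>"

definition level_set :: "nat \<Rightarrow> real set" where
  "level_set i = (if i = 0 then {0<..2} else {2 ^ i<..2 ^ Suc i})"

section \<open>The growth condition and summation over dyadic levels\<close>

locale calderon_growth =
  fixes \<phi> :: "real \<Rightarrow> real" and \<alpha> :: real
  assumes nonneg: "\<And>t. t \<ge> 0 \<Longrightarrow> \<phi> t \<ge> 0" and mono: "mono_on {0..} \<phi>" and \<alpha>: "\<alpha> > 0"
    and finite_integral: "(\<integral>\<^sup>+ t\<in>{1..}. quotient_power \<phi> \<alpha> t \<partial>lborel) < \<infinity>"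
begin

lemma phi_mono: "0 \<le> a \<Longrightarrow> a \<le> b \<Longrightarrow> \<phi> a \<le> \<phi> b"
  using mono by (auto simp: mono_on_def)

lemma measurable_lifted [measurable]: "lifted \<phi> \<in> borel_measurable borel"
proof -
  have "mono (\<lambda>s. \<phi> (max s 2))" by (auto intro!: monoI phi_mono)
  then have [measurable]: "(\<lambda>s. \<phi> (max s 2)) \<in> borel_measurable borel" by (rule borel_measurable_mono)
  show ?thesis unfolding lifted_def[abs_def] by measurable
qed

text \<open>Otherwise \<phi> vanishes on [1, 2], where the convention t / 0 = \<infinity> makes the
  integral diverge.\<close>

lemma phi_2_pos: "\<phi> 2 > 0"
proof (rule ccontr)
  assume "\<not> \<phi> 2 > 0"
  then have "\<phi> t = 0" if "0 \<le> t" "t \<le> 2" for t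
    using phi_mono[OF that] nonneg[of t] nonneg[of 2] that by linarith
  then have "(\<integral>\<^sup>+ t. \<infinity> * indicator {1..2::real} t \<partial>lborel) \<le> (\<integral>\<^sup>+ t\<in>{1..}. quotient_power \<phi> \<alpha> t \<partial>lborel)"
    by (intro nn_integral_mono) (auto simp: quotient_power_def indicator_def)
  moreover have "(\<integral>\<^sup>+ t. \<infinity> * indicator {1..2::real} t \<partial>lborel) = (\<infinity> :: ennreal)"
    by (subst nn_integral_cmult_indicator) (auto simp: ennreal_top_mult)
  ultimately show False using finite_integral by (simp add: top_unique)
qed

lemma level_weight_pos: "level_weight \<phi> i > 0"
proof -
  have "(2::real) ^ 1 \<le> 2 ^ max 1 i" by (intro power_increasing) auto
  then have "\<phi> 2 \<le> level_weight \<phi> i" unfolding level_weight_def by (intro phi_mono) auto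
  with phi_2_pos show ?thesis by simp
qed

lemma level_quotient_pos: "level_quotient \<phi> \<alpha> i > 0"
  using level_weight_pos[of i] by (simp add: level_quotient_def)

text \<open>On the block from 2^i to 2^(i+1), monotonicity bounds t / \<phi>(t) from below by 2^i /
  \<phi>(2^(i+1)). The weight of level \<open>Suc i\<close> sits at the right end of the block,
  hence the shift of the index; replacing 2^(i+2) by 2^i costs 4 outside and 4 inside the
  power.\<close>

lemma level_quotient_Suc_le:
  "ennreal (level_quotient \<phi> \<alpha> (Suc i)) \<le>
    ennreal (4 * 4 powr \<alpha>) * (\<integral>\<^sup>+ t. quotient_power \<phi> \<alpha> t * indicator {2 ^ i<..<2 ^ Suc i :: real} t \<partial>lborel)"
proof -
  define w where "w = level_weight \<phi> (Suc i)"
  have w: "w > 0" unfolding w_def by (rule level_weight_pos)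
  have w_eq: "w = \<phi> (2 ^ Suc i)" by (simp add: w_def level_weight_def)
  define c where "c = (2 ^ i / w) powr \<alpha>"
  have "ennreal (c * 2 ^ i) = (\<integral>\<^sup>+ t. ennreal c * indicator {2 ^ i<..<2 ^ Suc i :: real} t \<partial>lborel)"
    by (subst nn_integral_cmult_indicator) (auto simp: ennreal_mult' c_def)
  also have "\<dots> \<le> (\<integral>\<^sup>+ t. quotient_power \<phi> \<alpha> t * indicator {2 ^ i<..<2 ^ Suc i :: real} t \<partial>lborel)"
  proof (rule nn_integral_mono)
    fix t :: real
    show "ennreal c * indicator {2 ^ i<..<2 ^ Suc i :: real} t \<le> quotient_power \<phi> \<alpha> t * indicator {2 ^ i<..<2 ^ Suc i :: real} t"
    proof (cases "t \<in> {2 ^ i<..<2 ^ Suc i}")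
      case True
      then have t: "2 ^ i < t" "t < 2 ^ Suc i" by auto
      have t0: "0 < t" by (rule less_trans[OF _ t(1)]) simp
      have "\<phi> t \<le> w" unfolding w_eq using t t0 by (intro phi_mono) auto
      have "ennreal c \<le> quotient_power \<phi> \<alpha> t"
      proof (cases "\<phi> t = 0")
        case False
        then have "\<phi> t > 0" using nonneg[of t] t0 by auto
        then have "2 ^ i / w \<le> t / \<phi> t" using t \<open>\<phi> t \<le> w\<close> by (intro frac_le) auto
        then have "c \<le> (t / \<phi> t) powr \<alpha>" unfolding c_def using w \<alpha> by (intro powr_mono2) auto
        then show ?thesis using False by (simp add: quotient_power_def ennreal_leI)
      qed (simp add: quotient_power_def)
      then show ?thesis using True by simp
    qed simp
  qed
  finally have 1: "ennreal (c * 2 ^ i) \<le> (\<integral>\<^sup>+ t. quotient_power \<phi> \<alpha> t * indicator {2 ^ i<..<2 ^ Suc i :: real} t \<partial>lborel)" .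
  have "level_quotient \<phi> \<alpha> (Suc i) = 4 * 2 ^ i * (4 * (2 ^ i / w)) powr \<alpha>"
    by (simp add: level_quotient_def w_def)
  also have "\<dots> = 4 * 4 powr \<alpha> * (c * 2 ^ i)"
    using w by (subst powr_mult) (auto simp: c_def)
  finally have "ennreal (level_quotient \<phi> \<alpha> (Suc i)) = ennreal (4 * 4 powr \<alpha> * (c * 2 ^ i))"
    by (rule arg_cong)
  also have "\<dots> = ennreal (4 * 4 powr \<alpha>) * ennreal (c * 2 ^ i)"
    by (rule ennreal_mult) (auto simp: c_def)
  finally have "ennreal (level_quotient \<phi> \<alpha> (Suc i)) = ennreal (4 * 4 powr \<alpha>) * ennreal (c * 2 ^ i)" .
  then show ?thesis using mult_left_mono[OF 1, of "ennreal (4 * 4 powr \<alpha>)"] by simp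
qed

lemma level_quotient_bounded: "\<exists>\<Lambda>\<ge>0. \<forall>N. (\<Sum>i<N. level_quotient \<phi> \<alpha> i) \<le> \<Lambda>"
proof -
  let ?A = "\<lambda>i. {2 ^ i<..<2 ^ Suc i} :: real set"
  obtain c where c: "c \<ge> 0" "(\<integral>\<^sup>+ t\<in>{1..}. quotient_power \<phi> \<alpha> t \<partial>lborel) = ennreal c"
    using finite_integral by (metis ennreal_cases infinity_ennreal_def less_irrefl)
  \<comment> \<open>\<phi> is monotone only on the nonnegative half-line. Truncating the argument
    gives a monotone and hence Borel function that agrees with it on all the blocks.\<close>
  have "mono (\<lambda>t. \<phi> (max 0 t))" by (auto intro!: monoI phi_mono)
  then have [measurable]: "(\<lambda>t. \<phi> (max 0 t)) \<in> borel_measurable borel" by (rule borel_measurable_mono)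
  have qm [measurable]: "(\<lambda>t. quotient_power \<phi> \<alpha> t * indicator (?A i) t) \<in> borel_measurable borel" for i
  proof -
    have pos: "t > 0" if "t \<in> ?A i" for t using that by (auto intro: less_trans[of 0 "2 ^ i"])
    have eq: "quotient_power \<phi> \<alpha> t * indicator (?A i) t =
        (if \<phi> (max 0 t) = 0 then \<infinity> else ennreal ((t / \<phi> (max 0 t)) powr \<alpha>)) * indicator (?A i) t" for t
      using pos[of t] by (auto simp: quotient_power_def indicator_def max_def)
    show ?thesis unfolding eq by measurable
  qed
  have disj: "(\<Sum>i<N. indicator (?A i) t :: ennreal) \<le> indicator {1..} t" for t N
  proof -
    have pw: "a = b" if "t \<in> ?A a" "t \<in> ?A b" for a b
    proof (rule ccontr)
      assume "a \<noteq> b"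
      then have "Suc a \<le> b \<or> Suc b \<le> a" by linarith
      then have "(2::real) ^ Suc a \<le> 2 ^ b \<or> (2::real) ^ Suc b \<le> 2 ^ a" by (meson one_le_numeral power_increasing)
      then show False using that by auto
    qed
    show ?thesis
    proof (cases "\<exists>i<N. t \<in> ?A i")
      case True
      then obtain i where i: "i < N" "t \<in> ?A i" by blast
      have "(\<Sum>j<N. indicator (?A j) t :: ennreal) = (\<Sum>j<N. if j = i then 1 else 0)"
        using i pw by (intro sum.cong) (auto simp: indicator_def)
      also have "\<dots> = 1" using i by simp
      also have "\<dots> = indicator {1..} t"
      proof -
        have "(1::real) \<le> 2 ^ i" by simp
        moreover have "2 ^ i < t" using i(2) by simp
        ultimately have "1 \<le> t" by linarith
        then show ?thesis by simp
      qed
      finally show ?thesis by simp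
    next
      case False
      then have "(\<Sum>j<N. indicator (?A j) t :: ennreal) = 0" by (intro sum.neutral) auto
      then show ?thesis by (simp only: zero_le)
    qed
  qed
  have S: "(\<Sum>i<N. level_quotient \<phi> \<alpha> (Suc i)) \<le> 4 * 4 powr \<alpha> * c" for N
  proof -
    have "ennreal (\<Sum>i<N. level_quotient \<phi> \<alpha> (Suc i)) = (\<Sum>i<N. ennreal (level_quotient \<phi> \<alpha> (Suc i)))"
      by (rule sum_ennreal[symmetric]) (simp add: level_quotient_pos less_imp_le)
    also have "\<dots> \<le> (\<Sum>i<N. ennreal (4 * 4 powr \<alpha>) * (\<integral>\<^sup>+ t. quotient_power \<phi> \<alpha> t * indicator (?A i) t \<partial>lborel))"
      by (intro sum_mono level_quotient_Suc_le)
    also have "\<dots> = ennreal (4 * 4 powr \<alpha>) * (\<integral>\<^sup>+ t. (\<Sum>i<N. quotient_power \<phi> \<alpha> t * indicator (?A i) t) \<partial>lborel)"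
      by (subst nn_integral_sum) (auto simp: sum_distrib_left simp del: power_Suc)
    also have "\<dots> \<le> ennreal (4 * 4 powr \<alpha>) * (\<integral>\<^sup>+ t\<in>{1..}. quotient_power \<phi> \<alpha> t \<partial>lborel)"
      using disj by (intro mult_left_mono nn_integral_mono) (auto simp: sum_distrib_left[symmetric] intro!: mult_left_mono)
    also have "\<dots> = ennreal (4 * 4 powr \<alpha> * c)" using c by (simp add: ennreal_mult')
    finally show ?thesis using c by (subst (asm) ennreal_le_iff) auto
  qed
  have "(\<Sum>i<N. level_quotient \<phi> \<alpha> i) \<le> level_quotient \<phi> \<alpha> 0 + 4 * 4 powr \<alpha> * c" for N
  proof (cases N)
    case 0
    then show ?thesis using c level_quotient_pos[of 0] by (simp add: add_nonneg_nonneg less_imp_le)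
  next
    case (Suc n)
    then show ?thesis using S[of n] by (simp only: sum.lessThan_Suc_shift)
  qed
  moreover have "level_quotient \<phi> \<alpha> 0 + 4 * 4 powr \<alpha> * c \<ge> 0"
    using c level_quotient_pos[of 0] by (simp add: add_nonneg_nonneg less_imp_le)
  ultimately show ?thesis by blast
qed

lemma level_quotient_power:
  assumes "k \<ge> 2" "\<alpha> = 1 / (real k - 1)"
  shows "(2 ^ Suc i) ^ k = level_weight \<phi> i * level_quotient \<phi> \<alpha> i ^ (k - 1)"
proof -
  define s :: real where "s = 2 ^ Suc i"
  define w where "w = level_weight \<phi> i"
  have w: "w > 0" "s > 0" using level_weight_pos by (auto simp: w_def s_def)
  have "((s / w) powr \<alpha>) ^ (k - 1) = (s / w) powr (\<alpha> * real (k - 1))"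
    using w by (simp add: powr_powr[symmetric] powr_realpow)
  also have "\<alpha> * real (k - 1) = 1" using assms by (simp add: of_nat_diff)
  finally have "((s / w) powr \<alpha>) ^ (k - 1) = s / w" using w by simp
  then have "w * (s * (s / w) powr \<alpha>) ^ (k - 1) = s * s ^ (k - 1)"
    using w by (simp add: power_mult_distrib)
  also have "\<dots> = s ^ k" using assms(1) by (cases k) auto
  finally show ?thesis by (simp add: level_quotient_def s_def w_def)
qed

lemma level_set_le: "x \<in> level_set i \<Longrightarrow> x \<le> 2 ^ Suc i"
  by (auto simp: level_set_def split: if_splits)

lemma level_weight_le: "x \<in> level_set i \<Longrightarrow> level_weight \<phi> i \<le> lifted \<phi> x"
proof -
  assume x: "x \<in> level_set i"
  have "0 < x" using x by (auto simp: level_set_def split: if_splits intro: less_trans[of 0 "2 ^ i"])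
  moreover have "2 ^ max 1 i \<le> max x 2" using x by (cases i) (auto simp: level_set_def max_def)
  ultimately show ?thesis by (auto simp: level_weight_def lifted_def intro!: phi_mono)
qed

lemma level_set_cover: "x > 0 \<Longrightarrow> \<exists>i. x \<in> level_set i"
proof -
  assume x: "x > 0"
  obtain n where n: "x \<le> 2 ^ n" using real_arch_pow[of 2 x] by (auto intro: less_imp_le)
  define m where "m = (LEAST n. x \<le> 2 ^ Suc n)"
  have ex: "x \<le> 2 ^ Suc n" using n by (rule order_trans) simp
  have m: "x \<le> 2 ^ Suc m" unfolding m_def using ex by (rule LeastI)
  show ?thesis
  proof (cases m)
    case 0
    then have "x \<in> level_set 0" using m x by (simp add: level_set_def)
    then show ?thesis ..
  next
    case (Suc j)
    then have "\<not> x \<le> 2 ^ Suc j" using not_less_Least[of j "\<lambda>n. x \<le> 2 ^ Suc n"] by (simp add: m_def)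
    then have "x \<in> level_set m" using m Suc by (simp add: level_set_def)
    then show ?thesis ..
  qed
qed

lemma level_set_disjoint: "x \<in> level_set i \<Longrightarrow> x \<in> level_set j \<Longrightarrow> i = j"
proof -
  have *: "x \<notin> level_set j" if "x \<in> level_set i" "i < j" for x :: real and i j
  proof -
    have "(2::real) ^ Suc i \<le> 2 ^ j" using that by (intro power_increasing) auto
    then show ?thesis using level_set_le[OF that(1)] that by (auto simp: level_set_def)
  qed
  show "x \<in> level_set i \<Longrightarrow> x \<in> level_set j \<Longrightarrow> i = j"
    using *[of x i j] *[of x j i] by (cases i j rule: linorder_cases) auto
qed

lemma measurable_level_set [measurable]: "level_set i \<in> sets borel"
  by (simp add: level_set_def)

text \<open>Summation over the dyadic levels of \<open>g\<close>: no convexity of \<open>\<phi>\<close> is needed because \<open>\<phi>\<close> is only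
  compared with its values at powers of two.\<close>

lemma level_estimate:
  assumes k: "k \<ge> 2" "\<alpha> = 1 / (real k - 1)"
    and \<Lambda>: "\<And>N. (\<Sum>i<N. level_quotient \<phi> \<alpha> i) \<le> \<Lambda>"
    and [measurable]: "g \<in> borel_measurable M" "K \<in> borel_measurable M" "Q \<in> sets M"
    and Q: "emeasure M Q < \<infinity>"
    and K: "\<And>E. E \<in> sets M \<Longrightarrow> E \<subseteq> Q \<Longrightarrow> (\<integral>\<^sup>+x\<in>E. K x \<partial>M) \<le> ennreal (6 * root k (measure M E))"
    and c: "c \<ge> 0" "(\<integral>\<^sup>+x\<in>Q. ennreal (lifted \<phi> (g x)) \<partial>M) \<le> ennreal c"
  shows "(\<integral>\<^sup>+x\<in>Q. ennreal (g x) * K x \<partial>M) \<le> ennreal (6 * root k (\<Lambda> ^ (k - 1) * c))"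
proof -
  define E where "E i = {x \<in> Q. g x \<in> level_set i}" for i
  have E[measurable]: "E i \<in> sets M" for i
  proof -
    have "E i = Q \<inter> (g -` level_set i \<inter> space M)"
      using sets.sets_into_space[OF \<open>Q \<in> sets M\<close>] by (auto simp: E_def)
    moreover have "g -` level_set i \<inter> space M \<in> sets M" by measurable
    ultimately show ?thesis by auto
  qed
  have EQ: "E i \<subseteq> Q" for i by (auto simp: E_def)
  have Efin: "emeasure M (E i) = ennreal (measure M (E i))" for i
    using emeasure_mono[OF EQ, of M i] Q by (intro emeasure_eq_ennreal_measure) (auto simp: less_top[symmetric] top_unique)
  define r where "r i = root k (measure M (E i))" for i
  have r: "r i \<ge> 0" "r i ^ k = measure M (E i)" for i using k by (auto simp: r_def)
  have pt: "ennreal (g x) * K x * indicator Q x \<le> (\<Sum>i. ennreal (2 ^ Suc i) * (K x * indicator (E i) x))" for x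
  proof (cases "x \<in> Q \<and> g x > 0")
    case True
    then obtain i where i: "g x \<in> level_set i" using level_set_cover by blast
    have "ennreal (g x) * K x * indicator Q x \<le> ennreal (2 ^ Suc i) * (K x * indicator (E i) x)"
      using True i level_set_le[OF i] by (auto simp: E_def intro!: mult_right_mono ennreal_leI)
    also have "\<dots> = (\<Sum>i\<in>{i}. ennreal (2 ^ Suc i) * (K x * indicator (E i) x))" by simp
    also have "\<dots> \<le> (\<Sum>i. ennreal (2 ^ Suc i) * (K x * indicator (E i) x))"
      by (rule sum_le_suminf) auto
    finally show ?thesis .
  next
    case False
    then have "ennreal (g x) * K x * indicator Q x = 0" by (auto simp: ennreal_neg not_less indicator_def)
    then show ?thesis by (simp only: zero_le)
  qed
  have "(\<integral>\<^sup>+x\<in>Q. ennreal (g x) * K x \<partial>M) \<le> (\<integral>\<^sup>+x. (\<Sum>i. ennreal (2 ^ Suc i) * (K x * indicator (E i) x)) \<partial>M)"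
    by (intro nn_integral_mono pt)
  also have "\<dots> = (\<Sum>i. \<integral>\<^sup>+x. ennreal (2 ^ Suc i) * (K x * indicator (E i) x) \<partial>M)"
    by (rule nn_integral_suminf) measurable
  also have "\<dots> = (\<Sum>i. ennreal (2 ^ Suc i) * (\<integral>\<^sup>+x\<in>E i. K x \<partial>M))"
    by (subst nn_integral_cmult) auto
  also have "\<dots> \<le> (\<Sum>i. ennreal (6 * (2 ^ Suc i * r i)))"
  proof (intro suminf_le)
    fix i
    have "ennreal (2 ^ Suc i) * (\<integral>\<^sup>+x\<in>E i. K x \<partial>M) \<le> ennreal (2 ^ Suc i) * ennreal (6 * r i)"
      unfolding r_def by (intro mult_left_mono K E EQ) auto
    also have "\<dots> = ennreal (6 * (2 ^ Suc i * r i))"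
      using r(1)[of i] by (simp add: ennreal_mult'[symmetric] mult_ac)
    finally show "ennreal (2 ^ Suc i) * (\<integral>\<^sup>+x\<in>E i. K x \<partial>M) \<le> ennreal (6 * (2 ^ Suc i * r i))" .
  qed auto
  also have "\<dots> = (SUP N. \<Sum>i<N. ennreal (6 * (2 ^ Suc i * r i)))" by (rule suminf_eq_SUP)
  also have "\<dots> \<le> ennreal (6 * root k (\<Lambda> ^ (k - 1) * c))"
  proof (rule SUP_least)
    fix N
    have \<Lambda>0: "\<Lambda> \<ge> 0" using \<Lambda>[of 0] by simp
    have "ennreal (\<Sum>i<N. level_weight \<phi> i * r i ^ k) = (\<Sum>i<N. ennreal (level_weight \<phi> i) * emeasure M (E i))"
      unfolding r(2) Efin using level_weight_pos
      by (subst sum_ennreal[symmetric]) (auto simp: ennreal_mult' less_imp_le)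
    also have "\<dots> = (\<integral>\<^sup>+x. (\<Sum>i<N. ennreal (level_weight \<phi> i) * indicator (E i) x) \<partial>M)"
      by (subst nn_integral_sum) (auto simp: nn_integral_cmult_indicator)
    also have "\<dots> \<le> (\<integral>\<^sup>+x\<in>Q. ennreal (lifted \<phi> (g x)) \<partial>M)"
    proof (rule nn_integral_mono)
      fix x
      show "(\<Sum>i<N. ennreal (level_weight \<phi> i) * indicator (E i) x) \<le> ennreal (lifted \<phi> (g x)) * indicator Q x"
      proof (cases "\<exists>i<N. x \<in> E i")
        case True
        then obtain i where i: "i < N" "x \<in> E i" by blast
        have "(\<Sum>j<N. ennreal (level_weight \<phi> j) * indicator (E j) x) =
            (\<Sum>j<N. if j = i then ennreal (level_weight \<phi> j) else 0)"
          using i level_set_disjoint by (intro sum.cong) (auto simp: E_def indicator_def)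
        also have "\<dots> = ennreal (level_weight \<phi> i)" using i by simp
        also have "\<dots> \<le> ennreal (lifted \<phi> (g x)) * indicator Q x"
          using i level_weight_le[of "g x" i] by (auto simp: E_def intro!: ennreal_leI)
        finally show ?thesis .
      next
        case False
        then have "(\<Sum>j<N. ennreal (level_weight \<phi> j) * indicator (E j) x) = 0" by (intro sum.neutral) auto
        then show ?thesis by (simp only: zero_le)
      qed
    qed
    also have "\<dots> \<le> ennreal c" by (rule c)
    finally have wc: "(\<Sum>i<N. level_weight \<phi> i * r i ^ k) \<le> c" using c by (subst (asm) ennreal_le_iff) auto
    \<comment> \<open>Hoelder with s = 2^(i+1), the upper end of the level, and with
      \<open>r i\<close> the \<open>k\<close>-th root of the measure of the level set. The first
      factor is bounded by the growth condition, the second by the energy.\<close>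
    have "(\<Sum>i<N. 2 ^ Suc i * r i) ^ k \<le>
        (\<Sum>i<N. level_quotient \<phi> \<alpha> i) ^ (k - 1) * (\<Sum>i<N. level_weight \<phi> i * r i ^ k)"
      by (rule Holder_power_sum) (use k r level_quotient_pos level_quotient_power[OF k] in auto)
    also have "\<dots> \<le> \<Lambda> ^ (k - 1) * c"
      using \<Lambda> wc \<Lambda>0 r level_quotient_pos level_weight_pos
      by (intro mult_mono power_mono sum_nonneg mult_nonneg_nonneg zero_le_power) (auto simp: less_imp_le)
    finally have "root k ((\<Sum>i<N. 2 ^ Suc i * r i) ^ k) \<le> root k (\<Lambda> ^ (k - 1) * c)"
      using k by (intro real_root_le_mono) auto
    moreover have "(\<Sum>i<N. 2 ^ Suc i * r i) \<ge> 0" using r by (intro sum_nonneg) auto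
    then have "root k ((\<Sum>i<N. 2 ^ Suc i * r i) ^ k) = (\<Sum>i<N. 2 ^ Suc i * r i)"
      using k by (intro real_root_power_cancel) auto
    ultimately have "(\<Sum>i<N. 2 ^ Suc i * r i) \<le> root k (\<Lambda> ^ (k - 1) * c)" by (simp only:)
    then have "(\<Sum>i<N. 6 * (2 ^ Suc i * r i)) \<le> 6 * root k (\<Lambda> ^ (k - 1) * c)"
      unfolding sum_distrib_left[symmetric] by (rule mult_left_mono) simp
    then show "(\<Sum>i<N. ennreal (6 * (2 ^ Suc i * r i))) \<le> ennreal (6 * root k (\<Lambda> ^ (k - 1) * c))"
      using r by (subst sum_ennreal) (auto intro!: ennreal_leI)
  qed
  finally show ?thesis .
qed

end

section \<open>Smooth means over dyadic cubes and their potential estimate\<close>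

context rotated_coordinates
begin

definition mixed_mean ::
  "(real ^ 'n) set \<Rightarrow> (real ^ 'n \<Rightarrow> real) \<Rightarrow> real \<Rightarrow> nat \<Rightarrow> (real ^ 'n \<Rightarrow> int) \<Rightarrow> (real ^ 'n) set \<Rightarrow> real" where
  "mixed_mean U u t m z S = (LINT x|slice t. indicator U x * u x * tensor T J (mixed_bump m z S) x)"

definition cube_mean :: "(real ^ 'n) set \<Rightarrow> (real ^ 'n \<Rightarrow> real) \<Rightarrow> real \<Rightarrow> nat \<Rightarrow> (real ^ 'n \<Rightarrow> int) \<Rightarrow> real" where
  "cube_mean U u t m z = (LINT x|slice t. indicator U x * u x * tensor T J (\<lambda>b. dyadic_bump m (z b)) x)"

lemma mixed_mean_empty: "mixed_mean U u t m z {} = cube_mean U u t m (\<lambda>b. z b div 2)"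
  by (simp add: mixed_mean_def cube_mean_def mixed_bump_def[abs_def])

lemma mixed_mean_J: "mixed_mean U u t m z J = cube_mean U u t (Suc m) z"
proof -
  have "tensor T J (mixed_bump m z J) = tensor T J (\<lambda>b. dyadic_bump (Suc m) (z b))"
    unfolding tensor_def[abs_def] by (intro ext prod.cong) (auto simp: mixed_bump_def)
  then show ?thesis by (simp add: mixed_mean_def cube_mean_def)
qed

text \<open>Within the slice, the support lies in a closed cube that is compact, contained in
  \<open>U\<close> and of finite measure, and on which both factors are bounded.\<close>

lemma integrable_slice_mult_tensor:
  assumes U: "open U" and u: "continuous_on U u"
    and smooth: "\<And>b k. b \<in> J \<Longrightarrow> smooth_upto k (\<gamma> b)"
    and fl: "\<And>b s. b \<in> J \<Longrightarrow> \<gamma> b s \<noteq> 0 \<Longrightarrow> \<lfloor>2 ^ m * s\<rfloor> = z b"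
    and cl: "closed_dcube t m z \<subseteq> U"
  shows "integrable (slice t) (\<lambda>x. indicator U x * u x * tensor T J \<gamma> x)"
proof -
  let ?W = "closed_dcube t m z"
  have Wc: "compact ?W" by (rule compact_closed_dcube)
  have [measurable]: "?W \<in> sets borel" using compact_imp_closed[OF Wc] by simp
  have [measurable]: "(\<lambda>x. indicator U x * u x) \<in> borel_measurable borel"
    using borel_measurable_continuous_on_indicator[OF _ u] U by simp
  have [measurable]: "tensor T J \<gamma> \<in> borel_measurable borel" using smooth by (rule tensor_J_measurable)
  have "compact (u ` ?W)" using Wc cl u by (intro compact_continuous_image) (auto intro: continuous_on_subset)
  then obtain Bu where Bu: "\<forall>y\<in>u ` ?W. norm y \<le> Bu" using compact_imp_bounded bounded_iff by blast
  have "compact (tensor T J \<gamma> ` ?W)"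
    using Wc smooth by (intro compact_continuous_image continuous_on_subset[OF tensor_continuous]) auto
  then obtain BG where BG: "\<forall>y\<in>tensor T J \<gamma> ` ?W. norm y \<le> BG" using compact_imp_bounded bounded_iff by blast
  show ?thesis
  proof (rule Bochner_Integration.integrable_bound)
    show "integrable (slice t) (\<lambda>x. (Bu * BG) * indicator ?W x)"
      using slice_compact_finite[OF Wc] by auto
    have in_W: "\<bar>u x * tensor T J \<gamma> x\<bar> \<le> Bu * BG" if "x \<in> ?W" for x
    proof -
      have "\<bar>u x\<bar> \<le> Bu" "\<bar>tensor T J \<gamma> x\<bar> \<le> BG" using Bu BG that by auto
      then show ?thesis by (simp add: abs_mult mult_mono')
    qed
    show "AE x in slice t. norm (indicator U x * u x * tensor T J \<gamma> x) \<le> norm ((Bu * BG) * indicator ?W x)"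
      using AE_slice_height[of t]
    proof eventually_elim
      case (elim x)
      show ?case
      proof (cases "tensor T J \<gamma> x = 0")
        case False
        then have "x \<in> dcube m z" by (rule tensor_dcube) (rule fl)
        then have W: "x \<in> ?W" using elim dcube_plane_subset_closed[of m z t] by (auto simp: plane_def)
        then have "x \<in> U" using cl by blast
        then show ?thesis using in_W[OF W] W by simp
      qed simp
    qed
  qed measurable
qed

lemma mixed_bump_le:
  assumes B: "\<And>s. bump s \<le> B" "B \<ge> 1"
  shows "\<bar>mixed_bump m z S c s\<bar> \<le> 2 ^ Suc m * B"
proof -
  have "dyadic_bump m' k' s \<le> 2 ^ Suc m * B" if "m' \<le> Suc m" for m' k'
    unfolding dyadic_bump_def using that B by (intro mult_mono power_increasing) (auto simp: bump_nonneg)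
  then show ?thesis using mixed_bump_nonneg[of m z S c s] by (auto simp: mixed_bump_def dyadic_bump_nonneg)
qed

text \<open>The replaced factor is a difference of steps, at most 1, instead of a bump of size about
  2^m. This saving turns the natural factor l^(-k) of a mean into l^(1-k).\<close>

lemma tensor_step_bound:
  assumes B: "\<And>s. bump s \<le> B" "B \<ge> 1" and b: "b \<in> J"
  shows "\<bar>tensor T J ((mixed_bump m z S)(b := step_diff m z b)) x\<bar> \<le>
    (2 ^ Suc m * B) ^ (card J - 1) * indicator (dcube m (\<lambda>c. z c div 2)) x"
proof (cases "tensor T J ((mixed_bump m z S)(b := step_diff m z b)) x = 0")
  case True
  then show ?thesis using B by simp
next
  case False
  then have x: "x \<in> dcube m (\<lambda>c. z c div 2)" by (rule tensor_dcube) (rule mixed_upd_floor(1)[OF b])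
  have "\<bar>tensor T J ((mixed_bump m z S)(b := step_diff m z b)) x\<bar> =
      \<bar>step_diff m z b (T b \<bullet> x)\<bar> * (\<Prod>c\<in>J - {b}. \<bar>mixed_bump m z S c (T c \<bullet> x)\<bar>)"
    unfolding tensor_def prod.remove[OF finite_J b] by (simp add: abs_mult abs_prod)
  also have "\<dots> \<le> 1 * (\<Prod>c\<in>J - {b}. 2 ^ Suc m * B)"
    using mixed_bump_le[OF B] dyadic_step_diff_le_1 unfolding step_diff_def
    by (intro mult_mono prod_mono prod_nonneg) auto
  also have "\<dots> = (2 ^ Suc m * B) ^ (card J - 1)" using b by simp
  finally show ?thesis using x by simp
qed

text \<open>The two products differ only in the factor \<open>b\<close>, and there by
  \<open>bump_diff\<close>, the derivative of the compactly supported \<open>step_diff\<close>;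
  integration by parts on the slice applies.\<close>

lemma mixed_mean_insert:
  assumes U: "open U" and u: "continuous_on U u" and ibp: "ibp_slice U u g t"
    and [measurable]: "g \<in> borel_measurable borel" and g0: "\<And>x. g x \<ge> 0"
    and B: "\<And>s. bump s \<le> B" "B \<ge> 1"
    and S: "S \<subseteq> J" "b \<in> J" "b \<notin> S" and cl: "closed_dcube t m (\<lambda>c. z c div 2) \<subseteq> U"
  shows "ennreal \<bar>mixed_mean U u t m z (insert b S) - mixed_mean U u t m z S\<bar> \<le>
    ennreal ((2 ^ Suc m * B) ^ (card J - 1)) * (\<integral>\<^sup>+x\<in>dcube m (\<lambda>c. z c div 2). ennreal (g x) \<partial>slice t)"
proof -
  have diff: "tensor T J (mixed_bump m z (insert b S)) x - tensor T J (mixed_bump m z S) x =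
      tensor T J ((mixed_bump m z S)(b := bump_diff m z b)) x" for x
  proof -
    have "(\<Prod>c\<in>J - {b}. mixed_bump m z (insert b S) c (T c \<bullet> x)) = (\<Prod>c\<in>J - {b}. mixed_bump m z S c (T c \<bullet> x))"
      by (intro prod.cong) (auto simp: mixed_bump_def)
    moreover have "(\<Prod>c\<in>J - {b}. ((mixed_bump m z S)(b := bump_diff m z b)) c (T c \<bullet> x)) =
        (\<Prod>c\<in>J - {b}. mixed_bump m z S c (T c \<bullet> x))"
      by (intro prod.cong) auto
    ultimately show ?thesis
      unfolding tensor_def prod.remove[OF finite_J S(2)]
      using S(3) by (simp add: mixed_bump_def bump_diff_def left_diff_distrib)
  qed
  have int: "integrable (slice t) (\<lambda>x. indicator U x * u x * tensor T J (mixed_bump m z S') x)" for S'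
    by (rule integrable_slice_mult_tensor[OF U u _ _ cl])
       (rule smooth_upto_mixed_bump, rule mixed_bump_floor)
  have "mixed_mean U u t m z (insert b S) - mixed_mean U u t m z S =
      (LINT x|slice t. indicator U x * u x * tensor T J ((mixed_bump m z S)(b := bump_diff m z b)) x)"
    unfolding mixed_mean_def Bochner_Integration.integral_diff[OF int int, symmetric]
    by (simp only: right_diff_distrib[symmetric] diff)
  then have "ennreal \<bar>mixed_mean U u t m z (insert b S) - mixed_mean U u t m z S\<bar> \<le>
      (\<integral>\<^sup>+x. ennreal (g x * \<bar>tensor T J ((mixed_bump m z S)(b := step_diff m z b)) x\<bar>) \<partial>slice t)"
    using ibp S cl by (simp add: ibp_slice_def)
  also have "\<dots> \<le> (\<integral>\<^sup>+x. ennreal ((2 ^ Suc m * B) ^ (card J - 1)) *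
      (ennreal (g x) * indicator (dcube m (\<lambda>c. z c div 2)) x) \<partial>slice t)"
  proof (rule nn_integral_mono)
    fix x
    have "g x * \<bar>tensor T J ((mixed_bump m z S)(b := step_diff m z b)) x\<bar> \<le>
        g x * ((2 ^ Suc m * B) ^ (card J - 1) * indicator (dcube m (\<lambda>c. z c div 2)) x)"
      using tensor_step_bound[OF B S(2)] g0 by (intro mult_left_mono) auto
    then have "ennreal (g x * \<bar>tensor T J ((mixed_bump m z S)(b := step_diff m z b)) x\<bar>) \<le>
        ennreal (g x * ((2 ^ Suc m * B) ^ (card J - 1) * indicator (dcube m (\<lambda>c. z c div 2)) x))"
      by (rule ennreal_leI)
    also have "\<dots> = ennreal ((2 ^ Suc m * B) ^ (card J - 1)) * (ennreal (g x) * indicator (dcube m (\<lambda>c. z c div 2)) x)"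
    proof (cases "x \<in> dcube m (\<lambda>c. z c div 2)")
      case True
      have "ennreal ((2 ^ Suc m * B) ^ (card J - 1) * g x) = ennreal ((2 ^ Suc m * B) ^ (card J - 1)) * ennreal (g x)"
        using B g0 by (intro ennreal_mult) auto
      then show ?thesis using True by (simp add: mult.commute)
    qed simp
    finally show "ennreal (g x * \<bar>tensor T J ((mixed_bump m z S)(b := step_diff m z b)) x\<bar>) \<le>
      ennreal ((2 ^ Suc m * B) ^ (card J - 1)) * (ennreal (g x) * indicator (dcube m (\<lambda>c. z c div 2)) x)" .
  qed
  also have "\<dots> = ennreal ((2 ^ Suc m * B) ^ (card J - 1)) *
      (\<integral>\<^sup>+x\<in>dcube m (\<lambda>c. z c div 2). ennreal (g x) \<partial>slice t)"
    by (rule nn_integral_cmult) measurable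
  finally show ?thesis .
qed

text \<open>The coordinates are moved from parent to child type one at a time; the
  \<open>card J\<close> moves account for the factor in front.\<close>

lemma cube_mean_child:
  assumes U: "open U" and u: "continuous_on U u" and ibp: "ibp_slice U u g t"
    and g: "g \<in> borel_measurable borel" "\<And>x. g x \<ge> 0"
    and B: "\<And>s. bump s \<le> B" "B \<ge> 1"
    and cl: "closed_dcube t m (\<lambda>c. z c div 2) \<subseteq> U"
  shows "ennreal \<bar>cube_mean U u t (Suc m) z - cube_mean U u t m (\<lambda>c. z c div 2)\<bar> \<le>
    ennreal (real (card J) * (2 ^ Suc m * B) ^ (card J - 1)) *
      (\<integral>\<^sup>+x\<in>dcube m (\<lambda>c. z c div 2). ennreal (g x) \<partial>slice t)"
proof -
  define X where "X = ennreal ((2 ^ Suc m * B) ^ (card J - 1)) *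
      (\<integral>\<^sup>+x\<in>dcube m (\<lambda>c. z c div 2). ennreal (g x) \<partial>slice t)"
  have "ennreal \<bar>mixed_mean U u t m z S - mixed_mean U u t m z {}\<bar> \<le> of_nat (card S) * X"
    if "S \<subseteq> J" for S
    using finite_subset[OF that finite_J] that
  proof (induction S rule: finite_induct)
    case (insert b S)
    have "ennreal \<bar>mixed_mean U u t m z (insert b S) - mixed_mean U u t m z {}\<bar> \<le>
        ennreal (\<bar>mixed_mean U u t m z (insert b S) - mixed_mean U u t m z S\<bar> +
          \<bar>mixed_mean U u t m z S - mixed_mean U u t m z {}\<bar>)"
      by (rule ennreal_leI) linarith
    also have "\<dots> = ennreal \<bar>mixed_mean U u t m z (insert b S) - mixed_mean U u t m z S\<bar> +
          ennreal \<bar>mixed_mean U u t m z S - mixed_mean U u t m z {}\<bar>"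
      by (rule ennreal_plus) auto
    also have "\<dots> \<le> X + of_nat (card S) * X"
      using insert unfolding X_def
      by (intro add_mono mixed_mean_insert[OF U u ibp g B _ _ _ cl]) auto
    also have "\<dots> = of_nat (card (insert b S)) * X" using insert by (simp add: distrib_right)
    finally show ?case .
  qed simp
  from this[of J] have "ennreal \<bar>cube_mean U u t (Suc m) z - cube_mean U u t m (\<lambda>c. z c div 2)\<bar> \<le> of_nat (card J) * X"
    by (simp add: mixed_mean_J mixed_mean_empty)
  also have "\<dots> = ennreal (real (card J) * (2 ^ Suc m * B) ^ (card J - 1)) *
      (\<integral>\<^sup>+x\<in>dcube m (\<lambda>c. z c div 2). ennreal (g x) \<partial>slice t)"
    using B by (simp add: X_def ennreal_mult ennreal_of_nat_eq_real_of_nat mult.assoc)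
  finally show ?thesis .
qed

lemma closed_dcube_dist:
  assumes "x \<in> closed_dcube t m z" "y \<in> closed_dcube t m z"
  shows "dist x y \<le> real (card J) / 2 ^ m"
proof -
  have "\<bar>T b \<bullet> (x - y)\<bar> \<le> 1 / 2 ^ m" if "b \<in> J" for b
  proof -
    have "real_of_int (z b) / 2 ^ m \<le> T b \<bullet> x" "T b \<bullet> x \<le> (real_of_int (z b) + 1) / 2 ^ m"
      "real_of_int (z b) / 2 ^ m \<le> T b \<bullet> y" "T b \<bullet> y \<le> (real_of_int (z b) + 1) / 2 ^ m"
      using assms that by (auto simp: closed_dcube_def)
    then show ?thesis unfolding inner_diff_right add_divide_distrib by linarith
  qed
  moreover have "T e\<^sub>0 \<bullet> (x - y) = 0" using assms by (simp add: closed_dcube_def inner_diff_right)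
  moreover have "norm (x - y) \<le> (\<Sum>b\<in>Basis. \<bar>T b \<bullet> (x - y)\<bar>)" by (rule norm_le_orthogonal_coordinates[OF T])
  ultimately have "norm (x - y) \<le> (\<Sum>b\<in>J. \<bar>T b \<bullet> (x - y)\<bar>)"
    unfolding Basis_eq_insert by (simp add: sum.insert)
  also have "\<dots> \<le> (\<Sum>b\<in>J. 1 / 2 ^ m)"
    using \<open>\<And>b. b \<in> J \<Longrightarrow> \<bar>T b \<bullet> (x - y)\<bar> \<le> 1 / 2 ^ m\<close> by (rule sum_mono)
  finally show ?thesis by (simp add: dist_norm)
qed

lemma addr_in_closed: "x \<in> plane t \<Longrightarrow> x \<in> closed_dcube t m (addr m x)"
  using dcube_plane_subset_closed addr_self by blast

lemma closed_dcube_eventually_near: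
  assumes "x \<in> plane t" "\<epsilon> > 0"
  shows "\<exists>M. \<forall>m\<ge>M. \<forall>y\<in>closed_dcube t m (addr m x). dist x y < \<epsilon>"
proof -
  obtain M where M: "real (card J) / \<epsilon> < 2 ^ M" using real_arch_pow[of 2 "real (card J) / \<epsilon>"] by auto
  have "dist x y < \<epsilon>" if "m \<ge> M" "y \<in> closed_dcube t m (addr m x)" for m y
  proof -
    have "dist x y \<le> real (card J) / 2 ^ m"
      using closed_dcube_dist[OF addr_in_closed[OF assms(1)] that(2)] .
    also have "\<dots> < \<epsilon>"
    proof -
      have "real (card J) / \<epsilon> < 2 ^ m"
        by (rule less_le_trans[OF M power_increasing[OF that(1)]]) simp
      then show ?thesis using assms(2) by (simp add: field_simps)
    qed
    finally show ?thesis .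
  qed
  then show ?thesis by blast
qed

text \<open>The products are nonnegative of mass 1 and their supports shrink to \<open>x\<close>
  inside the slice. Continuity gives the limit at every point of the hyperplane, as estimates for
  images of Hausdorff null sets require.\<close>

lemma cube_mean_tendsto:
  assumes U: "open U" and u: "continuous_on U u" and x: "x \<in> U" "x \<in> plane t"
  shows "(\<lambda>m. cube_mean U u t m (addr m x)) \<longlonglongrightarrow> u x"
proof (rule LIMSEQ_I)
  fix \<epsilon> :: real assume \<epsilon>: "\<epsilon> > 0"
  obtain d1 where d1: "d1 > 0" "\<And>y. y \<in> U \<Longrightarrow> dist y x < d1 \<Longrightarrow> dist (u y) (u x) < \<epsilon> / 2"
    using u x(1) \<epsilon> unfolding continuous_on_iff by (metis half_gt_zero)
  obtain d2 where d2: "d2 > 0" "ball x d2 \<subseteq> U" using U x(1) open_contains_ball by blast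
  obtain M where M: "\<forall>m\<ge>M. \<forall>y\<in>closed_dcube t m (addr m x). dist x y < min d1 d2"
    using closed_dcube_eventually_near[OF x(2), of "min d1 d2"] d1 d2 by auto
  have "norm (cube_mean U u t m (addr m x) - u x) < \<epsilon>" if m: "m \<ge> M" for m
  proof -
    let ?G = "tensor T J (\<lambda>b. dyadic_bump m (addr m x b))"
    have cl: "closed_dcube t m (addr m x) \<subseteq> U"
    proof
      fix y assume "y \<in> closed_dcube t m (addr m x)"
      then have "dist x y < d2" using M m by auto
      then show "y \<in> U" using d2(2) by auto
    qed
    have i1: "integrable (slice t) (\<lambda>y. indicator U y * u y * ?G y)"
      by (rule integrable_slice_mult_tensor[OF U u _ _ cl])
         (rule smooth_upto_dyadic_bump, rule dyadic_bump_floor)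
    have i2: "integrable (slice t) ?G"
      by (rule integrable_slice_tensor) (rule integrable_dyadic_bump)
    have one: "(LINT y|slice t. ?G y) = 1"
      by (subst integral_slice_tensor) (auto simp: integrable_dyadic_bump integral_dyadic_bump)
    have G0: "?G y \<ge> 0" for y unfolding tensor_def by (intro prod_nonneg) (simp add: dyadic_bump_nonneg)
    have diff: "cube_mean U u t m (addr m x) - u x = (LINT y|slice t. indicator U y * u y * ?G y - u x * ?G y)"
      using i1 i2 by (subst Bochner_Integration.integral_diff) (auto simp: cube_mean_def one)
    have "norm (cube_mean U u t m (addr m x) - u x) \<le> (LINT y|slice t. norm (indicator U y * u y * ?G y - u x * ?G y))"
      unfolding diff by (rule integral_norm_bound)
    also have "\<dots> \<le> (LINT y|slice t. (\<epsilon> / 2) * ?G y)"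
    proof (rule integral_mono_AE)
      show "integrable (slice t) (\<lambda>y. norm (indicator U y * u y * ?G y - u x * ?G y))" using i1 i2 by auto
      show "integrable (slice t) (\<lambda>y. (\<epsilon> / 2) * ?G y)" using i2 by auto
      show "AE y in slice t. norm (indicator U y * u y * ?G y - u x * ?G y) \<le> (\<epsilon> / 2) * ?G y"
        using AE_slice_height[of t]
      proof eventually_elim
        case (elim y)
        show ?case
        proof (cases "?G y = 0")
          case False
          then have "y \<in> dcube m (addr m x)" by (rule tensor_dcube) (rule dyadic_bump_floor)
          then have W: "y \<in> closed_dcube t m (addr m x)"
            using elim dcube_plane_subset_closed[of m "addr m x" t] by (auto simp: plane_def)
          then have "y \<in> U" using cl by blast
          moreover have "dist y x < d1"
          proof -
            have "dist x y < min d1 d2" using M m W by blast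
            then show ?thesis by (simp add: dist_commute[of y x])
          qed
          ultimately have "\<bar>u y - u x\<bar> \<le> \<epsilon> / 2" using d1(2)[of y] by (simp add: dist_real_def)
          then have "\<bar>u y - u x\<bar> * ?G y \<le> (\<epsilon> / 2) * ?G y" using G0 by (intro mult_right_mono)
          moreover have "norm (indicator U y * u y * ?G y - u x * ?G y) = \<bar>u y - u x\<bar> * ?G y"
          proof -
            have "indicator U y * u y * ?G y - u x * ?G y = (u y - u x) * ?G y"
              using \<open>y \<in> U\<close> by (simp add: left_diff_distrib)
            then show ?thesis using G0[of y] by (simp only: real_norm_def abs_mult abs_of_nonneg)
          qed
          ultimately show ?thesis by simp
        qed simp
      qed
    qed
    also have "\<dots> = \<epsilon> / 2" by (simp add: one)
    finally show ?thesis using \<epsilon> by simp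
  qed
  then show "\<exists>M. \<forall>m\<ge>M. norm (cube_mean U u t m (addr m x) - u x) < \<epsilon>" by blast
qed

lemma closed_dcube_addr_subset:
  "closed_dcube t (m + j) (addr (m + j) x) \<subseteq> closed_dcube t m (addr m x)"
proof (induction j)
  case (Suc j)
  have "closed_dcube t (Suc i) (addr (Suc i) x) \<subseteq> closed_dcube t i (addr i x)" for i
  proof
    fix y assume y: "y \<in> closed_dcube t (Suc i) (addr (Suc i) x)"
    have "real_of_int (addr i x b) / 2 ^ i \<le> T b \<bullet> y \<and> T b \<bullet> y \<le> (real_of_int (addr i x b) + 1) / 2 ^ i" if "b \<in> J" for b
    proof -
      have "addr i x b = addr (Suc i) x b div 2" by (simp add: addr_Suc)
      then have "2 * real_of_int (addr i x b) \<le> real_of_int (addr (Suc i) x b)"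
        "real_of_int (addr (Suc i) x b) \<le> 2 * real_of_int (addr i x b) + 1" by linarith+
      moreover have "real_of_int (addr (Suc i) x b) \<le> 2 * 2 ^ i * (T b \<bullet> y)"
        "2 * 2 ^ i * (T b \<bullet> y) \<le> real_of_int (addr (Suc i) x b) + 1"
        using y that by (auto simp: closed_dcube_def field_simps)
      ultimately show ?thesis by (simp add: field_simps)
    qed
    then show "y \<in> closed_dcube t i (addr i x)" using y by (auto simp: closed_dcube_def)
  qed
  from this[of "m + j"] Suc show ?case by auto
qed simp

text \<open>Discrete analogue of the Riesz potential kernel \<open>\<bar>x - y\<bar> powr (1 - k)\<close>.\<close>

definition dyadic_kernel :: "nat \<Rightarrow> real ^ 'n \<Rightarrow> real ^ 'n \<Rightarrow> ennreal" where
  "dyadic_kernel m x y =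
    (\<Sum>j. ennreal ((2 ^ (m + j)) ^ (card J - 1)) * indicator (dcube (m + j) (addr (m + j) x)) y)"

lemma measurable_dyadic_kernel [measurable]: "dyadic_kernel m x \<in> borel_measurable borel"
  unfolding dyadic_kernel_def[abs_def] by measurable

text \<open>The means telescope along the cubes shrinking to \<open>x\<close>. Each difference
  carries the factor \<open>2 ^ (m + i)\<close> to the power \<open>card J - 1\<close>, and summing
  under the integral sign produces the kernel.\<close>

lemma potential_estimate:
  assumes U: "open U" and u: "continuous_on U u" and ibp: "ibp_slice U u g t"
    and g: "g \<in> borel_measurable borel" "\<And>x. g x \<ge> 0"
    and B: "\<And>s. bump s \<le> B" "B \<ge> 1"
    and cl: "closed_dcube t m (addr m x) \<subseteq> U" and x: "x \<in> plane t"
  shows "ennreal \<bar>u x - cube_mean U u t m (addr m x)\<bar> \<le>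
    ennreal (real (card J) * (2 * B) ^ (card J - 1)) *
      (\<integral>\<^sup>+y\<in>dcube m (addr m x). ennreal (g y) * dyadic_kernel m x y \<partial>slice t)"
proof -
  note [measurable] = g(1)
  define C where "C = real (card J) * (2 * B) ^ (card J - 1)"
  have C0: "C \<ge> 0" using B by (simp add: C_def)
  let ?M = "\<lambda>i. cube_mean U u t (m + i) (addr (m + i) x)"
  let ?Q = "\<lambda>i. dcube (m + i) (addr (m + i) x)"
  let ?a = "\<lambda>i. ennreal ((2 ^ (m + i)) ^ (card J - 1)) * (\<integral>\<^sup>+y\<in>?Q i. ennreal (g y) \<partial>slice t)"
  have xU: "x \<in> U" using addr_in_closed[OF x] cl by blast
  have step: "ennreal \<bar>?M (Suc i) - ?M i\<bar> \<le> ennreal C * ?a i" for i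
  proof -
    have ad: "(\<lambda>c. addr (Suc (m + i)) x c div 2) = addr (m + i) x" using addr_Suc by auto
    have "closed_dcube t (m + i) (addr (m + i) x) \<subseteq> U" using closed_dcube_addr_subset cl by blast
    from cube_mean_child[OF U u ibp g B, of "m + i" "addr (Suc (m + i)) x", unfolded ad, OF this]
    have "ennreal \<bar>?M (Suc i) - ?M i\<bar> \<le> ennreal (real (card J) * (2 ^ Suc (m + i) * B) ^ (card J - 1)) *
        (\<integral>\<^sup>+y\<in>?Q i. ennreal (g y) \<partial>slice t)" by simp
    also have "real (card J) * (2 ^ Suc (m + i) * B) ^ (card J - 1) = C * (2 ^ (m + i)) ^ (card J - 1)"
      by (simp add: C_def power_mult_distrib mult_ac)
    also have "ennreal \<dots> = ennreal C * ennreal ((2 ^ (m + i)) ^ (card J - 1))"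
      using C0 by (intro ennreal_mult) auto
    finally show ?thesis by (simp add: mult.assoc)
  qed
  have tele: "ennreal \<bar>?M i - ?M 0\<bar> \<le> ennreal C * (\<Sum>j<i. ?a j)" for i
  proof (induction i)
    case (Suc i)
    have "ennreal \<bar>?M (Suc i) - ?M 0\<bar> \<le> ennreal (\<bar>?M (Suc i) - ?M i\<bar> + \<bar>?M i - ?M 0\<bar>)"
      by (rule ennreal_leI) linarith
    also have "\<dots> = ennreal \<bar>?M (Suc i) - ?M i\<bar> + ennreal \<bar>?M i - ?M 0\<bar>" by (rule ennreal_plus) auto
    also have "\<dots> \<le> ennreal C * ?a i + ennreal C * (\<Sum>j<i. ?a j)" by (intro add_mono step Suc)
    also have "\<dots> = ennreal C * (\<Sum>j<Suc i. ?a j)" by (simp add: distrib_left add.commute)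
    finally show ?case .
  qed simp
  have "(\<lambda>i. ?M i) \<longlonglongrightarrow> u x"
    using LIMSEQ_ignore_initial_segment[OF cube_mean_tendsto[OF U u xU x], of m] by (simp add: add.commute)
  then have "(\<lambda>i. \<bar>?M i - ?M 0\<bar>) \<longlonglongrightarrow> \<bar>u x - ?M 0\<bar>" by (intro tendsto_intros)
  then have "(\<lambda>i. ennreal \<bar>?M i - ?M 0\<bar>) \<longlonglongrightarrow> ennreal \<bar>u x - ?M 0\<bar>" by (rule tendsto_ennrealI)
  then have "ennreal \<bar>u x - ?M 0\<bar> \<le> ennreal C * (\<Sum>j. ?a j)"
  proof (rule LIMSEQ_le_const2, intro exI allI impI)
    fix i
    have "(\<Sum>j<i. ?a j) \<le> (\<Sum>j. ?a j)" by (intro sum_le_suminf) auto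
    then show "ennreal \<bar>?M i - ?M 0\<bar> \<le> ennreal C * (\<Sum>j. ?a j)"
      using tele[of i] by (meson mult_left_mono order_trans zero_le)
  qed
  also have "(\<Sum>j. ?a j) = (\<Sum>j. \<integral>\<^sup>+y. ennreal ((2 ^ (m + j)) ^ (card J - 1)) * (ennreal (g y) * indicator (?Q j) y) \<partial>slice t)"
    by (subst nn_integral_cmult) auto
  also have "\<dots> = (\<integral>\<^sup>+y. (\<Sum>j. ennreal ((2 ^ (m + j)) ^ (card J - 1)) * (ennreal (g y) * indicator (?Q j) y)) \<partial>slice t)"
    by (rule nn_integral_suminf[symmetric]) measurable
  also have "\<dots> = (\<integral>\<^sup>+y\<in>dcube m (addr m x). ennreal (g y) * dyadic_kernel m x y \<partial>slice t)"
  proof (rule nn_integral_cong)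
    fix y
    have "(\<Sum>j. ennreal ((2 ^ (m + j)) ^ (card J - 1)) * (ennreal (g y) * indicator (?Q j) y)) =
        (\<Sum>j. ennreal (g y) * (ennreal ((2 ^ (m + j)) ^ (card J - 1)) * indicator (?Q j) y))"
      by (simp add: mult_ac)
    also have "\<dots> = ennreal (g y) * dyadic_kernel m x y" unfolding dyadic_kernel_def by (rule ennreal_suminf_cmult)
    also have "\<dots> = ennreal (g y) * dyadic_kernel m x y * indicator (dcube m (addr m x)) y"
    proof (cases "y \<in> dcube m (addr m x)")
      case False
      then have "y \<notin> ?Q j" for j using dcube_addr_subset by blast
      then have "dyadic_kernel m x y = 0" by (simp add: dyadic_kernel_def)
      then show ?thesis by simp
    qed simp
    finally show "(\<Sum>j. ennreal ((2 ^ (m + j)) ^ (card J - 1)) * (ennreal (g y) * indicator (?Q j) y)) =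
      ennreal (g y) * dyadic_kernel m x y * indicator (dcube m (addr m x)) y" .
  qed
  finally show ?thesis by (simp add: C_def)
qed

text \<open>Let r be the \<open>k\<close>-th root of the measure of \<open>E\<close>. Cubes of side
  at least r are estimated by the measure of \<open>E\<close>, smaller ones by their own measure.
  With s = 2^i r the summands are r s^(k-1), at most r s because \<open>k \<ge> 2\<close>, and r / s
  respectively: two geometric series meeting at s = 1.\<close>

lemma kernel_estimate:
  assumes k: "card J \<ge> 2" and [measurable]: "E \<in> sets borel" and E: "E \<subseteq> dcube m (addr m x)"
  shows "(\<integral>\<^sup>+y\<in>E. dyadic_kernel m x y \<partial>slice t) \<le> ennreal (6 * root (card J) (measure (slice t) E))"
proof -
  let ?k = "card J"
  define \<mu> where "\<mu> = measure (slice t) E"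
  define r where "r = root ?k \<mu>"
  have "emeasure (slice t) E \<le> emeasure (slice t) (dcube m (addr m x))" using E by (intro emeasure_mono) auto
  then have \<mu>: "emeasure (slice t) E = ennreal \<mu>"
    unfolding \<mu>_def emeasure_dcube by (intro emeasure_eq_ennreal_measure) (auto simp: top_unique)
  have r: "r \<ge> 0" "r ^ ?k = \<mu>" using k by (auto simp: r_def \<mu>_def)
  have summand: "ennreal ((2 ^ i) ^ (?k - 1)) * emeasure (slice t) (E \<inter> dcube i (addr i x)) \<le>
      ennreal (if r = 0 then 0 else r * min (2 ^ i * r) (1 / (2 ^ i * r)))" for i
  proof -
    have e1: "emeasure (slice t) (E \<inter> dcube i (addr i x)) \<le> ennreal \<mu>"
      unfolding \<mu>[symmetric] by (intro emeasure_mono) auto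
    have e2: "emeasure (slice t) (E \<inter> dcube i (addr i x)) \<le> ennreal ((1 / 2 ^ i) ^ ?k)"
      unfolding emeasure_dcube[of t i "addr i x", symmetric] by (intro emeasure_mono) auto
    show ?thesis
    proof (cases "r = 0")
      case True
      have "\<mu> = 0 ^ card J" using r(2) True by simp
      also have "\<dots> = 0" using k by (auto simp: power_0_left)
      finally have "\<mu> = 0" .
      then show ?thesis using e1 True by simp
    next
      case False
      define s where "s = 2 ^ i * r"
      have s: "s > 0" using False r by (simp add: s_def)
      have rs: "r = s / 2 ^ i" by (simp add: s_def)
      have kS: "p ^ ?k = p * p ^ (?k - 1)" for p :: real using k by (cases "card J") auto
      show ?thesis
      proof (cases "s \<le> 1")
        case True
        have "ennreal ((2 ^ i) ^ (?k - 1)) * emeasure (slice t) (E \<inter> dcube i (addr i x)) \<le>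
            ennreal ((2 ^ i) ^ (?k - 1)) * ennreal \<mu>" by (intro mult_left_mono e1) auto
        also have "\<dots> = ennreal ((2 ^ i) ^ (?k - 1) * \<mu>)" by (simp add: ennreal_mult')
        also have "(2 ^ i) ^ (?k - 1) * \<mu> = r * s ^ (?k - 1)"
          unfolding r(2)[symmetric] kS by (simp add: s_def power_mult_distrib)
        also have "ennreal \<dots> \<le> ennreal (r * min s (1 / s))"
        proof (intro ennreal_leI mult_left_mono r)
          have "s ^ (?k - 1) \<le> s ^ 1" using s True k by (intro power_decreasing) auto
          moreover have "s \<le> 1 / s" using s True by (simp add: field_simps mult_le_one)
          ultimately show "s ^ (?k - 1) \<le> min s (1 / s)" by simp
        qed
        finally show ?thesis using False by (simp add: s_def)
      next
        case s1: False
        have "ennreal ((2 ^ i) ^ (?k - 1)) * emeasure (slice t) (E \<inter> dcube i (addr i x)) \<le>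
            ennreal ((2 ^ i) ^ (?k - 1)) * ennreal ((1 / 2 ^ i) ^ ?k)" by (intro mult_left_mono e2) auto
        also have "\<dots> = ennreal ((2 ^ i) ^ (?k - 1) * (1 / 2 ^ i) ^ ?k)" by (simp add: ennreal_mult')
        also have "(2 ^ i) ^ (?k - 1) * (1 / 2 ^ i) ^ ?k = (1 / 2 ^ i :: real)"
          unfolding kS by (simp add: power_divide)
        also have "\<dots> = r * min s (1 / s)"
        proof -
          have "1 / s \<le> 1" using s1 by simp
          then have "1 / s \<le> s" using s1 by linarith
          then have "min s (1 / s) = 1 / s" by (rule min_absorb2)
          moreover have "r * (1 / s) = 1 / 2 ^ i" unfolding s_def using False by simp
          ultimately show ?thesis by (simp only:)
        qed
        finally show ?thesis using False by (simp add: s_def)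
      qed
    qed
  qed
  have "(\<integral>\<^sup>+y\<in>E. dyadic_kernel m x y \<partial>slice t) =
      (\<integral>\<^sup>+y. (\<Sum>j. ennreal ((2 ^ (m + j)) ^ (?k - 1)) * indicator (E \<inter> dcube (m + j) (addr (m + j) x)) y) \<partial>slice t)"
    unfolding dyadic_kernel_def
    by (intro nn_integral_cong, subst ennreal_suminf_multc[symmetric])
       (auto simp: indicator_inter_arith mult_ac)
  also have "\<dots> = (\<Sum>j. \<integral>\<^sup>+y. ennreal ((2 ^ (m + j)) ^ (?k - 1)) * indicator (E \<inter> dcube (m + j) (addr (m + j) x)) y \<partial>slice t)"
    by (rule nn_integral_suminf) measurable
  also have "\<dots> = (\<Sum>j. ennreal ((2 ^ (m + j)) ^ (?k - 1)) * emeasure (slice t) (E \<inter> dcube (m + j) (addr (m + j) x)))"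
    by (subst nn_integral_cmult_indicator) auto
  also have "\<dots> \<le> (\<Sum>j. ennreal (if r = 0 then 0 else r * min (2 ^ (m + j) * r) (1 / (2 ^ (m + j) * r))))"
    by (intro suminf_le summand) auto
  also have "\<dots> = (SUP N. \<Sum>j<N. ennreal (if r = 0 then 0 else r * min (2 ^ (m + j) * r) (1 / (2 ^ (m + j) * r))))"
    by (rule suminf_eq_SUP)
  also have "\<dots> \<le> ennreal (6 * r)"
  proof (rule SUP_least)
    fix N
    show "(\<Sum>j<N. ennreal (if r = 0 then 0 else r * min (2 ^ (m + j) * r) (1 / (2 ^ (m + j) * r)))) \<le> ennreal (6 * r)"
    proof (cases "r = 0")
      case False
      then have r0: "r > 0" using r by simp
      have "(\<Sum>j<N. ennreal (if r = 0 then 0 else r * min (2 ^ (m + j) * r) (1 / (2 ^ (m + j) * r)))) =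
          (\<Sum>j<N. ennreal (r * min ((2 ^ m * r) * 2 ^ j) (1 / ((2 ^ m * r) * 2 ^ j))))"
        using False by (simp add: power_add mult_ac)
      also have "\<dots> = ennreal (\<Sum>j<N. r * min ((2 ^ m * r) * 2 ^ j) (1 / ((2 ^ m * r) * 2 ^ j)))"
        using r0 by (intro sum_ennreal) auto
      also have "\<dots> \<le> ennreal (6 * r)"
        unfolding sum_distrib_left[symmetric]
        using sum_min_geometric_le[of "2 ^ m * r" N] r0
        by (intro ennreal_leI) (simp add: mult.commute mult_right_mono)
      finally show ?thesis .
    qed simp
  qed
  finally show ?thesis by (simp add: r_def \<mu>_def)
qed

end

section \<open>Calderon's oscillation estimate; here the exponent 1/(n - 2) equals 1/(k - 1) and n
  \<ge> 3 means k \<ge> 2\<close>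

locale slice_growth = rotated_coordinates T e\<^sub>0 + calderon_growth \<phi> "1 / (real CARD('n) - 2)"
  for T :: "real ^ 'n \<Rightarrow> real ^ 'n" and e\<^sub>0 :: "real ^ 'n" and \<phi> :: "real \<Rightarrow> real" +
  assumes dim: "CARD('n) \<ge> 3"
begin

text \<open>Both points are compared with the mean over their common cube. The constant precedes all
  other quantifiers: it depends on the dimension, on \<phi> and on the fixed bump, and so is the
  same for all cubes of a covering.\<close>

lemma oscillation_estimate:
  "\<exists>C\<ge>0. \<forall>U u g t m z c x y. open U \<longrightarrow> continuous_on U u \<longrightarrow> ibp_slice U u g t \<longrightarrow>
    g \<in> borel_measurable borel \<longrightarrow> (\<forall>x. g x \<ge> 0) \<longrightarrow> closed_dcube t m z \<subseteq> U \<longrightarrow> c \<ge> 0 \<longrightarrow>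
    (\<integral>\<^sup>+y\<in>dcube m z. ennreal (lifted \<phi> (g y)) \<partial>slice t) \<le> ennreal c \<longrightarrow>
    x \<in> dcube m z \<inter> plane t \<longrightarrow> y \<in> dcube m z \<inter> plane t \<longrightarrow> \<bar>u x - u y\<bar> \<le> C * root (CARD('n) - 1) c"
proof -
  obtain B where B: "\<And>s. bump s \<le> B" "B \<ge> 1" using bump_bounded by blast
  obtain \<Lambda> where \<Lambda>: "\<Lambda> \<ge> 0" "\<And>N. (\<Sum>i<N. level_quotient \<phi> (1 / (real CARD('n) - 2)) i) \<le> \<Lambda>"
    using level_quotient_bounded by blast
  let ?k = "card J"
  have k: "?k \<ge> 2" "1 / (real CARD('n) - 2) = 1 / (real ?k - 1)" using dim by (auto simp: card_J of_nat_diff)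
  \<comment> \<open>The factors come from the potential estimate, from the kernel (the 6) and from
    the sum of the level quotients.\<close>
  define A where "A = real ?k * (2 * B) ^ (?k - 1) * 6 * root ?k (\<Lambda> ^ (?k - 1))"
  have A0: "A \<ge> 0"
    unfolding A_def using B \<Lambda> by (intro mult_nonneg_nonneg real_root_ge_zero zero_le_power) auto
  have mean: "\<bar>u x - cube_mean U u t m z\<bar> \<le> A * root ?k c"
    if U: "open U" and u: "continuous_on U u" and ibp: "ibp_slice U u g t"
      and g: "g \<in> borel_measurable borel" "\<forall>x. g x \<ge> 0" and cl: "closed_dcube t m z \<subseteq> U"
      and c: "c \<ge> 0" "(\<integral>\<^sup>+y\<in>dcube m z. ennreal (lifted \<phi> (g y)) \<partial>slice t) \<le> ennreal c"
      and x: "x \<in> dcube m z \<inter> plane t" for U u g t m z c x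
  proof -
    \<comment> \<open>The given address may differ from that of \<open>x\<close> off
      \<open>J\<close>; cubes and means do not see those values.\<close>
    have ad: "b \<in> J \<Longrightarrow> addr m x b = z b" for b using x by (auto simp: addr_def dcube_def)
    have d: "dcube m (addr m x) = dcube m z" "closed_dcube t m (addr m x) = closed_dcube t m z"
      using ad by (auto simp: dcube_def closed_dcube_def)
    have "tensor T J (\<lambda>b. dyadic_bump m (addr m x b)) = tensor T J (\<lambda>b. dyadic_bump m (z b))"
      unfolding tensor_def[abs_def] using ad by (intro ext prod.cong) auto
    then have cm: "cube_mean U u t m (addr m x) = cube_mean U u t m z" by (simp add: cube_mean_def)
    note [measurable] = g(1)
    have lev: "(\<integral>\<^sup>+y\<in>dcube m (addr m x). ennreal (g y) * dyadic_kernel m x y \<partial>slice t) \<le>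
        ennreal (6 * root ?k (\<Lambda> ^ (?k - 1) * c))"
    proof (rule level_estimate[OF k \<Lambda>(2)])
      show "emeasure (slice t) (dcube m (addr m x)) < \<infinity>" by (simp add: emeasure_dcube)
      show "(\<integral>\<^sup>+y\<in>E. dyadic_kernel m x y \<partial>slice t) \<le> ennreal (6 * root ?k (measure (slice t) E))"
        if "E \<in> sets (slice t)" "E \<subseteq> dcube m (addr m x)" for E
        using that by (intro kernel_estimate k) auto
      show "(\<integral>\<^sup>+y\<in>dcube m (addr m x). ennreal (lifted \<phi> (g y)) \<partial>slice t) \<le> ennreal c" using c by (simp add: d)
    qed (use c in measurable)
    have "ennreal \<bar>u x - cube_mean U u t m z\<bar> \<le> ennreal (real ?k * (2 * B) ^ (?k - 1)) *
        (\<integral>\<^sup>+y\<in>dcube m (addr m x). ennreal (g y) * dyadic_kernel m x y \<partial>slice t)"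
      unfolding cm[symmetric] using g cl x
      by (intro potential_estimate[OF U u ibp _ _ B]) (auto simp: d)
    also have "\<dots> \<le> ennreal (real ?k * (2 * B) ^ (?k - 1)) * ennreal (6 * root ?k (\<Lambda> ^ (?k - 1) * c))"
      by (intro mult_left_mono lev) auto
    also have "\<dots> = ennreal (A * root ?k c)"
      using B \<Lambda> c k by (subst ennreal_mult[symmetric]) (auto simp: A_def real_root_mult)
    finally show ?thesis
      using A0 c by (subst (asm) ennreal_le_iff) (auto intro!: mult_nonneg_nonneg real_root_ge_zero)
  qed
  show ?thesis
  proof (intro exI[of _ "2 * A"] conjI allI impI)
    fix U u g t m z c x y
    assume a: "open U" "continuous_on U u" "ibp_slice U u g t" "g \<in> borel_measurable borel" "\<forall>x. 0 \<le> g x"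
      "closed_dcube t m z \<subseteq> U" "0 \<le> c" "(\<integral>\<^sup>+y\<in>dcube m z. ennreal (lifted \<phi> (g y)) \<partial>slice t) \<le> ennreal c"
    assume "x \<in> dcube m z \<inter> plane t" "y \<in> dcube m z \<inter> plane t"
    then have "\<bar>u x - cube_mean U u t m z\<bar> \<le> A * root ?k c" "\<bar>u y - cube_mean U u t m z\<bar> \<le> A * root ?k c"
      using mean[OF a] by blast+
    then show "\<bar>u x - u y\<bar> \<le> 2 * A * root (CARD('n) - 1) c" unfolding card_J by linarith
  qed (use A0 in simp)
qed

end

section \<open>Covering by dyadic cubes\<close>

text \<open>The measure may be infinite on \<open>U\<close>. Outer regularity of finite measures is
  applied to its restriction to each set of a relatively compact open exhaustion, with errors that
  form a geometric series of sum \<open>e\<close>.\<close>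

lemma outer_regular_locally_finite:
  fixes M :: "'a::euclidean_space measure"
  assumes sets: "sets M = sets borel" and U: "open U"
    and fin: "\<And>K. compact K \<Longrightarrow> K \<subseteq> U \<Longrightarrow> emeasure M K < \<infinity>"
    and A: "A \<in> sets borel" "A \<subseteq> U" and e: "e > 0"
  obtains V where "open V" "A \<subseteq> V" "V \<subseteq> U" "emeasure M (V - A) \<le> ennreal e"
proof -
  note [measurable_cong] = sets
  obtain C :: "nat \<Rightarrow> 'a set" where C: "\<And>n. compact (C n)" "\<And>n. C n \<subseteq> U" "\<And>n. C n \<subseteq> interior (C (Suc n))" "\<Union>(range C) = U"
    using open_Union_compact_subsets[OF U] by metis
  define W where "W n = interior (C n)" for n
  have W: "open (W n)" "W n \<subseteq> U" "emeasure M (W n) < \<infinity>" for n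
  proof -
    show "open (W n)" by (simp add: W_def)
    show "W n \<subseteq> U" using C(2)[of n] interior_subset[of "C n"] by (auto simp: W_def)
    have "emeasure M (W n) \<le> emeasure M (C n)"
      using interior_subset[of "C n"] compact_imp_closed[OF C(1)] by (intro emeasure_mono) (auto simp: W_def sets)
    also have "\<dots> < \<infinity>" by (rule fin[OF C(1,2)])
    finally show "emeasure M (W n) < \<infinity>" .
  qed
  have [measurable]: "W n \<in> sets borel" "A \<in> sets borel" for n using W(1) A by auto
  have UW: "U \<subseteq> (\<Union>n. W n)" using C(3,4) by (fastforce simp: W_def)
  have "\<exists>V. open V \<and> A \<inter> W n \<subseteq> V \<and> V \<subseteq> W n \<and> emeasure M (V - (A \<inter> W n)) \<le> ennreal (e * (1 / 2) ^ Suc n)" for n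
  proof -
    define N where "N = density M (indicator (W n))"
    have N: "emeasure N S = emeasure M (S \<inter> W n)" if "S \<in> sets borel" for S
    proof -
      have "emeasure N S = (\<integral>\<^sup>+x. indicator (W n) x * indicator S x \<partial>M)"
        unfolding N_def using that by (intro emeasure_density) (auto simp: sets)
      also have "\<dots> = (\<integral>\<^sup>+x. indicator (S \<inter> W n) x \<partial>M)"
        by (intro nn_integral_cong) (auto simp: indicator_def)
      also have "\<dots> = emeasure M (S \<inter> W n)" using that by (intro nn_integral_indicator) (auto simp: sets)
      finally show ?thesis .
    qed
    have sN: "sets N = sets borel" by (simp add: N_def sets)
    have spN: "space N = UNIV" using sets_eq_imp_space_eq[OF sN] by simp
    have "emeasure N (space N) \<noteq> \<infinity>" using W(3)[of n] by (simp add: N spN)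
    from outer_regular[OF sN this, of "A \<inter> W n"]
    have "emeasure N (A \<inter> W n) = (INF V\<in>{V. A \<inter> W n \<subseteq> V \<and> open V}. emeasure N V)" by simp
    moreover have "emeasure N (A \<inter> W n) < emeasure N (A \<inter> W n) + ennreal (e * (1 / 2) ^ Suc n)"
    proof -
      have "emeasure N (A \<inter> W n) \<le> emeasure M (W n)" by (subst N) (auto intro!: emeasure_mono simp: sets)
      then have "emeasure N (A \<inter> W n) < \<infinity>" using W(3)[of n] by (rule le_less_trans)
      then show ?thesis
        using e ennreal_add_left_cancel_less[of "emeasure N (A \<inter> W n)" 0 "ennreal (e * (1 / 2) ^ Suc n)"]
        by auto
    qed
    ultimately have "(INF V\<in>{V. A \<inter> W n \<subseteq> V \<and> open V}. emeasure N V) < emeasure N (A \<inter> W n) + ennreal (e * (1 / 2) ^ Suc n)"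
      by simp
    then obtain V where V: "A \<inter> W n \<subseteq> V" "open V" "emeasure N V < emeasure N (A \<inter> W n) + ennreal (e * (1 / 2) ^ Suc n)"
      by (auto simp: INF_less_iff)
    have "emeasure M (V \<inter> W n - A \<inter> W n) = emeasure M (V \<inter> W n) - emeasure M (A \<inter> W n)"
      using V W(3)[of n] emeasure_mono[of "A \<inter> W n" "W n" M]
      by (intro emeasure_Diff) (auto simp: sets less_top[symmetric] top_unique)
    also have "\<dots> \<le> ennreal (e * (1 / 2) ^ Suc n)"
      using V(2,3) by (subst ennreal_minus_le_iff) (auto simp: N inf.assoc less_imp_le)
    finally show ?thesis using V W(1)[of n] by (intro exI[of _ "V \<inter> W n"]) auto
  qed
  then obtain V where V: "\<And>n. open (V n)" "\<And>n. A \<inter> W n \<subseteq> V n" "\<And>n. V n \<subseteq> W n"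
      "\<And>n. emeasure M (V n - (A \<inter> W n)) \<le> ennreal (e * (1 / 2) ^ Suc n)"
    by metis
  show ?thesis
  proof (rule that)
    show "open (\<Union>n. V n)" using V(1) by auto
    show "A \<subseteq> (\<Union>n. V n)"
    proof
      fix x assume x: "x \<in> A"
      then obtain n where "x \<in> W n" using UW A(2) by auto
      with x show "x \<in> (\<Union>n. V n)" using V(2)[of n] by auto
    qed
    show "(\<Union>n. V n) \<subseteq> U"
    proof
      fix x assume "x \<in> (\<Union>n. V n)"
      then obtain n where "x \<in> V n" by auto
      then show "x \<in> U" using V(3)[of n] W(2)[of n] by auto
    qed
    have "emeasure M ((\<Union>n. V n) - A) \<le> emeasure M (\<Union>n. V n - (A \<inter> W n))"
      using V(1) by (intro emeasure_mono) (auto simp: sets)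
    also have "\<dots> \<le> (\<Sum>n. emeasure M (V n - (A \<inter> W n)))"
      using V(1) by (intro emeasure_subadditive_countably) (auto simp: sets)
    also have "\<dots> \<le> (\<Sum>n. ennreal (e * (1 / 2) ^ Suc n))" by (intro suminf_le V(4)) auto
    also have "\<dots> = ennreal e"
      using sums_mult[OF power_half_series, of e] e by (intro suminf_ennreal_eq) auto
    finally show "emeasure M ((\<Union>n. V n) - A) \<le> ennreal e" .
  qed
qed

text \<open>Split \<open>h\<close> at a height \<open>n\<close> above which its integral is below
  e/2; where \<open>h\<close> is at most \<open>n\<close>, a set contributes at most
  \<open>n\<close> times its measure.\<close>

lemma nn_integral_absolutely_continuous:
  fixes h :: "'a \<Rightarrow> real"
  assumes [measurable]: "h \<in> borel_measurable M" and h0: "\<And>x. h x \<ge> 0"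
    and fin: "(\<integral>\<^sup>+x. ennreal (h x) \<partial>M) < \<infinity>" and e: "e > 0"
  obtains d :: real where "d > 0" "\<And>A. A \<in> sets M \<Longrightarrow> emeasure M A < ennreal d \<Longrightarrow> (\<integral>\<^sup>+x\<in>A. ennreal (h x) \<partial>M) < ennreal e"
proof -
  have int: "integrable M h" using fin h0 by (simp add: integrable_iff_bounded)
  have "(\<lambda>n. LINT x|M. h x * indicator {x. h x > real n} x) \<longlonglongrightarrow> (LINT x|M. 0)"
  proof (rule integral_dominated_convergence[OF _ _ int])
    show "AE x in M. (\<lambda>n. h x * indicator {x. h x > real n} x) \<longlonglongrightarrow> 0"
    proof (rule AE_I2, rule tendsto_eventually)
      fix x
      obtain N where "h x \<le> real N" using real_arch_simple by blast
      then show "\<forall>\<^sub>F n in sequentially. h x * indicator {x. h x > real n} x = 0"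
        by (auto simp: eventually_sequentially indicator_def intro!: exI[of _ N])
    qed
  qed (use h0 in \<open>auto simp: indicator_def\<close>)
  then have "eventually (\<lambda>n. (LINT x|M. h x * indicator {x. h x > real n} x) < e / 2) sequentially"
    using e by (intro order_tendstoD(2)) auto
  then obtain n where n: "(LINT x|M. h x * indicator {x. h x > real n} x) < e / 2"
    by (auto simp: eventually_sequentially)
  have int_n: "integrable M (\<lambda>x. h x * indicator {x. h x > real n} x)"
    by (rule Bochner_Integration.integrable_bound[OF int]) (use h0 in \<open>auto simp: indicator_def\<close>)
  have n': "(\<integral>\<^sup>+x. ennreal (h x * indicator {x. h x > real n} x) \<partial>M) < ennreal (e / 2)"
    using n h0 e by (subst nn_integral_eq_integral[OF int_n]) (auto intro!: ennreal_lessI)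
  show ?thesis
  \<comment> \<open>This bounds the lower part by e/4, also for \<open>n = 0\<close>, and e/2 + e/4
    stays strictly below e.\<close>
  proof (rule that[of "e / (4 * (real n + 1))"])
    show "e / (4 * (real n + 1)) > 0" using e by simp
    fix A assume [measurable]: "A \<in> sets M" and A: "emeasure M A < ennreal (e / (4 * (real n + 1)))"
    have "(\<integral>\<^sup>+x\<in>A. ennreal (h x) \<partial>M) \<le>
        (\<integral>\<^sup>+x. ennreal (h x * indicator {x. h x > real n} x) + ennreal (real n) * indicator A x \<partial>M)"
      by (intro nn_integral_mono) (auto simp: indicator_def intro!: ennreal_leI)
    also have "\<dots> = (\<integral>\<^sup>+x. ennreal (h x * indicator {x. h x > real n} x) \<partial>M) + ennreal (real n) * emeasure M A"
      by (subst nn_integral_add) (auto simp: nn_integral_cmult_indicator)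
    also have "\<dots> \<le> ennreal (e / 2) + ennreal (e / 4)"
    proof (rule add_mono)
      have "ennreal (real n) * emeasure M A \<le> ennreal (real n) * ennreal (e / (4 * (real n + 1)))"
        using A by (intro mult_left_mono) auto
      also have "\<dots> = ennreal (real n * (e / (4 * (real n + 1))))" by (rule ennreal_mult'[symmetric]) simp
      also have "\<dots> \<le> ennreal (e / 4)" using e by (intro ennreal_leI) (simp add: field_simps)
      finally show "ennreal (real n) * emeasure M A \<le> ennreal (e / 4)" .
    qed (use n' in auto)
    also have "\<dots> = ennreal (3 * e / 4)" using e by (subst ennreal_plus[symmetric]) auto
    also have "\<dots> < ennreal e" using e by (intro ennreal_lessI) auto
    finally show "(\<integral>\<^sup>+x\<in>A. ennreal (h x) \<partial>M) < ennreal e" .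
  qed
qed

lemma hausdorff_measure_leI:
  assumes "\<And>\<delta>. \<delta> > 0 \<Longrightarrow> hausdorff_premeasure k \<delta> A \<le> c"
  shows "hausdorff_measure k A \<le> c"
  unfolding hausdorff_measure_def using assms by (intro SUP_least) auto

section \<open>Hausdorff measure against Lebesgue measure on a slice\<close>

context rotated_coordinates
begin

text \<open>Each covering set is enclosed in a slab over a coordinate cube centred at one of its points.\<close>

lemma hausdorff_measure_slice_cover:
  assumes k: "card J = k" and E: "hausdorff_measure k E < c"
  obtains A where "A \<in> sets borel" "E \<subseteq> A" "emeasure (slice t) A \<le> ennreal (4 ^ k / unit_ball_vol (real k)) * c"
proof -
  \<comment> \<open>A cube of half-side d has slice measure (2 d)^k, whereas a covering set of
    diameter d costs the volume of the unit ball times (d/2)^k; \<open>K\<close> is the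
    quotient.\<close>
  define K where "K = 4 ^ k / unit_ball_vol (real k)"
  have v: "unit_ball_vol (real k) > 0" by simp
  \<comment> \<open>The scale 1 is arbitrary: a cover at any one scale bounds the slice measure, and
    every premeasure lies below the Hausdorff measure.\<close>
  have "hausdorff_premeasure k 1 E \<le> hausdorff_measure k E"
    unfolding hausdorff_measure_def by (rule SUP_upper) simp
  then have "hausdorff_premeasure k 1 E < c" using E by (rule le_less_trans)
  then obtain C :: "nat \<Rightarrow> _" where C: "E \<subseteq> (\<Union>i. C i)" "\<And>i. bounded (C i)"
      "(\<Sum>i. hausdorff_cost k (C i)) < c"
    unfolding hausdorff_premeasure_def INF_less_iff by auto
  define p where "p i = (SOME x. x \<in> C i)" for i
  define B where "B i = (if C i = {} then {} else
     {x. \<forall>b\<in>J. T b \<bullet> x \<in> {T b \<bullet> p i - diameter (C i) .. T b \<bullet> p i + diameter (C i)}})" for i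
  have Bm [measurable]: "B i \<in> sets borel" for i
  proof -
    have "{x. \<forall>b\<in>J. T b \<bullet> x \<in> {T b \<bullet> p i - diameter (C i) .. T b \<bullet> p i + diameter (C i)}} =
        (\<Inter>b\<in>J. {x. T b \<bullet> p i - diameter (C i) \<le> T b \<bullet> x} \<inter> {x. T b \<bullet> x \<le> T b \<bullet> p i + diameter (C i)})"
      by auto
    also have "closed \<dots>" by (intro closed_INT ballI closed_Int closed_Collect_le continuous_intros)
    finally show ?thesis by (simp add: B_def)
  qed
  have CB: "C i \<subseteq> B i" for i
  proof
    fix x assume x: "x \<in> C i"
    then have p: "p i \<in> C i" unfolding p_def by (rule someI)
    have near: "\<bar>T b \<bullet> x - T b \<bullet> p i\<bar> \<le> diameter (C i)" if "b \<in> J" for b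
    proof -
      have "\<bar>T b \<bullet> (x - p i)\<bar> \<le> norm (T b) * norm (x - p i)" by (rule Cauchy_Schwarz_ineq2)
      also have "\<dots> = dist x (p i)"
        using J_subset[OF that] by (simp add: orthogonal_transformation_norm[OF T] dist_norm)
      also have "\<dots> \<le> diameter (C i)" by (rule diameter_bounded_bound[OF C(2) x p])
      finally show ?thesis by (simp add: inner_diff_right)
    qed
    have "T b \<bullet> p i - diameter (C i) \<le> T b \<bullet> x \<and> T b \<bullet> x \<le> T b \<bullet> p i + diameter (C i)" if "b \<in> J" for b
      using near[OF that] by linarith
    then show "x \<in> B i" using x by (auto simp: B_def)
  qed
  have cost: "emeasure (slice t) (B i) \<le> ennreal K * hausdorff_cost k (C i)" for i
  proof (cases "C i = {}")
    case False
    define d where "d = diameter (C i)"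
    have d: "d \<ge> 0" unfolding d_def by (rule diameter_ge_0[OF C(2)])
    have "emeasure (slice t) (B i) = (\<Prod>b\<in>J. emeasure lborel {T b \<bullet> p i - d .. T b \<bullet> p i + d})"
      using False unfolding B_def d_def by (simp only: if_False) (rule emeasure_slice_box, simp)
    also have "\<dots> = ennreal ((2 * d) ^ k)" using d k by (simp add: ennreal_power)
    also have "(2 * d) ^ k = K * (unit_ball_vol (real k) * (d / 2) ^ k)"
    proof -
      have "(2 * d) ^ k = (4 * (d / 2)) ^ k" by simp
      also have "\<dots> = 4 ^ k * (d / 2) ^ k" by (rule power_mult_distrib)
      finally show ?thesis using less_imp_neq[OF v] by (simp add: K_def)
    qed
    also have "ennreal \<dots> = ennreal K * hausdorff_cost k (C i)"
      using False v d by (subst ennreal_mult) (auto simp: K_def hausdorff_cost_def d_def)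
    finally show ?thesis by simp
  qed (simp add: B_def)
  show ?thesis
  proof (rule that)
    show "(\<Union>i. B i) \<in> sets borel" by measurable
    show "E \<subseteq> (\<Union>i. B i)" using C(1) CB by blast
    have "emeasure (slice t) (\<Union>i. B i) \<le> (\<Sum>i. emeasure (slice t) (B i))"
      by (intro emeasure_subadditive_countably) auto
    also have "\<dots> \<le> (\<Sum>i. ennreal K * hausdorff_cost k (C i))" by (intro suminf_le cost) auto
    also have "\<dots> = ennreal K * (\<Sum>i. hausdorff_cost k (C i))" by (rule ennreal_suminf_cmult)
    also have "\<dots> \<le> ennreal K * c" using C(3) by (intro mult_left_mono) auto
    finally show "emeasure (slice t) (\<Union>i. B i) \<le> ennreal (4 ^ k / unit_ball_vol (real k)) * c"
      by (simp add: K_def)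
  qed
qed

lemma dcube_restrict: "dcube m (restrict z J) = dcube m z"
  by (auto simp: dcube_def)

lemma dcube_eq_of_mem: "y \<in> dcube m (addr m x) \<Longrightarrow> dcube m (addr m y) = dcube m (addr m x)"
  by (auto simp: dcube_def addr_def)

lemma closed_plane: "closed (plane t)"
proof -
  have "plane t = {x. T e\<^sub>0 \<bullet> x = t}" by (simp add: plane_def)
  then show ?thesis by (simp add: closed_hyperplane)
qed

end

section \<open>The Hausdorff measure of images and the energy of the gradient\<close>

context slice_growth
begin

abbreviation energy :: "(real ^ 'n) set \<Rightarrow> (real ^ 'n \<Rightarrow> real) \<Rightarrow> real \<Rightarrow> (real ^ 'n) measure" where
  "energy U g t \<equiv> density (slice t) (\<lambda>x. ennreal (lifted \<phi> (g x)) * indicator U x)"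

definition good_slice :: "(real ^ 'n) set \<Rightarrow> (real ^ 'n \<Rightarrow> real ^ 'm) \<Rightarrow> (real ^ 'n \<Rightarrow> real) \<Rightarrow> real \<Rightarrow> bool" where
  "good_slice U f g t \<longleftrightarrow> (\<forall>i. ibp_slice U (\<lambda>x. f x $ i) g t) \<and>
     (\<forall>K. compact K \<longrightarrow> K \<subseteq> U \<longrightarrow> (\<integral>\<^sup>+x\<in>K. ennreal (lifted \<phi> (g x)) \<partial>slice t) < \<infinity>)"

lemma emeasure_energy:
  assumes "open U" "g \<in> borel_measurable borel" "A \<in> sets borel" "A \<subseteq> U"
  shows "emeasure (energy U g t) A = (\<integral>\<^sup>+x\<in>A. ennreal (lifted \<phi> (g x)) \<partial>slice t)"
proof -
  note [measurable] = assms(2,3)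
  have [measurable]: "U \<in> sets borel" using assms(1) by simp
  show ?thesis
    by (subst emeasure_density) (use assms(4) in \<open>auto simp: indicator_def intro!: nn_integral_cong\<close>)
qed

text \<open>Calderon's estimate bounds the cost of the image of a cube by a measure of the cube,
  which adds up over disjoint cubes. Dyadic cubes are nested or disjoint, so maximal ones cover
  without any overlap. The covering argument works inside an open set; outer regularity then passes
  to Borel sets.\<close>

lemma hausdorff_image_le_energy:
  fixes f :: "real ^ 'n \<Rightarrow> real ^ 'm"
  assumes U: "open U" and f: "continuous_on U f" and good: "good_slice U f g t"
    and g: "g \<in> borel_measurable borel" "\<And>x. g x \<ge> 0"
  shows "\<exists>D\<ge>0. \<forall>E A. E \<subseteq> plane t \<longrightarrow> E \<subseteq> A \<longrightarrow> A \<in> sets borel \<longrightarrow> A \<subseteq> U \<longrightarrow>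
    hausdorff_measure (CARD('n) - 1) (f ` E) \<le> ennreal D * emeasure (energy U g t) A"
proof -
  let ?k = "CARD('n) - 1"
  obtain C where C0: "C \<ge> 0" and C: "\<And>U u g t m z c x y. open U \<Longrightarrow> continuous_on U u \<Longrightarrow> ibp_slice U u g t \<Longrightarrow>
    g \<in> borel_measurable borel \<Longrightarrow> (\<And>x. g x \<ge> 0) \<Longrightarrow> closed_dcube t m z \<subseteq> U \<Longrightarrow> c \<ge> 0 \<Longrightarrow>
    (\<integral>\<^sup>+y\<in>dcube m z. ennreal (lifted \<phi> (g y)) \<partial>slice t) \<le> ennreal c \<Longrightarrow>
    x \<in> dcube m z \<inter> plane t \<Longrightarrow> y \<in> dcube m z \<inter> plane t \<Longrightarrow> \<bar>u x - u y\<bar> \<le> C * root ?k c"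
    using oscillation_estimate by (smt (verit))
  \<comment> \<open>The oscillation estimate is for single components; the norm is at most the sum
    of the \<open>CARD('m)\<close> components.\<close>
  define D0 where "D0 = real CARD('m) * C"
  have D00: "D0 \<ge> 0" using C0 by (simp add: D0_def)
  \<comment> \<open>The cost of a set of diameter \<open>D0\<close> times the \<open>k\<close>-th
    root of \<open>c\<close> is this constant times \<open>c\<close>.\<close>
  define D where "D = unit_ball_vol (real ?k) * (D0 / 2) ^ ?k"
  have D: "D \<ge> 0" using D00 by (simp add: D_def)
  have k0: "?k > 0" using dim by simp
  have "hausdorff_measure ?k (f ` E) \<le> ennreal D * emeasure (energy U g t) A"
    if E: "E \<subseteq> plane t" "E \<subseteq> A" and A: "A \<in> sets borel" "A \<subseteq> U" for E A
  proof (rule hausdorff_measure_leI)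
    fix \<delta> :: real assume \<delta>: "\<delta> > 0"
    note [measurable] = g(1)
    have [measurable]: "plane t \<in> sets borel" using closed_plane by auto
    let ?\<mu> = "energy U g t"
    have fin: "emeasure ?\<mu> K < \<infinity>" if "compact K" "K \<subseteq> U" for K
      using good that compact_imp_closed[OF that(1)] by (subst emeasure_energy[OF U g(1)]) (auto simp: good_slice_def)
    have open_case: "hausdorff_premeasure ?k \<delta> (f ` E) \<le> ennreal D * emeasure ?\<mu> V"
      if V: "open V" "E \<subseteq> V" "V \<subseteq> U" for V
    proof -
      define ok where "ok m x \<longleftrightarrow> closed_dcube t m (addr m x) \<subseteq> V \<and>
        (\<forall>y\<in>dcube m (addr m x) \<inter> plane t. \<forall>y'\<in>dcube m (addr m x) \<inter> plane t. dist (f y) (f y') \<le> \<delta>)" for m x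
      have ok_ex: "\<exists>m. ok m x" if x: "x \<in> E" for x
      proof -
        have xU: "x \<in> U" "x \<in> V" "x \<in> plane t" using x E A V by auto
        obtain d1 where d1: "d1 > 0" "ball x d1 \<subseteq> V" using V(1) xU(2) open_contains_ball by blast
        obtain d2 where d2: "d2 > 0" "\<And>y. y \<in> U \<Longrightarrow> dist y x < d2 \<Longrightarrow> dist (f y) (f x) < \<delta> / 2"
          using f xU(1) \<delta> unfolding continuous_on_iff by (metis half_gt_zero)
        obtain m where m: "\<forall>y\<in>closed_dcube t m (addr m x). dist x y < min d1 d2"
          using closed_dcube_eventually_near[OF xU(3), of "min d1 d2"] d1(1) d2(1) by auto
        have cl: "closed_dcube t m (addr m x) \<subseteq> V"
        proof
          fix y assume "y \<in> closed_dcube t m (addr m x)"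
          then have "dist x y < d1" using m by auto
          then show "y \<in> V" using d1(2) by auto
        qed
        have near: "dist (f y) (f x) < \<delta> / 2" if "y \<in> dcube m (addr m x) \<inter> plane t" for y
        proof (rule d2(2))
          have y: "y \<in> closed_dcube t m (addr m x)" using that dcube_plane_subset_closed by blast
          then show "y \<in> U" using cl V(3) by blast
          show "dist y x < d2" using m y by (metis dist_commute min_less_iff_conj)
        qed
        have "dist (f y) (f y') \<le> \<delta>" if "y \<in> dcube m (addr m x) \<inter> plane t" "y' \<in> dcube m (addr m x) \<inter> plane t" for y y'
          using near[OF that(1)] near[OF that(2)] dist_triangle2[of "f y" "f y'" "f x"] by linarith
        then show ?thesis using cl unfolding ok_def by blast
      qed
      \<comment> \<open>The least admissible generation gives the largest admissible cube around
        \<open>x\<close>.\<close>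
      define mm where "mm x = (LEAST m. ok m x)" for x
      have mm: "ok (mm x) x" if "x \<in> E" for x unfolding mm_def using ok_ex[OF that] by (auto intro: LeastI)
      define Q where "Q x = dcube (mm x) (addr (mm x) x)" for x
      define \<C> where "\<C> = Q ` E"
      have "countable \<C>"
      proof (rule countable_subset)
        show "\<C> \<subseteq> (\<lambda>(m, z). dcube m z) ` (UNIV \<times> (J \<rightarrow>\<^sub>E UNIV))"
        proof
          fix X assume "X \<in> \<C>"
          then obtain x where "X = dcube (mm x) (restrict (addr (mm x) x) J)" by (auto simp: \<C>_def Q_def dcube_restrict)
          then show "X \<in> (\<lambda>(m, z). dcube m z) ` (UNIV \<times> (J \<rightarrow>\<^sub>E UNIV))"
            by (intro image_eqI[of _ _ "(mm x, restrict (addr (mm x) x) J)"]) auto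
        qed
        show "countable ((\<lambda>(m, z). dcube m z) ` ((UNIV :: nat set) \<times> (J \<rightarrow>\<^sub>E (UNIV :: int set))))"
          by (intro countable_image countable_SIGMA countable_PiE) auto
      qed
      have ok_cong: "ok m y" if "y \<in> dcube m (addr m x)" "ok m x" for m x y
      proof -
        have "\<And>b. b \<in> J \<Longrightarrow> addr m y b = addr m x b" using that(1) by (auto simp: dcube_def addr_def)
        then have "closed_dcube t m (addr m y) = closed_dcube t m (addr m x)" by (auto simp: closed_dcube_def)
        then show ?thesis using that(2) unfolding ok_def dcube_eq_of_mem[OF that(1)] by simp
      qed
      \<comment> \<open>If two chosen cubes meet, the coarser one contains the base point of the
        finer one. Admissibility depends only on the cube, so minimality forces equal generations
        and hence equal cubes.\<close>
      have same: "Q x = Q x'" if x: "x \<in> E" "x' \<in> E" and y: "y \<in> Q x" "y \<in> Q x'" and le: "mm x \<le> mm x'" for x x' y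
      proof -
        obtain j where j: "mm x' = mm x + j" using le le_iff_add by blast
        have y': "y \<in> dcube (mm x) (addr (mm x) x')" using y(2) dcube_addr_subset[of "mm x" j x'] by (auto simp: Q_def j)
        have e1: "dcube (mm x) (addr (mm x) y) = Q x" using y(1) dcube_eq_of_mem by (auto simp: Q_def)
        have e2: "dcube (mm x) (addr (mm x) y) = dcube (mm x) (addr (mm x) x')" using y' by (rule dcube_eq_of_mem)
        have "x' \<in> dcube (mm x) (addr (mm x) x)" using addr_self[of x' "mm x"] e1 e2 by (simp add: Q_def)
        then have "ok (mm x) x'" using mm[OF x(1)] by (rule ok_cong)
        then have "mm x' \<le> mm x" unfolding mm_def[of x'] by (rule Least_le)
        then have "mm x' = mm x" using le by simp
        then show ?thesis using e1 e2 by (simp add: Q_def)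
      qed
      have disj: "X = Y" if "X \<in> \<C>" "Y \<in> \<C>" "y \<in> X" "y \<in> Y" for X Y y
        using that same unfolding \<C>_def by (metis imageE nle_le)
      \<comment> \<open>An enumeration of the cubes cut by the hyperplane. Indices that belong to no
        cube give the empty set, whose cost is 0.\<close>
      define F where "F i = \<Union>{X \<in> \<C>. to_nat_on \<C> X = i} \<inter> plane t" for i
      have F: "F i = {} \<or> (\<exists>x\<in>E. F i = Q x \<inter> plane t)" for i
      proof (cases "\<exists>X\<in>\<C>. to_nat_on \<C> X = i")
        case True
        then obtain X where X: "X \<in> \<C>" "to_nat_on \<C> X = i" by blast
        then have "{X \<in> \<C>. to_nat_on \<C> X = i} = {X}" using inj_on_to_nat_on[OF \<open>countable \<C>\<close>] by (auto dest: inj_onD)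
        then show ?thesis using X(1) by (auto simp: F_def \<C>_def)
      next
        case False
        then have emp: "{X \<in> \<C>. to_nat_on \<C> X = i} = {}" by blast
        show ?thesis unfolding F_def emp by simp
      qed
      have FV: "F i \<subseteq> V" for i
      proof -
        have "Q x \<inter> plane t \<subseteq> V" if "x \<in> E" for x
          using mm[OF that] dcube_plane_subset_closed unfolding ok_def Q_def by blast
        then show ?thesis using F[of i] by auto
      qed
      have Fm [measurable]: "F i \<in> sets borel" for i using F[of i] by (auto simp: Q_def)
      have Fd: "disjoint_family F"
        unfolding disjoint_family_on_def F_def using disj by fastforce
      have cost: "hausdorff_cost ?k (f ` F i) \<le> ennreal D * emeasure ?\<mu> (F i)"
        and dia: "bounded (f ` F i) \<and> diameter (f ` F i) \<le> \<delta>" for i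
      proof -
        have "hausdorff_cost ?k (f ` F i) \<le> ennreal D * emeasure ?\<mu> (F i) \<and>
          bounded (f ` F i) \<and> diameter (f ` F i) \<le> \<delta>"
        proof (cases "F i = {}")
          case True
          then show ?thesis using \<delta> by (simp add: hausdorff_cost_def diameter_def)
        next
          case False
          then obtain x where x: "x \<in> E" and Fx: "F i = Q x \<inter> plane t" using F[of i] by blast
          have okx: "ok (mm x) x" by (rule mm[OF x])
          have ne: "f ` F i \<noteq> {}" using False by simp
          have d1: "dist (f y) (f y') \<le> \<delta>" if "y \<in> F i" "y' \<in> F i" for y y'
            using okx that unfolding ok_def Fx Q_def by blast
          have bd: "bounded (f ` F i)"
          proof -
            obtain y0 where "y0 \<in> F i" using False by blast
            then have "f ` F i \<subseteq> cball (f y0) \<delta>" using d1 by auto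
            then show ?thesis using bounded_cball bounded_subset by blast
          qed
          have dd: "diameter (f ` F i) \<le> \<delta>"
            by (rule diameter_le) (use ne d1 in \<open>auto simp: dist_norm\<close>)
          have cl: "closed_dcube t (mm x) (addr (mm x) x) \<subseteq> U" using okx V(3) unfolding ok_def by blast
          \<comment> \<open>The hyperplane carries the whole slice measure, so cutting the cube by
            it leaves the energy unchanged.\<close>
          have eF: "emeasure ?\<mu> (F i) = (\<integral>\<^sup>+y\<in>Q x. ennreal (lifted \<phi> (g y)) \<partial>slice t)"
          proof -
            have "emeasure ?\<mu> (F i) = (\<integral>\<^sup>+y\<in>F i. ennreal (lifted \<phi> (g y)) \<partial>slice t)"
              using FV[of i] V(3) by (intro emeasure_energy[OF U g(1)]) auto
            also have "\<dots> = (\<integral>\<^sup>+y\<in>Q x. ennreal (lifted \<phi> (g y)) \<partial>slice t)"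
              using AE_slice_height[of t]
              by (intro nn_integral_cong_AE, eventually_elim) (auto simp: Fx plane_def indicator_def)
            finally show ?thesis .
          qed
          have "emeasure ?\<mu> (F i) < \<infinity>"
          proof (rule le_less_trans)
            show "emeasure ?\<mu> (F i) \<le> emeasure ?\<mu> (closed_dcube t (mm x) (addr (mm x) x))"
              using dcube_plane_subset_closed compact_imp_closed[OF compact_closed_dcube]
              by (intro emeasure_mono) (auto simp: Fx Q_def)
            show "emeasure ?\<mu> (closed_dcube t (mm x) (addr (mm x) x)) < \<infinity>"
              by (rule fin[OF compact_closed_dcube cl])
          qed
          then obtain c where c: "c \<ge> 0" "emeasure ?\<mu> (F i) = ennreal c"
            by (cases "emeasure ?\<mu> (F i)" rule: ennreal_cases) auto
          have osc: "norm (f y - f y') \<le> D0 * root ?k c" if "y \<in> F i" "y' \<in> F i" for y y'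
          proof -
            have "\<bar>(f y - f y') $ j\<bar> \<le> C * root ?k c" for j
            proof -
              have "\<bar>f y $ j - f y' $ j\<bar> \<le> C * root ?k c"
              proof (rule C[OF U _ _ g cl c(1)])
                show "continuous_on U (\<lambda>x. f x $ j)" using f by (intro continuous_intros)
                show "ibp_slice U (\<lambda>x. f x $ j) g t" using good by (simp add: good_slice_def)
                show "(\<integral>\<^sup>+y\<in>dcube (mm x) (addr (mm x) x). ennreal (lifted \<phi> (g y)) \<partial>slice t) \<le> ennreal c"
                  using eF c(2) by (simp add: Q_def)
              qed (use that in \<open>auto simp: Fx Q_def\<close>)
              then show ?thesis by simp
            qed
            then have "norm (f y - f y') \<le> (\<Sum>j\<in>(UNIV :: 'm set). C * root ?k c)"
              by (intro order_trans[OF norm_le_l1_cart] sum_mono)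
            then show ?thesis by (simp add: D0_def)
          qed
          have "diameter (f ` F i) \<le> D0 * root ?k c"
            by (rule diameter_le) (use ne osc in auto)
          then have "(diameter (f ` F i) / 2) ^ ?k \<le> (D0 * root ?k c / 2) ^ ?k"
            using diameter_ge_0[OF bd] by (intro power_mono) auto
          also have "\<dots> = (D0 / 2) ^ ?k * c"
            using c(1) k0 by (simp add: power_mult_distrib power_divide)
          finally have "unit_ball_vol (real ?k) * (diameter (f ` F i) / 2) ^ ?k \<le> D * c"
            unfolding D_def mult.assoc by (intro mult_left_mono) auto
          then have "hausdorff_cost ?k (f ` F i) \<le> ennreal (D * c)"
            using ne by (simp add: hausdorff_cost_def ennreal_leI)
          also have "\<dots> = ennreal D * emeasure ?\<mu> (F i)" using D c by (simp add: ennreal_mult)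
          finally show ?thesis using bd dd by blast
        qed
        then show "hausdorff_cost ?k (f ` F i) \<le> ennreal D * emeasure ?\<mu> (F i)"
          "bounded (f ` F i) \<and> diameter (f ` F i) \<le> \<delta>" by blast+
      qed
      have cover: "f ` E \<subseteq> (\<Union>i. f ` F i)"
      proof
        fix y assume "y \<in> f ` E"
        then obtain x where x: "x \<in> E" "y = f x" by blast
        have "x \<in> F (to_nat_on \<C> (Q x))"
          using x(1) E(1) addr_self[of x "mm x"] by (auto simp: F_def \<C>_def Q_def)
        then show "y \<in> (\<Union>i. f ` F i)" using x(2) by blast
      qed
      have "hausdorff_premeasure ?k \<delta> (f ` E) \<le> (\<Sum>i. hausdorff_cost ?k (f ` F i))"
        unfolding hausdorff_premeasure_def using cover dia by (intro INF_lower) auto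
      also have "\<dots> \<le> (\<Sum>i. ennreal D * emeasure ?\<mu> (F i))" by (intro suminf_le cost) auto
      also have "\<dots> = ennreal D * (\<Sum>i. emeasure ?\<mu> (F i))" by (rule ennreal_suminf_cmult)
      also have "(\<Sum>i. emeasure ?\<mu> (F i)) = emeasure ?\<mu> (\<Union>i. F i)"
        using Fd by (intro suminf_emeasure) auto
      also have "ennreal D * \<dots> \<le> ennreal D * emeasure ?\<mu> V"
        using FV V(1) by (intro mult_left_mono emeasure_mono) auto
      finally show ?thesis .
    qed
    show "hausdorff_premeasure ?k \<delta> (f ` E) \<le> ennreal D * emeasure ?\<mu> A"
    proof (rule ennreal_le_epsilon)
      fix \<epsilon> :: real assume \<epsilon>: "\<epsilon> > 0"
      \<comment> \<open>The shift by 1 avoids a division by zero when \<open>D\<close> is 0.\<close>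
      have "\<epsilon> / (D + 1) > 0" using \<epsilon> D by simp
      have "sets ?\<mu> = sets borel" by simp
      from outer_regular_locally_finite[OF this U fin A \<open>\<epsilon> / (D + 1) > 0\<close>]
      obtain V where V: "open V" "A \<subseteq> V" "V \<subseteq> U" "emeasure ?\<mu> (V - A) \<le> ennreal (\<epsilon> / (D + 1))" by blast
      have "hausdorff_premeasure ?k \<delta> (f ` E) \<le> ennreal D * emeasure ?\<mu> V"
        using V E by (intro open_case) auto
      also have "emeasure ?\<mu> V = emeasure ?\<mu> A + emeasure ?\<mu> (V - A)"
        using V A by (subst plus_emeasure) (auto simp: Un_absorb1)
      also have "ennreal D * \<dots> \<le> ennreal D * (emeasure ?\<mu> A + ennreal (\<epsilon> / (D + 1)))"
        using V(4) by (intro mult_left_mono add_left_mono) auto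
      also have "\<dots> = ennreal D * emeasure ?\<mu> A + ennreal (D * (\<epsilon> / (D + 1)))"
        using D by (simp add: distrib_left ennreal_mult'[symmetric])
      also have "\<dots> \<le> ennreal D * emeasure ?\<mu> A + ennreal \<epsilon>"
        using D \<epsilon> by (intro add_left_mono ennreal_leI) (simp add: field_simps)
      finally show "hausdorff_premeasure ?k \<delta> (f ` E) \<le> ennreal D * emeasure ?\<mu> A + ennreal \<epsilon>" .
    qed
  qed
  then show ?thesis using D by blast
qed

text \<open>Covers of ever smaller cost enclose \<open>E\<close> in a Borel set that is null for the
  slice measure; the energy has a density with respect to that measure and so vanishes on
  it.\<close>

lemma good_slice_lusin:
  fixes f :: "real ^ 'n \<Rightarrow> real ^ 'm"
  assumes U: "open U" and f: "continuous_on U f" and good: "good_slice U f g t"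
    and g: "g \<in> borel_measurable borel" "\<And>x. g x \<ge> 0"
  shows "lusin_N_on (CARD('n) - 1) (plane t \<inter> U) f"
  unfolding lusin_N_on_def
proof (intro allI impI)
  let ?k = "CARD('n) - 1"
  fix E assume E: "E \<subseteq> plane t \<inter> U" "hausdorff_measure ?k E = 0"
  obtain D where D: "\<And>E A. E \<subseteq> plane t \<Longrightarrow> E \<subseteq> A \<Longrightarrow> A \<in> sets borel \<Longrightarrow> A \<subseteq> U \<Longrightarrow>
    hausdorff_measure ?k (f ` E) \<le> ennreal D * emeasure (energy U g t) A"
    using hausdorff_image_le_energy[OF assms(1-5)] by blast
  note [measurable] = g(1)
  have [measurable]: "U \<in> sets borel" using U by simp
  define K where "K = 4 ^ ?k / unit_ball_vol (real ?k)"
  have K: "K > 0" by (simp add: K_def)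
  have "\<exists>A. A \<in> sets borel \<and> E \<subseteq> A \<and> emeasure (slice t) A \<le> ennreal (K * (1 / real (Suc n)))" for n
  proof -
    have "hausdorff_measure ?k E < ennreal (1 / real (Suc n))" using E(2) by simp
    from hausdorff_measure_slice_cover[OF card_J this, of t]
    obtain A where "A \<in> sets borel" "E \<subseteq> A" "emeasure (slice t) A \<le> ennreal K * ennreal (1 / real (Suc n))"
      unfolding K_def by blast
    moreover have "ennreal K * ennreal (1 / real (Suc n)) = ennreal (K * (1 / real (Suc n)))"
      using K by (intro ennreal_mult[symmetric]) auto
    ultimately show ?thesis by (intro exI[of _ A]) simp
  qed
  then obtain A where A: "\<And>n. A n \<in> sets borel" "\<And>n. E \<subseteq> A n"
      "\<And>n. emeasure (slice t) (A n) \<le> ennreal (K * (1 / real (Suc n)))" by metis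
  note [measurable] = A(1)
  define N where "N = (\<Inter>n. A n) \<inter> U"
  have [measurable]: "N \<in> sets borel" unfolding N_def by measurable
  have "emeasure (slice t) N = 0"
  proof (rule ccontr)
    assume "emeasure (slice t) N \<noteq> 0"
    have le: "emeasure (slice t) N \<le> ennreal (K * (1 / real (Suc n)))" for n
      by (rule order_trans[OF emeasure_mono A(3)[of n]]) (auto simp: N_def)
    have "(\<lambda>n. ennreal (K * (1 / real (Suc n)))) \<longlonglongrightarrow> ennreal (K * 0)"
      by (intro tendsto_ennrealI tendsto_intros LIMSEQ_Suc[OF lim_1_over_n])
    then have "emeasure (slice t) N \<le> ennreal (K * 0)"
      using le by (intro LIMSEQ_le_const) auto
    then show False using \<open>emeasure (slice t) N \<noteq> 0\<close> by simp
  qed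
  then have "N \<in> null_sets (slice t)" by (auto simp: null_sets_def)
  then have "emeasure (energy U g t) N = 0"
    by (subst emeasure_density) (auto simp: nn_integral_null_set)
  moreover have "hausdorff_measure ?k (f ` E) \<le> ennreal D * emeasure (energy U g t) N"
    using E A(2) by (intro D) (auto simp: N_def)
  ultimately show "hausdorff_measure ?k (f ` E) = 0" by simp
qed

lemma good_slice_absolutely_continuous:
  fixes f :: "real ^ 'n \<Rightarrow> real ^ 'm"
  assumes U: "open U" and f: "continuous_on U f" and good: "good_slice U f g t"
    and g: "g \<in> borel_measurable borel" "\<And>x. g x \<ge> 0"
  shows "locally_abs_continuous_on (CARD('n) - 1) (plane t \<inter> U) f"
  unfolding locally_abs_continuous_on_def
proof (intro allI impI)
  let ?k = "CARD('n) - 1"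
  fix K and \<epsilon> :: real assume K: "compact K" "K \<subseteq> plane t \<inter> U" and \<epsilon>: "\<epsilon> > 0"
  obtain D where D0: "D \<ge> 0" and D: "\<And>E A. E \<subseteq> plane t \<Longrightarrow> E \<subseteq> A \<Longrightarrow> A \<in> sets borel \<Longrightarrow> A \<subseteq> U \<Longrightarrow>
    hausdorff_measure ?k (f ` E) \<le> ennreal D * emeasure (energy U g t) A"
    using hausdorff_image_le_energy[OF assms(1-5)] by blast
  note [measurable] = g(1)
  have [measurable]: "K \<in> sets borel" using compact_imp_closed[OF K(1)] by simp
  define V where "V = 4 ^ ?k / unit_ball_vol (real ?k)"
  have V: "V > 0" by (simp add: V_def)
  \<comment> \<open>Cut off to \<open>K\<close>, the density has finite integral, as absolute
    continuity of the integral requires.\<close>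
  define h where "h x = lifted \<phi> (g x) * indicator K x" for x
  have lifted0: "lifted \<phi> s \<ge> 0" for s using nonneg by (simp add: lifted_def)
  have hi: "ennreal (h x) = ennreal (lifted \<phi> (g x)) * indicator K x" for x by (simp add: h_def indicator_def)
  have "(\<integral>\<^sup>+x. ennreal (h x) \<partial>slice t) < \<infinity>" using good K by (simp add: hi good_slice_def)
  moreover have "\<epsilon> / (D + 1) > 0" using \<epsilon> D0 by simp
  moreover have "h \<in> borel_measurable (slice t)" unfolding h_def[abs_def] by measurable
  ultimately obtain d where d: "d > 0"
    "\<And>A. A \<in> sets (slice t) \<Longrightarrow> emeasure (slice t) A < ennreal d \<Longrightarrow> (\<integral>\<^sup>+x\<in>A. ennreal (h x) \<partial>slice t) < ennreal (\<epsilon> / (D + 1))"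
    using lifted0 by (elim nn_integral_absolutely_continuous[rotated 2]) (auto simp: h_def)
  show "\<exists>\<delta>>0. \<forall>E. E \<subseteq> K \<longrightarrow> E \<in> hausdorff_measurable ?k \<longrightarrow> hausdorff_measure ?k E < ennreal \<delta> \<longrightarrow>
      hausdorff_measure ?k (f ` E) < ennreal \<epsilon>"
  \<comment> \<open>\<open>V\<close> is the constant comparing slice measure with Hausdorff measure;
    the half restores strict inequality after the covering step.\<close>
  proof (intro exI[of _ "d / (2 * V)"] conjI allI impI)
    show "d / (2 * V) > 0" using d V by simp
    fix E assume E: "E \<subseteq> K" "hausdorff_measure ?k E < ennreal (d / (2 * V))"
    from hausdorff_measure_slice_cover[OF card_J E(2), of t]
    obtain A where A: "A \<in> sets borel" "E \<subseteq> A" "emeasure (slice t) A \<le> ennreal V * ennreal (d / (2 * V))"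
      unfolding V_def by blast
    note [measurable] = A(1)
    have "ennreal V * ennreal (d / (2 * V)) = ennreal (d / 2)" using V d by (subst ennreal_mult[symmetric]) auto
    also have "\<dots> < ennreal d" using d by (intro ennreal_lessI) auto
    finally have "emeasure (slice t) A < ennreal d" using A(3) by (rule le_less_trans[rotated])
    then have small: "(\<integral>\<^sup>+x\<in>A. ennreal (h x) \<partial>slice t) < ennreal (\<epsilon> / (D + 1))" using A by (intro d) auto
    have "hausdorff_measure ?k (f ` E) \<le> ennreal D * emeasure (energy U g t) (A \<inter> K)"
      using E K A(2) by (intro D) auto
    also have "emeasure (energy U g t) (A \<inter> K) = (\<integral>\<^sup>+x\<in>A \<inter> K. ennreal (lifted \<phi> (g x)) \<partial>slice t)"
      using K by (intro emeasure_energy[OF U g(1)]) auto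
    also have "\<dots> = (\<integral>\<^sup>+x\<in>A. ennreal (h x) \<partial>slice t)"
      unfolding hi by (intro nn_integral_cong) (auto simp: indicator_def)
    also have "ennreal D * \<dots> \<le> ennreal D * ennreal (\<epsilon> / (D + 1))" using small by (intro mult_left_mono) auto
    also have "\<dots> = ennreal (D * (\<epsilon> / (D + 1)))" using D0 \<epsilon> by (subst ennreal_mult) auto
    also have "\<dots> < ennreal \<epsilon>" using D0 \<epsilon> by (intro ennreal_lessI) (auto simp: field_simps)
    finally show "hausdorff_measure ?k (f ` E) < ennreal \<epsilon>" .
  qed
qed

text \<open>\<open>lifted \<phi>\<close> is 0 at 0, so the energy does not charge the Borel set
  where \<open>g\<close> vanishes. Adjoining the null set \<open>N\<close> yields a Borel set of
  energy 0 around the arbitrary set \<open>E\<close>.\<close>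

lemma good_slice_zero_gradient:
  fixes f :: "real ^ 'n \<Rightarrow> real ^ 'm"
  assumes U: "open U" and f: "continuous_on U f" and good: "good_slice U f g t"
    and g: "g \<in> borel_measurable borel" "\<And>x. g x \<ge> 0"
    and N: "N \<in> sets borel" "emeasure (slice t) N = 0"
    and E: "E \<subseteq> plane t \<inter> U" "\<And>x. x \<in> E \<Longrightarrow> x \<in> N \<or> g x = 0"
  shows "hausdorff_measure (CARD('n) - 1) (f ` E) = 0"
proof -
  let ?k = "CARD('n) - 1"
  obtain D where D: "\<And>E A. E \<subseteq> plane t \<Longrightarrow> E \<subseteq> A \<Longrightarrow> A \<in> sets borel \<Longrightarrow> A \<subseteq> U \<Longrightarrow>
    hausdorff_measure ?k (f ` E) \<le> ennreal D * emeasure (energy U g t) A"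
    using hausdorff_image_le_energy[OF assms(1-5)] by blast
  note [measurable] = g(1) N(1)
  have [measurable]: "U \<in> sets borel" using U by simp
  define A where "A = U \<inter> (N \<union> {x. g x = 0})"
  have [measurable]: "A \<in> sets borel" unfolding A_def by measurable
  have "AE x in slice t. x \<notin> N" using N by (intro AE_not_in) (auto simp: null_sets_def)
  then have "AE x in slice t. ennreal (lifted \<phi> (g x)) * indicator A x = 0"
    by eventually_elim (auto simp: A_def lifted_def indicator_def)
  then have "emeasure (energy U g t) A = 0"
    by (subst emeasure_energy[OF U g(1)]) (auto simp: A_def nn_integral_0_iff_AE)
  moreover have "hausdorff_measure ?k (f ` E) \<le> ennreal D * emeasure (energy U g t) A"
    using E by (intro D) (auto simp: A_def)
  ultimately show ?thesis by simp
qed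

text \<open>Finite energy is demanded on all compact subsets of \<open>U\<close>; a countable
  exhaustion that absorbs every compact subset reduces this to countably many conditions, each true
  at almost every height by Fubini.\<close>

lemma AE_good_slice:
  fixes f :: "real ^ 'n \<Rightarrow> real ^ 'm"
  assumes U: "open U" and f: "continuous_on U f" and D: "weak_gradient U f D"
    and int: "(\<lambda>x. \<phi> (gradient_norm (D x))) locally_integrable_on U"
    and g: "g \<in> borel_measurable borel" "\<And>x. g x \<ge> 0"
    and gD: "AE x in lebesgue. x \<in> U \<longrightarrow> norm (D x) = g x"
  shows "AE t in lborel. good_slice U f g t"
proof -
  note [measurable] = g(1)
  have "AE t in lborel. ibp_slice U (\<lambda>x. f x $ i) g t" for i
  proof (rule AE_ibp_slice[OF U _ _ g, where v = "\<lambda>j x. D x $ i $ j"])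
    show "continuous_on U (\<lambda>x. f x $ i)" using f by (intro continuous_intros)
    show "weak_partial U j (\<lambda>x. f x $ i) (\<lambda>x. D x $ i $ j)" for j using D by (simp add: weak_gradient_def)
    fix b assume b: "b \<in> J"
    show "AE x in lebesgue. x \<in> U \<longrightarrow> \<bar>\<Sum>j\<in>UNIV. T b $ j * D x $ i $ j\<bar> \<le> g x"
      using gD
    proof eventually_elim
      case (elim x)
      have "\<bar>\<Sum>j\<in>UNIV. T b $ j * D x $ i $ j\<bar> = \<bar>T b \<bullet> D x $ i\<bar>" by (simp add: inner_vec_def)
      also have "\<dots> \<le> norm (T b) * norm (D x $ i)" by (rule Cauchy_Schwarz_ineq2)
      also have "\<dots> = norm (D x $ i)" using J_subset[OF b] by (simp add: orthogonal_transformation_norm[OF T])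
      also have "\<dots> \<le> norm (D x)" by (rule Finite_Cartesian_Product.norm_nth_le)
      finally have "\<bar>\<Sum>j\<in>UNIV. T b $ j * D x $ i $ j\<bar> \<le> norm (D x)" .
      with elim show ?case by (intro impI) (simp only: simp_thms)
    qed
  qed
  then have 1: "AE t in lborel. \<forall>i. ibp_slice U (\<lambda>x. f x $ i) g t" by (simp add: AE_all_countable)
  obtain C :: "nat \<Rightarrow> _" where C: "\<And>n. compact (C n)" "\<And>n. C n \<subseteq> U"
      "\<And>K. \<lbrakk>compact K; K \<subseteq> U\<rbrakk> \<Longrightarrow> \<exists>N. \<forall>n\<ge>N. K \<subseteq> C n"
    using open_Union_compact_subsets[OF U] by metis
  have [measurable]: "C n \<in> sets borel" for n using compact_imp_closed[OF C(1)] by simp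
  have "AE t in lborel. (\<integral>\<^sup>+x\<in>C n. ennreal (lifted \<phi> (g x)) \<partial>slice t) < \<infinity>" for n
  proof -
    \<comment> \<open>Raising small arguments to 2 costs at most the constant
      \<open>\<phi> 2\<close>, which is integrable on compact sets.\<close>
    have le: "lifted \<phi> s \<le> \<phi> 2 + \<phi> s" if "s \<ge> 0" for s
      using that nonneg[of s] nonneg[of 2] by (auto simp: lifted_def max_def)
    have int_C: "integrable lebesgue (\<lambda>x. indicator (C n) x *\<^sub>R \<phi> (gradient_norm (D x)))"
      using int C by (simp add: locally_integrable_on_def set_integrable_def)
    have "(\<integral>\<^sup>+x\<in>C n. ennreal (lifted \<phi> (g x)) \<partial>lborel) = (\<integral>\<^sup>+x\<in>C n. ennreal (lifted \<phi> (g x)) \<partial>lebesgue)"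
      by (rule nn_integral_completion[symmetric])
    also have "\<dots> \<le> (\<integral>\<^sup>+x. ennreal (\<phi> 2) * indicator (C n) x +
        ennreal (norm (indicator (C n) x *\<^sub>R \<phi> (gradient_norm (D x)))) \<partial>lebesgue)"
    proof (rule nn_integral_mono_AE)
      show "AE x in lebesgue. ennreal (lifted \<phi> (g x)) * indicator (C n) x \<le> ennreal (\<phi> 2) * indicator (C n) x +
        ennreal (norm (indicator (C n) x *\<^sub>R \<phi> (gradient_norm (D x))))"
        using gD
      proof eventually_elim
        case (elim x)
        show ?case
        proof (cases "x \<in> C n")
          case True
          then have "gradient_norm (D x) = g x" using elim C(2) by (auto simp: gradient_norm_eq_norm)
          moreover have "ennreal (lifted \<phi> (g x)) \<le> ennreal (\<phi> 2) + ennreal (\<phi> (g x))"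
          proof -
            have "ennreal (lifted \<phi> (g x)) \<le> ennreal (\<phi> 2 + \<phi> (g x))" by (intro ennreal_leI le g)
            also have "\<dots> = ennreal (\<phi> 2) + ennreal (\<phi> (g x))" using nonneg g(2) by (intro ennreal_plus) auto
            finally show ?thesis .
          qed
          ultimately show ?thesis using True nonneg[OF g(2), of x] by simp
        qed simp
      qed
    qed
    also have "\<dots> = ennreal (\<phi> 2) * emeasure lebesgue (C n) +
        (\<integral>\<^sup>+x. ennreal (norm (indicator (C n) x *\<^sub>R \<phi> (gradient_norm (D x)))) \<partial>lebesgue)"
    proof -
      have "C n \<in> sets lebesgue" by simp
      then have "(\<lambda>x. ennreal (\<phi> 2) * indicator (C n) x) \<in> borel_measurable lebesgue"
        by (intro borel_measurable_times_ennreal borel_measurable_const borel_measurable_indicator)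
      then show ?thesis
        using int_C by (subst nn_integral_add) (auto simp: nn_integral_cmult_indicator)
    qed
    also have "\<dots> < \<infinity>"
      using int_C lmeasurable_compact[OF C(1)[of n]] unfolding integrable_iff_bounded fmeasurable_def
      by (auto simp: ennreal_mult_less_top)
    finally have "(\<integral>\<^sup>+t. (\<integral>\<^sup>+x\<in>C n. ennreal (lifted \<phi> (g x)) \<partial>slice t) \<partial>lborel) < \<infinity>"
      by (subst nn_integral_lborel_slice[symmetric]) auto
    then have "AE t in lborel. (\<integral>\<^sup>+x\<in>C n. ennreal (lifted \<phi> (g x)) \<partial>slice t) \<noteq> \<infinity>"
      by (intro nn_integral_PInf_AE measurable_nn_integral_slice) auto
    then show ?thesis by (simp add: less_top)
  qed
  then have "AE t in lborel. \<forall>n. (\<integral>\<^sup>+x\<in>C n. ennreal (lifted \<phi> (g x)) \<partial>slice t) < \<infinity>"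
    by (simp only: AE_all_countable) blast
  with 1 show ?thesis
  proof eventually_elim
    case (elim t)
    have "(\<integral>\<^sup>+x\<in>K. ennreal (lifted \<phi> (g x)) \<partial>slice t) < \<infinity>" if K: "compact K" "K \<subseteq> U" for K
    proof -
      obtain n where "K \<subseteq> C n" using C(3)[OF K] by blast
      then have "(\<integral>\<^sup>+x\<in>K. ennreal (lifted \<phi> (g x)) \<partial>slice t) \<le> (\<integral>\<^sup>+x\<in>C n. ennreal (lifted \<phi> (g x)) \<partial>slice t)"
        by (intro nn_integral_mono) (auto simp: indicator_def)
      then show ?thesis using elim(2) by (meson le_less_trans)
    qed
    then show ?case using elim(1) by (simp add: good_slice_def)
  qed
qed

end

section \<open>A Borel version of the gradient norm, and the passage from heights to parallel
  hyperplanes\<close>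

lemma ex_borel_gradient_norm:
  fixes U :: "(real ^ 'n) set" and D :: "real ^ 'n \<Rightarrow> real ^ 'n ^ 'm"
  assumes U: "open U" and D: "weak_gradient U f D"
  obtains g where "g \<in> borel_measurable borel" "\<And>x. g x \<ge> 0" "AE x in lebesgue. x \<in> U \<longrightarrow> norm (D x) = g x"
proof -
  have "(\<lambda>x. indicator U x * (D x $ i $ j)) \<in> borel_measurable lebesgue" for i j
    using D by (intro indicator_mult_measurable[OF U]) (auto simp: weak_gradient_def weak_partial_def)
  then have "(\<lambda>x. \<Sum>i\<in>UNIV. \<Sum>j\<in>UNIV. (indicator U x * (D x $ i $ j))\<^sup>2) \<in> borel_measurable lebesgue"
    by (intro borel_measurable_sum borel_measurable_power)
  then have "(\<lambda>x. sqrt (\<Sum>i\<in>UNIV. \<Sum>j\<in>UNIV. (indicator U x * (D x $ i $ j))\<^sup>2)) \<in> borel_measurable lebesgue"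
    by (rule measurable_compose[OF _ borel_measurable_sqrt])
  then obtain g where g: "g \<in> borel_measurable lborel"
    "AE x in lborel. sqrt (\<Sum>i\<in>UNIV. \<Sum>j\<in>UNIV. (indicator U x * (D x $ i $ j))\<^sup>2) = g x"
    using completion_ex_borel_measurable_real by blast
  show ?thesis
  proof (rule that[of "\<lambda>x. \<bar>g x\<bar>"])
    show "(\<lambda>x. \<bar>g x\<bar>) \<in> borel_measurable borel" using g(1) by auto
    show "AE x in lebesgue. x \<in> U \<longrightarrow> norm (D x) = \<bar>g x\<bar>"
      using AE_completion[OF g(2)]
    proof eventually_elim
      case (elim x)
      show ?case
      proof
        assume "x \<in> U"
        then have "g x = norm (D x)" using elim by (simp add: gradient_norm_eq_norm[symmetric] gradient_norm_def)
        then show "norm (D x) = \<bar>g x\<bar>" by simp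
      qed
    qed
  qed simp
qed

lemma AE_lebesgue_shift:
  fixes c :: real
  assumes "AE s in lborel. Q s"
  shows "AE t in lebesgue. Q (c + t)"
proof -
  have "AE s in distr lborel borel ((+) c). Q s" using assms by (simp only: lborel_distr_plus)
  then have "AE t in lborel. Q (c + t)" by (rule AE_distrD[rotated]) simp
  then show ?thesis by (rule AE_completion)
qed

text \<open>Turns the parameter on the line through \<open>p\<close> into the height
  \<open>e \<bullet> p + t\<close>. The inclusion is enough, as all the conclusions are inherited by
  subsets of the level set.\<close>

lemma parallel_subset_plane:
  assumes orth: "\<forall>x\<in>P\<^sub>0. \<forall>y\<in>P\<^sub>0. orthogonal e (x - y)" and par: "affine_parallel P\<^sub>0 P"
    and p: "p + t *\<^sub>R e \<in> P" and e: "norm e = 1"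
  shows "P \<subseteq> {x. e \<bullet> x = e \<bullet> p + t}"
proof
  fix x assume x: "x \<in> P"
  obtain a where a: "P = (\<lambda>x. a + x) ` P\<^sub>0" using par unfolding affine_parallel_def by blast
  obtain x0 p0 where "x = a + x0" "x0 \<in> P\<^sub>0" "p + t *\<^sub>R e = a + p0" "p0 \<in> P\<^sub>0" using x p a by auto
  then have "x - (p + t *\<^sub>R e) = x0 - p0" "orthogonal e (x0 - p0)" using orth by auto
  then have "e \<bullet> (x - (p + t *\<^sub>R e)) = 0" by (simp add: orthogonal_def)
  then show "x \<in> {x. e \<bullet> x = e \<bullet> p + t}" using e by (simp add: inner_diff_right inner_add_right norm_eq_1)
qed

theorem theorem4p2:
  fixes U :: "(real ^ 'n) set"
    and \<phi> :: "real \<Rightarrow> real"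
    and f :: "real ^ 'n \<Rightarrow> real ^ 'm"
    and P\<^sub>0 :: "(real ^ 'n) set"
  assumes "CARD('n) \<ge> 3"
    and "open U"
    and "\<And>t. t \<ge> 0 \<Longrightarrow> \<phi> t \<ge> 0"
    and "mono_on {0..} \<phi>"
    and "\<phi> 0 = 0"
    and "(\<integral>\<^sup>+ t\<in>{1..}. quotient_power \<phi> (1 / (real CARD('n) - 2)) t \<partial>lborel) < \<infinity>"
    and "continuous_on U f"
    and "orlicz_sobolev_loc \<phi> U f"
    and "is_hyperplane P\<^sub>0"
  shows "ae_parallel_hyperplane P\<^sub>0 (\<lambda>P.
           lusin_N_on (CARD('n) - 1) (P \<inter> U) f \<and>
           locally_abs_continuous_on (CARD('n) - 1) (P \<inter> U) f) \<and>
         (\<forall>D. weak_gradient U f D \<longrightarrow>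
           ae_parallel_hyperplane P\<^sub>0 (\<lambda>P.
             \<forall>E. E \<subseteq> P \<inter> U \<longrightarrow> (\<forall>x\<in>E. gradient_norm (D x) = 0) \<longrightarrow>
               hausdorff_measure (CARD('n) - 1) (f ` E) = 0))"
proof -
  let ?k = "CARD('n) - 1"
  obtain D\<^sub>0 where D0: "weak_gradient U f D\<^sub>0"
    and int: "(\<lambda>x. \<phi> (gradient_norm (D\<^sub>0 x))) locally_integrable_on U"
    using assms(8) by (auto simp: orlicz_sobolev_loc_def)
  obtain g where g: "g \<in> borel_measurable borel" "\<And>x. g x \<ge> 0"
    and gD: "AE x in lebesgue. x \<in> U \<longrightarrow> norm (D\<^sub>0 x) = g x"
    using ex_borel_gradient_norm[OF assms(2) D0] by blast
  \<comment> \<open>Any basis vector may serve as \<open>e\<^sub>0\<close>; a rotation carries it to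
    the prescribed normal \<open>e\<close>.\<close>
  have main: "\<exists>T e\<^sub>0. slice_growth T e\<^sub>0 \<phi> \<and> T e\<^sub>0 = e" if e: "norm e = 1" for e :: "real ^ 'n"
  proof -
    define e0 :: "real ^ 'n" where "e0 = axis undefined 1"
    have e0: "e0 \<in> Basis" by (simp add: e0_def axis_in_Basis_iff)
    then have "norm e0 = 1" by simp
    then obtain T where "orthogonal_transformation T" "T e0 = e"
      using orthogonal_transformation_exists_1[OF _ e] by blast
    moreover from this have "slice_growth T e0 \<phi>"
      using assms e0 by unfold_locales auto
    ultimately show ?thesis by blast
  qed
  show ?thesis
  proof (intro conjI allI impI)
    show "ae_parallel_hyperplane P\<^sub>0 (\<lambda>P. lusin_N_on ?k (P \<inter> U) f \<and> locally_abs_continuous_on ?k (P \<inter> U) f)"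
      unfolding ae_parallel_hyperplane_def
    proof (intro allI impI)
      fix p e assume e: "norm e = 1" and orth: "\<forall>x\<in>P\<^sub>0. \<forall>y\<in>P\<^sub>0. orthogonal e (x - y)"
      obtain T e\<^sub>0 where Te: "slice_growth T e\<^sub>0 \<phi>" "T e\<^sub>0 = e" using main[OF e] by blast
      interpret slice_growth T e\<^sub>0 \<phi> by (rule Te(1))
      have "AE t in lebesgue. good_slice U f g (e \<bullet> p + t)"
        by (rule AE_lebesgue_shift[OF AE_good_slice[OF assms(2,7) D0 int g gD]])
      then show "AE t in lebesgue. \<forall>P. affine_parallel P\<^sub>0 P \<longrightarrow> p + t *\<^sub>R e \<in> P \<longrightarrow>
          lusin_N_on ?k (P \<inter> U) f \<and> locally_abs_continuous_on ?k (P \<inter> U) f"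
      proof (eventually_elim, intro allI impI)
        fix t P assume good: "good_slice U f g (e \<bullet> p + t)" and P: "affine_parallel P\<^sub>0 P" "p + t *\<^sub>R e \<in> P"
        have sub: "P \<inter> U \<subseteq> plane (e \<bullet> p + t) \<inter> U"
          using parallel_subset_plane[OF orth P e] by (auto simp: plane_def Te(2))
        have "lusin_N_on ?k (plane (e \<bullet> p + t) \<inter> U) f"
          by (rule good_slice_lusin[OF assms(2,7) good g])
        moreover have "locally_abs_continuous_on ?k (plane (e \<bullet> p + t) \<inter> U) f"
          by (rule good_slice_absolutely_continuous[OF assms(2,7) good g])
        ultimately show "lusin_N_on ?k (P \<inter> U) f \<and> locally_abs_continuous_on ?k (P \<inter> U) f"
          using sub unfolding lusin_N_on_def locally_abs_continuous_on_def by (meson subset_trans)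
      qed
    qed
  next
    fix D assume D: "weak_gradient U f D"
    show "ae_parallel_hyperplane P\<^sub>0 (\<lambda>P. \<forall>E. E \<subseteq> P \<inter> U \<longrightarrow> (\<forall>x\<in>E. gradient_norm (D x) = 0) \<longrightarrow>
               hausdorff_measure ?k (f ` E) = 0)"
      unfolding ae_parallel_hyperplane_def
    proof (intro allI impI)
      fix p e assume e: "norm e = 1" and orth: "\<forall>x\<in>P\<^sub>0. \<forall>y\<in>P\<^sub>0. orthogonal e (x - y)"
      obtain T e\<^sub>0 where Te: "slice_growth T e\<^sub>0 \<phi>" "T e\<^sub>0 = e" using main[OF e] by blast
      interpret slice_growth T e\<^sub>0 \<phi> by (rule Te(1))
      \<comment> \<open>\<open>g\<close> was built from \<open>D\<^sub>0\<close>; uniqueness of weak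
        derivatives, entry by entry, makes it the norm of \<open>D\<close> as well, almost
        everywhere.\<close>
      have "AE x in lebesgue. x \<in> U \<longrightarrow> D x $ i $ j = D\<^sub>0 x $ i $ j" for i j
        using D D0 by (intro weak_partial_unique[OF assms(2), of j "\<lambda>x. f x $ i"]) (auto simp: weak_gradient_def)
      then have "AE x in lebesgue. \<forall>i j. x \<in> U \<longrightarrow> D x $ i $ j = D\<^sub>0 x $ i $ j"
        by (intro AE_all_countable[THEN iffD2] allI)
      with gD have "AE x in lebesgue. x \<in> U \<longrightarrow> norm (D x) = g x"
        by eventually_elim (auto simp: vec_eq_iff[symmetric])
      then have "AE x in lborel. x \<in> U \<longrightarrow> norm (D x) = g x" by (simp add: AE_completion_iff)
      \<comment> \<open>\<open>N\<close>, and with it the exceptional set of hyperplanes, depends on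
        the representative \<open>D\<close>; almost every slice meets it in a null set.\<close>
      then obtain N where N: "{x. \<not> (x \<in> U \<longrightarrow> norm (D x) = g x)} \<subseteq> N" "N \<in> null_sets lborel"
        unfolding eventually_ae_filter by auto
      have Nb: "N \<in> sets borel" using N(2) by auto
      have "AE x in lborel. x \<notin> N" by (rule AE_not_in[OF N(2)])
      then have "AE t in lborel. AE x in slice t. x \<notin> N" by (rule AE_slice)
      moreover have "AE t in lborel. good_slice U f g t" by (rule AE_good_slice[OF assms(2,7) D0 int g gD])
      ultimately have "AE t in lborel. (AE x in slice t. x \<notin> N) \<and> good_slice U f g t" by eventually_elim simp
      then have "AE t in lebesgue. (AE x in slice (e \<bullet> p + t). x \<notin> N) \<and> good_slice U f g (e \<bullet> p + t)"
        by (rule AE_lebesgue_shift)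
      then show "AE t in lebesgue. \<forall>P. affine_parallel P\<^sub>0 P \<longrightarrow> p + t *\<^sub>R e \<in> P \<longrightarrow>
          (\<forall>E. E \<subseteq> P \<inter> U \<longrightarrow> (\<forall>x\<in>E. gradient_norm (D x) = 0) \<longrightarrow> hausdorff_measure ?k (f ` E) = 0)"
      proof (eventually_elim, intro allI impI)
        fix t P E
        assume t: "(AE x in slice (e \<bullet> p + t). x \<notin> N) \<and> good_slice U f g (e \<bullet> p + t)"
          and P: "affine_parallel P\<^sub>0 P" "p + t *\<^sub>R e \<in> P"
          and E: "E \<subseteq> P \<inter> U" "\<forall>x\<in>E. gradient_norm (D x) = 0"
        have sub: "E \<subseteq> plane (e \<bullet> p + t) \<inter> U"
          using parallel_subset_plane[OF orth P e] E(1) by (auto simp: plane_def Te(2))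
        have N0: "emeasure (slice (e \<bullet> p + t)) N = 0"
          using t Nb by (simp add: AE_iff_measurable[of N])
        \<comment> \<open>Points of \<open>E\<close> lie in \<open>U\<close>, so off
          \<open>N\<close> the value of \<open>g\<close> is the norm of \<open>D\<close>, which is 0
          on \<open>E\<close>.\<close>
        have "x \<in> N \<or> g x = 0" if "x \<in> E" for x
          using that E N(1) by (auto simp: gradient_norm_eq_norm)
        then show "hausdorff_measure ?k (f ` E) = 0"
          using t by (intro good_slice_zero_gradient[OF assms(2,7) _ g Nb N0 sub]) auto
      qed
    qed
  qed
qed

end
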